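(* Let $M\in\mathbb{R}$, $M\ge2$, and $a\in L^\infty(0,1)$. Let $\widehat\nu_i$ be defined by iterated minimization as in the context. If $\widehat\nu_i<\big(\frac{M-2}{2}\big)^2$, then the infimum $\widehat\nu_i$ is attained at a function $\psi_i\in\mathcal H_{0,M}$ which satisfies $$\int_0^1r^{M-1}(\psi_i'\varphi'-a\,\psi_i\varphi)\,dr=\widehat\nu_i\int_0^1r^{M-3}\psi_i\varphi\,dr\qquad\text{for every }\varphi\in\mathcal H_{0,M},$$ and therefore is a weak solution to the singular Sturm–Liouville problem $$-(r^{M-1}\psi')'-r^{M-1}a\,\psi=r^{M-3}\,\widehat\nu_i\,\psi\ \text{ in }(0,1),\qquad\psi\in\mathcal H_{0,M}.\tag{S}$$ Conversely, the eigenvalues of problem (S) which are less than $\big(\frac{M-2}{2}\big)^2$ coincide with the numbers $\widehat\nu_i$ so defined.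
   Context: $L^2_M$ is the set of measurable $v:(0,1)\to\mathbb{R}$ with $\int_0^1r^{M-1}v^2dr<\infty$; $H^1_M$ is the set of $v\in L^2_M$ having a first order weak derivative $v'\in L^2_M$ (taken continuous on $(0,1]$); $H^1_{0,M}=\{v\in H^1_M:v(1)=0\}$; $\mathcal L_M$ is the set of measurable $v$ on $(0,1)$ with $\int_0^1r^{M-3}v^2dr<\infty$, with scalar product $\int_0^1r^{M-3}\eta\varphi\,dr$ and related orthogonality $\underline\perp_M$; $\mathcal H_{0,M}=H^1_{0,M}\cap\mathcal L_M$. $\mathcal Q_{a,M}(w)=\int_0^1r^{M-1}(|w'|^2-a w^2)dr$. Iterated minimization: $\widehat\nu_1=\inf\{\mathcal Q_{a,M}(w)/\int_0^1r^{M-3}w^2dr:w\in\mathcal H_{0,M}\setminus\{0\}\}$, and for $i\ge2$, as long as $\widehat\nu_{i-1}<(\frac{M-2}{2})^2$, with $\psi_1,\dots,\psi_{i-1}$ functions attaining $\widehat\nu_1,\dots,\widehat\nu_{i-1}$, $\widehat\nu_i=\inf\{\mathcal Q_{a,M}(w)/\int_0^1r^{M-3}w^2dr:w\in\mathcal H_{0,M}\setminus\{0\},\ w\,\underline\perp_M\,\psi_1,\dots,\psi_{i-1}\}$. A real number $\widehat\nu$ is an eigenvalue of (S) if there is $\psi\in\mathcal H_{0,M}\setminus\{0\}$ with $\int_0^1r^{M-1}(\psi'\varphi'-a\psi\varphi)dr=\widehat\nu\int_0^1r^{M-3}\psi\varphi\,dr$ for all $\varphi\in\mathcal H_{0,M}$.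 *)

theory Defs
  imports "HOL-Analysis.Analysis"
begin

abbreviation unit_ival :: "real measure"
  where "unit_ival \<equiv> lebesgue_on {0<..<1}"

text \<open>
  Elements of the function spaces are functions of type \<open>real \<Rightarrow> real\<close>; only their values on
  the interval (0,1], in general up to null sets, matter.
\<close>

definition L_infty :: "(real \<Rightarrow> real) set"
  where "L_infty = {a \<in> borel_measurable unit_ival. \<exists>C. AE r in unit_ival. \<bar>a r\<bar> \<le> C}"

definition L2_sp :: "real \<Rightarrow> (real \<Rightarrow> real) set"
  where "L2_sp M = {v \<in> borel_measurable unit_ival.
           integrable unit_ival (\<lambda>r. r powr (M - 1) * (v r)\<^sup>2)}"

definition cal_L :: "real \<Rightarrow> (real \<Rightarrow> real) set"
  where "cal_L M = {v \<in> borel_measurable unit_ival.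
           integrable unit_ival (\<lambda>r. r powr (M - 3) * (v r)\<^sup>2)}"

definition inner_L :: "real \<Rightarrow> (real \<Rightarrow> real) \<Rightarrow> (real \<Rightarrow> real) \<Rightarrow> real"
  where "inner_L M \<eta> \<phi> = (\<integral>r. r powr (M - 3) * (\<eta> r * \<phi> r) \<partial>unit_ival)"

definition orth_L :: "real \<Rightarrow> (real \<Rightarrow> real) \<Rightarrow> (real \<Rightarrow> real) \<Rightarrow> bool"
  where "orth_L M \<eta> \<phi> \<longleftrightarrow> inner_L M \<eta> \<phi> = 0"

definition test_fun :: "(real \<Rightarrow> real) set"
  where "test_fun = {\<phi>. (\<forall>n. (deriv ^^ n) \<phi> differentiable_on UNIV) \<and>
           (\<exists>c d. 0 < c \<and> d < 1 \<and> (\<forall>x. x \<notin> {c..d} \<longrightarrow> \<phi> x = 0))}"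

definition loc_integrable :: "(real \<Rightarrow> real) \<Rightarrow> bool"
  where "loc_integrable v \<longleftrightarrow> (\<forall>c d. 0 < c \<longrightarrow> d < 1 \<longrightarrow> integrable (lebesgue_on {c..d}) v)"

definition has_weak_deriv :: "(real \<Rightarrow> real) \<Rightarrow> (real \<Rightarrow> real) \<Rightarrow> bool"
  where "has_weak_deriv v g \<longleftrightarrow> loc_integrable v \<and> loc_integrable g \<and>
           (\<forall>\<phi>\<in>test_fun. (\<integral>r. v r * deriv \<phi> r \<partial>unit_ival) = - (\<integral>r. g r * \<phi> r \<partial>unit_ival))"

text \<open>
  A weak derivative is unique up to null sets, so the choice made here does not influence
  any of the integrals below.
\<close>

definition weak_deriv :: "(real \<Rightarrow> real) \<Rightarrow> real \<Rightarrow> real"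
  where "weak_deriv v = (SOME g. has_weak_deriv v g)"

text \<open>The continuous representative on (0,1] is built in, which gives a meaning to the value at 1.\<close>

definition H1_sp :: "real \<Rightarrow> (real \<Rightarrow> real) set"
  where "H1_sp M = {v \<in> L2_sp M. continuous_on {0<..1} v \<and> (\<exists>g\<in>L2_sp M. has_weak_deriv v g)}"

definition H10_sp :: "real \<Rightarrow> (real \<Rightarrow> real) set"
  where "H10_sp M = {v \<in> H1_sp M. v 1 = 0}"

definition cal_H0 :: "real \<Rightarrow> (real \<Rightarrow> real) set"
  where "cal_H0 M = H10_sp M \<inter> cal_L M"

definition nonzero_fun :: "(real \<Rightarrow> real) \<Rightarrow> bool"
  where "nonzero_fun w \<longleftrightarrow> \<not> (AE r in unit_ival. w r = 0)"

definition Q_form :: "(real \<Rightarrow> real) \<Rightarrow> real \<Rightarrow> (real \<Rightarrow> real) \<Rightarrow> real"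
  where "Q_form a M w =
           (\<integral>r. r powr (M - 1) * (\<bar>weak_deriv w r\<bar>\<^sup>2 - a r * (w r)\<^sup>2) \<partial>unit_ival)"

definition rayleigh :: "(real \<Rightarrow> real) \<Rightarrow> real \<Rightarrow> (real \<Rightarrow> real) \<Rightarrow> real"
  where "rayleigh a M w = Q_form a M w / (\<integral>r. r powr (M - 3) * (w r)\<^sup>2 \<partial>unit_ival)"

text \<open>
  In the iterated minimization, \<open>\<psi> 1, \<psi> 2, \<dots>\<close> are the chosen minimizers (\<open>\<psi> 0\<close> is never used);
  the i-th infimum depends on \<open>\<psi> 1, \<dots>, \<psi> (i - 1)\<close> only.
\<close>

definition competitors :: "real \<Rightarrow> (nat \<Rightarrow> real \<Rightarrow> real) \<Rightarrow> nat \<Rightarrow> (real \<Rightarrow> real) set"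
  where "competitors M \<psi> i =
           {w \<in> cal_H0 M. nonzero_fun w \<and> (\<forall>j\<in>{1..<i}. orth_L M w (\<psi> j))}"

definition nu_hat :: "(real \<Rightarrow> real) \<Rightarrow> real \<Rightarrow> (nat \<Rightarrow> real \<Rightarrow> real) \<Rightarrow> nat \<Rightarrow> real"
  where "nu_hat a M \<psi> i = (INF w\<in>competitors M \<psi> i. rayleigh a M w)"

definition attains :: "(real \<Rightarrow> real) \<Rightarrow> real \<Rightarrow> (nat \<Rightarrow> real \<Rightarrow> real) \<Rightarrow> nat \<Rightarrow> (real \<Rightarrow> real) \<Rightarrow> bool"
  where "attains a M \<psi> i w \<longleftrightarrow> w \<in> competitors M \<psi> i \<and> rayleigh a M w = nu_hat a M \<psi> i"

text \<open>
  The i-th step of the procedure is reached: all earlier infima lie below the threshold and are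
  attained by the chosen functions. Only for such i is \<open>nu_hat a M \<psi> i\<close> one of the numbers
  defined by iterated minimization.
\<close>

definition step_reached :: "(real \<Rightarrow> real) \<Rightarrow> real \<Rightarrow> (nat \<Rightarrow> real \<Rightarrow> real) \<Rightarrow> nat \<Rightarrow> bool"
  where "step_reached a M \<psi> i \<longleftrightarrow> 1 \<le> i \<and>
           (\<forall>j\<in>{1..<i}. nu_hat a M \<psi> j < ((M - 2) / 2)\<^sup>2 \<and> attains a M \<psi> j (\<psi> j))"

text \<open>
  A complete run never stops while the current infimum is below the threshold. Functions
  \<open>\<psi> i\<close> with i beyond the end of the run are unconstrained.
\<close>

definition complete_run :: "(real \<Rightarrow> real) \<Rightarrow> real \<Rightarrow> (nat \<Rightarrow> real \<Rightarrow> real) \<Rightarrow> bool"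
  where "complete_run a M \<psi> \<longleftrightarrow>
           (\<forall>i. step_reached a M \<psi> i \<and> nu_hat a M \<psi> i < ((M - 2) / 2)\<^sup>2 \<longrightarrow> attains a M \<psi> i (\<psi> i))"

definition weak_solution_S :: "(real \<Rightarrow> real) \<Rightarrow> real \<Rightarrow> real \<Rightarrow> (real \<Rightarrow> real) \<Rightarrow> bool"
  where "weak_solution_S a M \<nu> \<psi> \<longleftrightarrow> \<psi> \<in> cal_H0 M \<and>
           (\<forall>\<phi>\<in>cal_H0 M.
              (\<integral>r. r powr (M - 1) * (weak_deriv \<psi> r * weak_deriv \<phi> r - a r * \<psi> r * \<phi> r) \<partial>unit_ival)
              = \<nu> * (\<integral>r. r powr (M - 3) * (\<psi> r * \<phi> r) \<partial>unit_ival))"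

definition eigenvalue_S :: "(real \<Rightarrow> real) \<Rightarrow> real \<Rightarrow> real \<Rightarrow> bool"
  where "eigenvalue_S a M \<nu> \<longleftrightarrow> (\<exists>\<psi>. nonzero_fun \<psi> \<and> weak_solution_S a M \<nu> \<psi>)"

end

theory Submission imports Defs "HOL-Complex_Analysis.Great_Picard" begin

text \<open>
  Let \<open>\<nu>\<close> be one of the infima and assume it lies below the Hardy constant \<open>((M - 2) / 2)\<^sup>2\<close>. On the
  subspace of admissible functions the quadratic form \<open>B = Q - \<nu> \<parallel>\<cdot>\<parallel>\<^sup>2\<close> is nonnegative, and by the Hardy
  inequality it dominates the norm of the energy space up to the term \<open>\<integral> r\<^bsup>M - 1\<^esup> a w\<^sup>2\<close>, which is compact.
  Weak convergence can be avoided: for a minimizing sequence, the parallelogram law and \<open>B \<ge> 0\<close> give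
  \<open>B (w\<^sub>m - w\<^sub>n) \<le> 2 B w\<^sub>m + 2 B w\<^sub>n \<longrightarrow> 0\<close>, so a subsequence along which the compact term converges is a
  Cauchy sequence in the energy norm, and its limit is a minimizer. The Euler equation holds on the
  admissible subspace by a first variation, and on the earlier minimizers by symmetry.

  Conversely, an eigenfunction whose eigenvalue \<open>\<mu>\<close> below the threshold is not among the infima is
  orthogonal to all minimizers, hence admissible at every step, and so every infimum is at most \<open>\<mu>\<close>.
  The procedure then never stops, and the normalized minimizers are an infinite orthonormal sequence
  of bounded energy whose Rayleigh quotients stay below the Hardy constant, against compactness.
\<close>

subsection \<open>Smooth cutoff functions\<close>

text \<open>The compact term carries the weight r^(M-1), and the weight is what matters. Bounded
  energy gives r^(M-2) w^2 \<le> C pointwise. This is a constant majorant for r^(M-1) w^2, but only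
  C/r for r^(M-3) w^2, which is not integrable at 0. Pointwise limits therefore do not control the
  constraint norm, and it has to be recovered from coercivity, where the gap between \<nu> and the
  Hardy constant enters as the factor 1 / (k - \<nu>).

  A second obstacle is the weak derivative. It is tested only against smooth functions supported
  inside (0,1), and \<open>weak_deriv\<close> is an arbitrary choice among almost equal functions.
  Explicit smooth functions exp(-s / ((x-c)(d-x))), which tend to the indicator of (c,d) as s tends
  to 0, turn weak derivatives into indefinite integrals; the Hardy inequality, compactness and
  completeness rest on that representation.\<close>

lemma has_derivative_zero_if_quadratic_bound:
  fixes f :: "real \<Rightarrow> real"
  assumes "\<And>y. \<bar>f y\<bar> \<le> C * (y - x)\<^sup>2"
  shows "(f has_real_derivative 0) (at x)"
proof -
  have fx: "f x = 0" using assms[of x] by simp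
  have "((\<lambda>y. (f y - f x) / (y - x)) \<longlongrightarrow> 0) (at x)"
  proof (rule Lim_null_comparison)
    show "\<forall>\<^sub>F y in at x. norm ((f y - f x) / (y - x)) \<le> C * \<bar>y - x\<bar>"
      unfolding eventually_at_filter
    proof (intro always_eventually allI impI)
      fix y assume "y \<noteq> x"
      then have "\<bar>f y\<bar> / \<bar>y - x\<bar> \<le> C * (y - x)\<^sup>2 / \<bar>y - x\<bar>"
        using assms[of y] by (intro divide_right_mono) auto
      also have "\<dots> = C * \<bar>y - x\<bar>"
      proof -
        have "C * z\<^sup>2 / z = C * z" if "z \<noteq> 0" for z :: real
          using that by (simp add: power2_eq_square)
        from this[of "\<bar>y - x\<bar>"] \<open>y \<noteq> x\<close> show ?thesis by simp
      qed
      finally show "norm ((f y - f x) / (y - x)) \<le> C * \<bar>y - x\<bar>"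
        by (simp add: fx abs_divide)
    qed
    show "((\<lambda>y. C * \<bar>y - x\<bar>) \<longlongrightarrow> 0) (at x)"
      by (rule tendsto_eq_intros refl | simp)+
  qed
  then show ?thesis by (simp add: has_field_derivative_iff)
qed

text \<open>For \<open>c < d\<close> it is positive exactly on (c,d) and has simple zeros at both
  ends. As a polynomial it keeps the numerators of all derivatives of \<open>bump\<close>
  polynomial.\<close>

definition bump_den :: "real \<Rightarrow> real \<Rightarrow> real poly"
  where "bump_den c d = [:- c, 1:] * [:d, - 1:]"

text \<open>
  This family is closed under differentiation, with \<open>m\<close> replaced by \<open>m + 2\<close>; hence its members are smooth.
\<close>

definition bump :: "real \<Rightarrow> real \<Rightarrow> real \<Rightarrow> real poly \<Rightarrow> nat \<Rightarrow> real \<Rightarrow> real"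
  where "bump c d s p m x = (if c < x \<and> x < d
     then poly p x / poly (bump_den c d) x ^ m * exp (- s / poly (bump_den c d) x) else 0)"

text \<open>With K = \<open>bump_den c d\<close>, this is the derivative of p K^(-m) exp(-s/K) over
  the common denominator K^(m+2), exponential factor removed.\<close>

definition bump_deriv_num :: "real \<Rightarrow> real \<Rightarrow> real \<Rightarrow> real poly \<Rightarrow> nat \<Rightarrow> real poly"
  where "bump_deriv_num c d s p m = pderiv p * (bump_den c d)\<^sup>2
     - smult (real m) (bump_den c d * p * pderiv (bump_den c d)) + smult s (p * pderiv (bump_den c d))"

lemma bump_den: "poly (bump_den c d) x = (x - c) * (d - x)"
  by (simp add: bump_den_def algebra_simps)

lemma pderiv_bump_den: "poly (pderiv (bump_den c d)) x = c + d - 2 * x"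
  by (simp add: bump_den_def pderiv_mult pderiv_pCons algebra_simps)

text \<open>One term of the exponential series, of order m + 2, bounds exp(s/t) from below. The two
  orders beyond m leave the factor t^2 that differentiability at the zeros of
  \<open>bump_den\<close> needs.\<close>

lemma exp_neg_inverse_le:
  fixes s t :: real
  assumes "s > 0" "t > 0"
  shows "exp (- s / t) / t ^ m \<le> fact (m + 2) / s ^ (m + 2) * t\<^sup>2"
proof -
  have "(s / t) ^ (m + 2) / fact (m + 2) \<le> exp (s / t)"
  proof -
    have sm: "summable (\<lambda>n. (s / t) ^ n / fact n)"
      using summable_exp[of "s / t"] by (simp add: divide_inverse mult.commute)
    have "(\<Sum>n\<in>{m + 2}. (s / t) ^ n / fact n) \<le> (\<Sum>n. (s / t) ^ n / fact n)"
      by (rule sum_le_suminf[OF sm]) (use assms in auto)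
    then show ?thesis
      by (simp add: exp_def divide_inverse mult.commute)
  qed
  then have "exp (- (s / t)) \<le> fact (m + 2) / (s / t) ^ (m + 2)"
    using assms by (simp add: exp_minus divide_simps mult.commute del: fact_Suc)
  then have "exp (- (s / t)) / t ^ m \<le> fact (m + 2) / (s / t) ^ (m + 2) / t ^ m"
    using assms by (intro divide_right_mono) auto
  also have "\<dots> = fact (m + 2) / s ^ (m + 2) * t\<^sup>2"
    using assms by (simp add: power_divide power_add power2_eq_square field_simps del: fact_Suc)
  finally show ?thesis by simp
qed

text \<open>Quadratic decay at either endpoint, stated for all y, so that the derivative at c and d
  is 0 without one-sided limits.\<close>

lemma bump_quadratic_bound:
  assumes "c < d" "s > 0"
  obtains C where "\<And>y. \<bar>bump c d s p m y\<bar> \<le> C * (y - c)\<^sup>2" "\<And>y. \<bar>bump c d s p m y\<bar> \<le> C * (y - d)\<^sup>2"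
proof -
  have "bounded (poly p ` {c..d})"
    by (intro compact_imp_bounded compact_continuous_image continuous_intros) auto
  then obtain B where B: "\<And>y. y \<in> {c..d} \<Longrightarrow> \<bar>poly p y\<bar> \<le> B" and "B > 0"
    unfolding bounded_pos by (metis imageI real_norm_def)
  define C where "C = B * (fact (m + 2) / s ^ (m + 2)) * (d - c)\<^sup>2"
  have C0: "C \<ge> 0" using \<open>B > 0\<close> assms by (simp add: C_def)
  have main: "\<bar>bump c d s p m y\<bar> \<le> B * (fact (m + 2) / s ^ (m + 2) * ((y - c) * (d - y))\<^sup>2)" if y: "c < y" "y < d" for y
  proof -
    have t: "(y - c) * (d - y) > 0" using y by simp
    have "\<bar>bump c d s p m y\<bar> = \<bar>poly p y\<bar> * (exp (- s / ((y - c) * (d - y))) / ((y - c) * (d - y)) ^ m)"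
      using y t by (simp add: bump_def bump_den abs_mult abs_divide power_abs)
    also have "\<dots> \<le> B * (fact (m + 2) / s ^ (m + 2) * ((y - c) * (d - y))\<^sup>2)"
      using y B[of y] \<open>B > 0\<close> t by (intro mult_mono exp_neg_inverse_le assms) auto
    finally show ?thesis .
  qed
  have sq: "((y - c) * (d - y))\<^sup>2 \<le> (d - c)\<^sup>2 * (y - c)\<^sup>2" "((y - c) * (d - y))\<^sup>2 \<le> (d - c)\<^sup>2 * (y - d)\<^sup>2"
    if y: "c < y" "y < d" for y
  proof -
    have "(d - y)\<^sup>2 \<le> (d - c)\<^sup>2" "(y - c)\<^sup>2 \<le> (d - c)\<^sup>2"
      using y by (auto intro!: power_mono)
    then show "((y - c) * (d - y))\<^sup>2 \<le> (d - c)\<^sup>2 * (y - c)\<^sup>2" "((y - c) * (d - y))\<^sup>2 \<le> (d - c)\<^sup>2 * (y - d)\<^sup>2"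
      using mult_right_mono[of "(d - y)\<^sup>2" "(d - c)\<^sup>2" "(y - c)\<^sup>2"]
        mult_right_mono[of "(y - c)\<^sup>2" "(d - c)\<^sup>2" "(d - y)\<^sup>2"]
      by (simp_all add: power_mult_distrib mult.commute[of "(y - c)\<^sup>2"] power2_commute[of y d])
  qed
  show ?thesis
  proof
    fix y
    show "\<bar>bump c d s p m y\<bar> \<le> C * (y - c)\<^sup>2"
    proof (cases "c < y \<and> y < d")
      case True
      then have "\<bar>bump c d s p m y\<bar> \<le> B * (fact (m + 2) / s ^ (m + 2) * ((d - c)\<^sup>2 * (y - c)\<^sup>2))"
        using assms \<open>B > 0\<close> by (intro order_trans[OF main] mult_left_mono sq) auto
      then show ?thesis by (simp only: C_def mult.assoc)
    qed (use C0 in \<open>auto simp: bump_def\<close>)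
    show "\<bar>bump c d s p m y\<bar> \<le> C * (y - d)\<^sup>2"
    proof (cases "c < y \<and> y < d")
      case True
      then have "\<bar>bump c d s p m y\<bar> \<le> B * (fact (m + 2) / s ^ (m + 2) * ((d - c)\<^sup>2 * (y - d)\<^sup>2))"
        using assms \<open>B > 0\<close> by (intro order_trans[OF main] mult_left_mono sq) auto
      then show ?thesis by (simp only: C_def mult.assoc)
    qed (use C0 in \<open>auto simp: bump_def\<close>)
  qed
qed

lemma bump_has_derivative:
  assumes "c < d" "s > 0"
  shows "(bump c d s p m has_real_derivative bump c d s (bump_deriv_num c d s p m) (m + 2) x) (at x)"
proof -
  consider "c < x \<and> x < d" | "x < c \<or> d < x" | "x = c \<or> x = d" by linarith
  then show ?thesis
  proof cases
    case 1
    define K where "K = bump_den c d"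
    have K0: "poly K x \<noteq> 0" using 1 by (simp add: K_def bump_den)
    have "((\<lambda>y. poly p y / poly K y ^ m * exp (- s / poly K y)) has_real_derivative
       bump c d s (bump_deriv_num c d s p m) (m + 2) x) (at x)"
    proof -
      have e: "bump c d s (bump_deriv_num c d s p m) (m + 2) x =
        (poly (pderiv p) x * (poly K x)\<^sup>2 - real m * (poly K x * poly p x * poly (pderiv K) x)
          + s * (poly p x * poly (pderiv K) x)) / poly K x ^ (m + 2) * exp (- s / poly K x)"
        using 1 by (simp add: bump_def bump_deriv_num_def K_def)
      show ?thesis
        unfolding e
      \<comment> \<open>The power rule applies to an exponent \<open>Suc m'\<close>; for exponent 0
        the denominator is the constant 1 and the middle term of the numerator vanishes.\<close>
      proof (cases m)
        case 0
        show "((\<lambda>y. poly p y / poly K y ^ m * exp (- s / poly K y)) has_real_derivative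
          (poly (pderiv p) x * (poly K x)\<^sup>2 - real m * (poly K x * poly p x * poly (pderiv K) x)
          + s * (poly p x * poly (pderiv K) x)) / poly K x ^ (m + 2) * exp (- s / poly K x)) (at x)"
          using K0 unfolding 0
          by (auto intro!: derivative_eq_intros simp: field_simps power2_eq_square)
      next
        case (Suc m')
        have "((\<lambda>y. poly p y / poly K y ^ Suc m' * exp (- s / poly K y)) has_real_derivative
          ((poly (pderiv p) x * poly K x ^ Suc m' - poly p x * (real (Suc m') * poly K x ^ m' * poly (pderiv K) x))
            / (poly K x ^ Suc m' * poly K x ^ Suc m')) * exp (- s / poly K x)
          + poly p x / poly K x ^ Suc m' * (exp (- s / poly K x) * (s * poly (pderiv K) x / (poly K x * poly K x)))) (at x)"
        proof (rule DERIV_mult[THEN DERIV_cong])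
          show "((\<lambda>y. poly p y / poly K y ^ Suc m') has_real_derivative
            (poly (pderiv p) x * poly K x ^ Suc m' - poly p x * (real (Suc m') * poly K x ^ m' * poly (pderiv K) x))
              / (poly K x ^ Suc m' * poly K x ^ Suc m')) (at x)"
            by (rule DERIV_divide[THEN DERIV_cong, OF poly_DERIV DERIV_power_Suc[OF poly_DERIV]])
              (use K0 in \<open>auto simp: algebra_simps\<close>)
          show "((\<lambda>y. exp (- s / poly K y)) has_real_derivative
            exp (- s / poly K x) * (s * poly (pderiv K) x / (poly K x * poly K x))) (at x)"
            using K0 by (auto intro!: derivative_eq_intros)
        qed (simp add: mult_ac)
        also have "((poly (pderiv p) x * poly K x ^ Suc m' - poly p x * (real (Suc m') * poly K x ^ m' * poly (pderiv K) x))
            / (poly K x ^ Suc m' * poly K x ^ Suc m')) * exp (- s / poly K x)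
          + poly p x / poly K x ^ Suc m' * (exp (- s / poly K x) * (s * poly (pderiv K) x / (poly K x * poly K x)))
          = (poly (pderiv p) x * (poly K x)\<^sup>2 - real (Suc m') * (poly K x * poly p x * poly (pderiv K) x)
          + s * (poly p x * poly (pderiv K) x)) / poly K x ^ (Suc m' + 2) * exp (- s / poly K x)"
          using K0 by (simp add: divide_simps power2_eq_square) (simp add: algebra_simps)
        finally show "((\<lambda>y. poly p y / poly K y ^ m * exp (- s / poly K y)) has_real_derivative
          (poly (pderiv p) x * (poly K x)\<^sup>2 - real m * (poly K x * poly p x * poly (pderiv K) x)
          + s * (poly p x * poly (pderiv K) x)) / poly K x ^ (m + 2) * exp (- s / poly K x)) (at x)"
          unfolding Suc .
      qed
    qed
    then show ?thesis
      by (rule has_field_derivative_transform_within_open[of _ _ _ "{c<..<d}"])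
        (use 1 in \<open>auto simp: bump_def K_def\<close>)
  next
    case 2
    have "((\<lambda>y. 0) has_real_derivative 0) (at x)" by simp
    then have "(bump c d s p m has_real_derivative 0) (at x)"
      by (rule has_field_derivative_transform_within_open[of _ _ _ "- {c..d}"])
        (use 2 in \<open>auto simp: bump_def\<close>)
    moreover have "bump c d s (bump_deriv_num c d s p m) (m + 2) x = 0"
      using 2 by (auto simp: bump_def)
    ultimately show ?thesis by simp
  next
    case 3
    obtain C where "\<And>y. \<bar>bump c d s p m y\<bar> \<le> C * (y - c)\<^sup>2" "\<And>y. \<bar>bump c d s p m y\<bar> \<le> C * (y - d)\<^sup>2"
      using bump_quadratic_bound[OF assms] by blast
    with 3 have "(bump c d s p m has_real_derivative 0) (at x)"
      using has_derivative_zero_if_quadratic_bound by blast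
    moreover have "bump c d s (bump_deriv_num c d s p m) (m + 2) x = 0"
      using 3 by (auto simp: bump_def)
    ultimately show ?thesis by simp
  qed
qed

lemma deriv_bump:
  assumes "c < d" "s > 0"
  shows "deriv (bump c d s p m) = bump c d s (bump_deriv_num c d s p m) (m + 2)"
  using bump_has_derivative[OF assms] by (auto simp: fun_eq_iff intro: DERIV_imp_deriv)

lemma deriv_funpow_bump:
  assumes "c < d" "s > 0"
  shows "\<exists>p' m'. (deriv ^^ n) (bump c d s p m) = bump c d s p' m'"
proof (induction n)
  case 0
  show ?case by auto
next
  case (Suc n)
  then show ?case using deriv_bump[OF assms] by (metis comp_apply funpow.simps(2))
qed

lemma bump_in_test_fun:
  assumes "0 < c" "c < d" "d < 1" "s > 0"
  shows "bump c d s p m \<in> test_fun"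
  unfolding test_fun_def
proof (intro CollectI conjI allI)
  fix n
  obtain p' m' where "(deriv ^^ n) (bump c d s p m) = bump c d s p' m'"
    using deriv_funpow_bump[OF assms(2,4)] by blast
  then show "(deriv ^^ n) (bump c d s p m) differentiable_on UNIV"
    using bump_has_derivative[OF assms(2,4)]
    by (metis differentiable_at_imp_differentiable_on real_differentiable_def)
  show "\<exists>c' d'. 0 < c' \<and> d' < 1 \<and> (\<forall>x. x \<notin> {c'..d'} \<longrightarrow> bump c d s p m x = 0)"
    using assms by (intro exI[of _ c] exI[of _ d]) (auto simp: bump_def)
qed

text \<open>The exponent parameter s = 1 / (n + 1) tends to 0, so the exponential factor tends to 1
  at every point of (c,d).\<close>

abbreviation cutoff :: "real \<Rightarrow> real \<Rightarrow> nat \<Rightarrow> real \<Rightarrow> real"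
  where "cutoff c d n \<equiv> bump c d (1 / Suc n) 1 0"

lemma cutoff_bounds: "0 \<le> cutoff c d n x" "cutoff c d n x \<le> 1"
  by (auto simp: bump_def bump_den)

lemma cutoff_tendsto_indicator: "(\<lambda>n. cutoff c d n x) \<longlonglongrightarrow> indicator {c<..<d} x"
proof (cases "c < x \<and> x < d")
  case True
  have "(\<lambda>n. exp (- (inverse (real (Suc n))) / ((x - c) * (d - x)))) \<longlonglongrightarrow> exp (- 0 / ((x - c) * (d - x)))"
    by (intro tendsto_intros LIMSEQ_inverse_real_of_nat) (use True in auto)
  with True show ?thesis by (simp add: bump_def bump_den inverse_eq_divide)
qed (auto simp: bump_def)

lemma continuous_on_bump:
  assumes "c < d" "s > 0"
  shows "continuous_on A (bump c d s p m)"
  using bump_has_derivative[OF assms] by (meson DERIV_continuous_on has_field_derivative_at_within)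

lemma deriv_cutoff:
  assumes "c < d"
  shows "deriv (cutoff c d n) x = (if c < x \<and> x < d
    then (c + d - 2 * x) / (real (Suc n) * ((x - c) * (d - x))\<^sup>2) * exp (- (1 / Suc n) / ((x - c) * (d - x))) else 0)"
proof -
  have "bump_deriv_num c d (1 / Suc n) 1 0 = smult (1 / Suc n) (pderiv (bump_den c d))"
    by (simp add: bump_deriv_num_def)
  then show ?thesis
    using assms by (simp add: deriv_bump bump_def bump_den pderiv_bump_den power2_eq_square)
qed

lemma cutoff_FTC:
  assumes "c < d" "a \<le> b"
  shows "(deriv (cutoff c d n) has_integral (cutoff c d n b - cutoff c d n a)) {a..b}"
  using assms bump_has_derivative[of c d "1 / Suc n" 1 0]
  by (intro fundamental_theorem_of_calculus)
    (auto simp: deriv_bump simp flip: has_real_derivative_iff_has_vector_derivative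
      intro: has_field_derivative_at_within)

lemma continuous_on_deriv_cutoff:
  assumes "c < d"
  shows "continuous_on A (deriv (cutoff c d n))"
  using assms by (simp add: deriv_bump continuous_on_bump)

text \<open>The sign of the derivative is that of c + d - 2x: the cutoff rises from 0 to its value
  at the midpoint, at most 1, and falls back to 0. Its total variation is thus bounded uniformly in
  n.\<close>

lemma integral_abs_deriv_cutoff_le:
  assumes "c < d"
  shows "integral {c..d} (\<lambda>x. \<bar>deriv (cutoff c d n) x\<bar>) \<le> 2"
proof -
  let ?m = "(c + d) / 2"
  have int: "(\<lambda>x. \<bar>deriv (cutoff c d n) x\<bar>) integrable_on {a..b}" for a b
    by (intro integrable_continuous_real continuous_intros continuous_on_deriv_cutoff assms)
  have "integral {c..d} (\<lambda>x. \<bar>deriv (cutoff c d n) x\<bar>) =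
      integral {c..?m} (\<lambda>x. \<bar>deriv (cutoff c d n) x\<bar>) + integral {?m..d} (\<lambda>x. \<bar>deriv (cutoff c d n) x\<bar>)"
    using assms int by (intro Henstock_Kurzweil_Integration.integral_combine[symmetric]) auto
  also have "integral {c..?m} (\<lambda>x. \<bar>deriv (cutoff c d n) x\<bar>) = integral {c..?m} (deriv (cutoff c d n))"
    using assms by (intro integral_cong) (auto simp: deriv_cutoff simp del: of_nat_Suc)
  also have "\<dots> = cutoff c d n ?m - cutoff c d n c"
    using assms by (intro integral_unique cutoff_FTC) auto
  also have "integral {?m..d} (\<lambda>x. \<bar>deriv (cutoff c d n) x\<bar>) = integral {?m..d} (\<lambda>x. - deriv (cutoff c d n) x)"
    using assms by (intro integral_cong) (auto simp: deriv_cutoff abs_if mult_less_0_iff divide_less_0_iff zero_less_mult_iff simp del: of_nat_Suc)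
  also have "\<dots> = - (cutoff c d n d - cutoff c d n ?m)"
    using assms by (intro integral_unique has_integral_neg cutoff_FTC) auto
  finally show ?thesis
    using cutoff_bounds[where c=c and d=d and n=n] by (smt (verit))
qed

subsection \<open>Absolute continuity and weak derivatives\<close>

abbreviation LI :: "real \<Rightarrow> real \<Rightarrow> (real \<Rightarrow> real) \<Rightarrow> real"
  where "LI a b f \<equiv> integral\<^sup>L (lebesgue_on {a..b}) f"

lemma continuous_imp_measurable_lebesgue_on_interval:
  "continuous_on {a..b} g \<Longrightarrow> (g :: real \<Rightarrow> real) \<in> borel_measurable (lebesgue_on {a..b})"
  by (simp add: continuous_imp_measurable_on_sets_lebesgue)

lemma integrable_mult_bounded:
  fixes f g :: "'a \<Rightarrow> real"
  assumes f: "integrable N f" and g: "g \<in> borel_measurable N" and b: "AE x in N. \<bar>g x\<bar> \<le> B"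
  shows "integrable N (\<lambda>x. f x * g x)"
proof (rule Bochner_Integration.integrable_bound)
  show "integrable N (\<lambda>x. B * \<bar>f x\<bar>)" using f by simp
  show "(\<lambda>x. f x * g x) \<in> borel_measurable N" using f g by measurable
  show "AE x in N. norm (f x * g x) \<le> norm (B * \<bar>f x\<bar>)"
    using b
  proof eventually_elim
    case (elim x)
    then have "\<bar>f x\<bar> * \<bar>g x\<bar> \<le> \<bar>f x\<bar> * B" by (intro mult_left_mono) auto
    also have "\<dots> \<le> norm (B * \<bar>f x\<bar>)" by (simp add: mult.commute)
    finally show ?case by (simp add: abs_mult)
  qed
qed

lemma integrable_mult_continuous:
  fixes f g :: "real \<Rightarrow> real"
  assumes f: "integrable (lebesgue_on {a..b}) f" and g: "continuous_on {a..b} g"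
  shows "integrable (lebesgue_on {a..b}) (\<lambda>x. f x * g x)"
proof -
  have "bounded (g ` {a..b})"
    by (intro compact_imp_bounded compact_continuous_image g) auto
  then obtain B where "\<And>x. x \<in> {a..b} \<Longrightarrow> \<bar>g x\<bar> \<le> B"
    unfolding bounded_iff by (metis imageI real_norm_def)
  then show ?thesis
    by (intro integrable_mult_bounded[OF f continuous_imp_measurable_lebesgue_on_interval[OF g], of B])
      (auto intro!: AE_I2)
qed

section \<open>Indefinite integrals and their product rule\<close>

lemma continuous_on_if_indefinite_integral:
  assumes "integrable (lebesgue_on {a..b}) f" "\<And>x. x \<in> {a..b} \<Longrightarrow> F x = F a + LI a x f"
  shows "continuous_on {a..b} F"
proof -
  have "continuous_on {a..b} (\<lambda>x. F a + LI a x f)"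
    by (intro continuous_intros indefinite_integral_continuous_real assms)
  then show ?thesis
    by (rule continuous_on_eq) (simp flip: assms(2))
qed

lemma LI_diff:
  assumes "integrable (lebesgue_on {a..b}) f" "\<And>x. x \<in> {a..b} \<Longrightarrow> F x = F a + LI a x f"
    "a \<le> x" "x \<le> y" "y \<le> b"
  shows "F y - F x = LI x y f"
proof -
  have "integrable (lebesgue_on {a..y}) f"
    by (rule integrable_subinterval[OF assms(1)]) (use assms in auto)
  from Equivalence_Measurable_On_Borel.integral_combine[OF this, of x] assms(2)[of x] assms(2)[of y] assms(3-)
  show ?thesis by simp
qed

text \<open>
  The defect of the product rule is additive in the interval, and on short intervals it is at most
  \<open>\<epsilon>\<close> times the integral of \<open>\<bar>f\<bar> + \<bar>g\<bar>\<close>.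
\<close>

lemma product_rule_indefinite_integral:
  assumes ab: "a \<le> b"
    and f: "integrable (lebesgue_on {a..b}) f" and F: "\<And>x. x \<in> {a..b} \<Longrightarrow> F x = F a + LI a x f"
    and g: "integrable (lebesgue_on {a..b}) g" and G: "\<And>x. x \<in> {a..b} \<Longrightarrow> G x = G a + LI a x g"
  shows "integrable (lebesgue_on {a..b}) (\<lambda>x. f x * G x + g x * F x)" (is "integrable _ ?h")
    and "F b * G b - F a * G a = LI a b (\<lambda>x. f x * G x + g x * F x)"
proof -
  have cF: "continuous_on {a..b} F" and cG: "continuous_on {a..b} G"
    using continuous_on_if_indefinite_integral[OF f F] continuous_on_if_indefinite_integral[OF g G] by auto
  have int: "integrable (lebesgue_on {x..y}) f" "integrable (lebesgue_on {x..y}) g"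
    "continuous_on {x..y} F" "continuous_on {x..y} G" if "a \<le> x" "y \<le> b" for x y
    using integrable_subinterval[OF f] integrable_subinterval[OF g] that
      continuous_on_subset[OF cF] continuous_on_subset[OF cG] by auto
  have ih: "integrable (lebesgue_on {x..y}) (\<lambda>x. f x * G x + g x * F x)" if "a \<le> x" "y \<le> b" for x y
    using int[OF that] by (intro Bochner_Integration.integrable_add integrable_mult_continuous)
  then show "integrable (lebesgue_on {a..b}) ?h" by simp
  have ia: "integrable (lebesgue_on {x..y}) (\<lambda>x. \<bar>f x\<bar> + \<bar>g x\<bar>)" if "a \<le> x" "y \<le> b" for x y
    using int[OF that] by auto
  define E where "E x y = F y * G y - F x * G x - LI x y ?h" for x y
  define N where "N x y = LI x y (\<lambda>x. \<bar>f x\<bar> + \<bar>g x\<bar>)" for x y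
  have small: "\<bar>E a b\<bar> \<le> e * N a b" if e: "e > 0" for e
  proof -
    \<comment> \<open>The guard is needed because the local case of Bolzano's principle also ranges
      over intervals around x that leave [a,b].\<close>
    define P where "P x y \<longleftrightarrow> (a \<le> x \<and> y \<le> b \<longrightarrow> \<bar>E x y\<bar> \<le> e * N x y)" for x y
    have "P a b"
      using ab
    proof (induction rule: Bolzano)
      case (trans x y z)
      show ?case
        unfolding P_def
      proof
        assume xz: "a \<le> x \<and> z \<le> b"
        then have "E x z = E x y + E y z" "N x z = N x y + N y z"
          using Equivalence_Measurable_On_Borel.integral_combine[OF ih[of x z], of y]
            Equivalence_Measurable_On_Borel.integral_combine[OF ia[of x z], of y] trans(3,4)
          by (auto simp: E_def N_def)
        moreover have "\<bar>E x y\<bar> \<le> e * N x y" "\<bar>E y z\<bar> \<le> e * N y z"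
          using trans xz by (auto simp: P_def)
        ultimately show "\<bar>E x z\<bar> \<le> e * N x z" by (simp add: distrib_left)
      qed
    next
      case (local x)
      then have x: "x \<in> {a..b}" by simp
      obtain d1 where d1: "d1 > 0" "\<And>y. y \<in> {a..b} \<Longrightarrow> dist y x < d1 \<Longrightarrow> dist (F y) (F x) < e / 2"
        using cF x e unfolding continuous_on_iff by (metis half_gt_zero)
      obtain d2 where d2: "d2 > 0" "\<And>y. y \<in> {a..b} \<Longrightarrow> dist y x < d2 \<Longrightarrow> dist (G y) (G x) < e / 2"
        using cG x e unfolding continuous_on_iff by (metis half_gt_zero)
      show ?case
        unfolding P_def
      proof (intro exI[of _ "min d1 d2"] conjI allI impI)
        show "min d1 d2 > 0" using d1 d2 by simp
        fix u v assume uv: "u \<le> x \<and> x \<le> v \<and> v - u < min d1 d2" and ab': "a \<le> u \<and> v \<le> b"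
        have osc: "\<bar>F t - F x\<bar> \<le> e / 2" "\<bar>G t - G x\<bar> \<le> e / 2" if "t \<in> {u..v}" for t
        proof -
          have "t \<in> {a..b}" "dist t x < d1" "dist t x < d2"
            using uv ab' that by (auto simp: dist_real_def)
          then show "\<bar>F t - F x\<bar> \<le> e / 2" "\<bar>G t - G x\<bar> \<le> e / 2"
            using d1(2)[of t] d2(2)[of t] by (auto simp: dist_real_def)
        qed
        note i = int[of u v] ih[of u v]
        \<comment> \<open>Freezing G at the right end and F at the left end makes the increment an
          exact integral. The defect \<open>E u v\<close> then contains only the oscillations
          \<open>G v - G t\<close> and \<open>F u - F t\<close>.\<close>
        have "F v * G v - F u * G u = (F v - F u) * G v + (G v - G u) * F u"
          by (simp add: algebra_simps)
        also have "\<dots> = LI u v (\<lambda>t. f t * G v) + LI u v (\<lambda>t. g t * F u)"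
          using LI_diff[OF f F, of u v] LI_diff[OF g G, of u v] uv ab' by simp
        also have "\<dots> = LI u v (\<lambda>t. f t * G v + g t * F u)"
          using i ab' by simp
        finally have eq: "E u v = LI u v (\<lambda>t. (f t * G v + g t * F u) - (f t * G t + g t * F t))"
          unfolding E_def using i ab' by (subst Bochner_Integration.integral_diff) auto
        have "\<bar>E u v\<bar> \<le> LI u v (\<lambda>t. e * (\<bar>f t\<bar> + \<bar>g t\<bar>))"
          unfolding eq
        proof (rule integral_abs_bound_integral)
          show "integrable (lebesgue_on {u..v}) (\<lambda>t. e * (\<bar>f t\<bar> + \<bar>g t\<bar>))"
            using ia[of u v] ab' by simp
          show "integrable (lebesgue_on {u..v}) (\<lambda>t. (f t * G v + g t * F u) - (f t * G t + g t * F t))"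
            using i ab' by (intro Bochner_Integration.integrable_diff) auto
          fix t assume "t \<in> space (lebesgue_on {u..v})"
          then have t: "t \<in> {u..v}" by simp
          have "(f t * G v + g t * F u) - (f t * G t + g t * F t) = f t * (G v - G t) + g t * (F u - F t)"
            by (simp add: algebra_simps)
          also have "\<bar>\<dots>\<bar> \<le> \<bar>f t\<bar> * \<bar>G v - G t\<bar> + \<bar>g t\<bar> * \<bar>F u - F t\<bar>"
            using abs_triangle_ineq[of "f t * (G v - G t)" "g t * (F u - F t)"] by (simp only: abs_mult)
          also have "\<dots> \<le> \<bar>f t\<bar> * e + \<bar>g t\<bar> * e"
          proof (intro add_mono mult_left_mono abs_ge_zero)
            have "u \<in> {u..v}" "v \<in> {u..v}" using uv by auto
            then show "\<bar>G v - G t\<bar> \<le> e" "\<bar>F u - F t\<bar> \<le> e"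
              using osc[OF t] osc[of v] osc[of u] by linarith+
          qed
          finally show "\<bar>(f t * G v + g t * F u) - (f t * G t + g t * F t)\<bar> \<le> e * (\<bar>f t\<bar> + \<bar>g t\<bar>)"
            by (simp add: algebra_simps)
        qed
        then show "\<bar>E u v\<bar> \<le> e * N u v" by (simp add: N_def)
      qed
    qed
    then show ?thesis by (simp add: P_def)
  qed
  have N0: "N a b \<ge> 0" by (simp add: N_def)
  have "\<bar>E a b\<bar> \<le> e" if "e > 0" for e
  proof -
    have "e / (N a b + 1) * N a b \<le> e"
      using that N0 by (simp add: pos_divide_le_eq add_nonneg_pos algebra_simps)
    with small[of "e / (N a b + 1)"] that N0 show ?thesis
      by (meson add_nonneg_pos divide_pos_pos order_trans zero_less_one)
  qed
  then have "E a b = 0"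
    by (metis abs_le_zero_iff dense_ge)
  then show "F b * G b - F a * G a = LI a b ?h" by (simp add: E_def)
qed

section \<open>Functions whose integrals over intervals vanish\<close>

lemma sigma_finite_lebesgue: "sigma_finite_measure (lebesgue :: 'a::euclidean_space measure)"
proof
  obtain A :: "'a set set" where "countable A" "A \<subseteq> sets lborel" "\<Union>A = space lborel"
    "\<forall>a\<in>A. emeasure lborel a \<noteq> \<infinity>"
    using lborel.sigma_finite_countable by blast
  then show "\<exists>A::'a set set. countable A \<and> A \<subseteq> sets lebesgue \<and> \<Union>A = space lebesgue \<and>
      (\<forall>a\<in>A. emeasure lebesgue a \<noteq> \<infinity>)"
    by (intro exI[of _ A]) (auto simp: subset_iff)
qed

text \<open>A Dynkin class argument: the half-lines are stable under intersection and generate the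
  Borel sets, and the sets over which f integrates to 0 are closed under complement (as the total
  integral is 0) and countable disjoint union. Null sets carry this over to Lebesgue sets, and then
  the density f vanishes.\<close>

lemma AE_zero_if_initial_integrals_zero:
  fixes f :: "real \<Rightarrow> real"
  assumes f: "integrable lebesgue f" and 0: "(\<integral>x. f x \<partial>lebesgue) = 0"
    and init: "\<And>a. (LINT x:{..a}|lebesgue. f x) = 0"
  shows "AE x in lebesgue. f x = 0"
proof -
  have si: "set_integrable lebesgue A f" if "A \<in> sets lebesgue" for A
    using f that unfolding set_integrable_def by (simp add: integrable_real_mult_indicator mult.commute)
  have borel: "(LINT x:A|lebesgue. f x) = 0" if "A \<in> sets borel" for A
  proof -
    have sb: "sigma_sets UNIV (range (\<lambda>a::real. {..a})) = sets borel"
      by (simp add: borel_eq_atMost)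
    have st: "Int_stable (range (\<lambda>a::real. {..a}))"
      by (auto simp: Int_stable_def)
    have sub: "range (\<lambda>a::real. {..a}) \<subseteq> Pow UNIV" by simp
    have "A \<in> sigma_sets UNIV (range (\<lambda>a::real. {..a}))"
      using that by (simp add: sb)
    then show ?thesis
    proof (induction rule: sigma_sets_induct_disjoint[OF st sub, consumes 1, case_names basic empty compl union])
      case (basic A)
      then show ?case using init by auto
    next
      case empty
      show ?case by (simp add: set_lebesgue_integral_def)
    next
      case (compl A)
      then have A: "A \<in> sets lebesgue" by (simp add: sb)
      have "(\<integral>x. f x \<partial>lebesgue) = (LINT x:A \<union> (UNIV - A)|lebesgue. f x)"
        by (simp add: set_lebesgue_integral_def)
      also have "\<dots> = (LINT x:A|lebesgue. f x) + (LINT x:UNIV - A|lebesgue. f x)"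
        using A by (intro set_integral_Un si) auto
      finally show ?case using 0 compl by simp
    next
      case (union A)
      then have "A i \<in> sets lebesgue" for i by (auto simp: sb)
      then have "(LINT x:(\<Union>i. A i)|lebesgue. f x) = (\<Sum>i. (LINT x:(A i)|lebesgue. f x))"
        using union(1) by (intro lebesgue_integral_countable_add si) (auto simp: disjoint_family_on_def)
      then show ?case using union by simp
    qed
  qed
  show ?thesis
  proof (rule sigma_finite_measure.density_zero[OF sigma_finite_lebesgue f])
    fix A :: "real set" assume "A \<in> sets lebesgue"
    \<comment> \<open>A Lebesgue set is a Borel set up to part of a null set, which does not change
      the integral.\<close>
    then obtain S N N' where A: "A = S \<union> N" "N \<subseteq> N'" "N' \<in> null_sets lborel" "S \<in> sets lborel"
      by (auto elim: sets_completionE)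
    then have "N' \<in> null_sets lebesgue" by (simp add: null_sets_completionI)
    then have "AE x in lebesgue. x \<notin> N'" by (rule AE_not_in)
    then have "(LINT x:A|lebesgue. f x) = (LINT x:S|lebesgue. f x)"
      unfolding set_lebesgue_integral_def
    proof (intro integral_cong_AE borel_measurable_integrable[OF si[unfolded set_integrable_def]])
      show "AE x in lebesgue. indicat_real A x *\<^sub>R f x = indicat_real S x *\<^sub>R f x"
        using \<open>AE x in lebesgue. x \<notin> N'\<close>
        by eventually_elim (use A(1,2) in \<open>auto simp: indicator_def\<close>)
    qed (use \<open>A \<in> sets lebesgue\<close> A(4) in auto)
    then show "(LINT x:A|lebesgue. f x) = 0" using borel A(4) by simp
  qed
qed

text \<open>After extension of h by 0 outside [c,d], every initial integral is one over
  [c, min a d]: zero by hypothesis, or over at most one point. Countably many intervals [c,d]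
  exhaust (0,1).\<close>

lemma AE_zero_if_interval_integrals_zero:
  assumes h: "\<And>c d. 0 < c \<Longrightarrow> c < d \<Longrightarrow> d < 1 \<Longrightarrow> integrable (lebesgue_on {c..d}) h \<and> LI c d h = 0"
  shows "AE x in unit_ival. h x = 0"
proof -
  have key: "AE x in lebesgue. x \<in> {c..d} \<longrightarrow> h x = 0" if cd: "0 < c" "c < d" "d < 1" for c d
  proof -
    let ?f = "\<lambda>x. if x \<in> {c..d} then h x else 0"
    have "AE x in lebesgue. ?f x = 0"
    proof (rule AE_zero_if_initial_integrals_zero)
      show "integrable lebesgue ?f"
        using h[OF cd] by (intro iffD2[OF Lebesgue_Measure.integrable_restrict_UNIV]) auto
      show "(\<integral>x. ?f x \<partial>lebesgue) = 0"
        using h[OF cd] by (subst Lebesgue_Measure.integral_restrict_UNIV) auto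
      fix a
      have "(LINT x:{..a}|lebesgue. ?f x) = (\<integral>x. (if x \<in> {c..min a d} then h x else 0) \<partial>lebesgue)"
        unfolding set_lebesgue_integral_def
        by (intro Bochner_Integration.integral_cong) (auto simp: indicator_def)
      also have "\<dots> = LI c (min a d) h"
        by (subst Lebesgue_Measure.integral_restrict_UNIV) auto
      also have "\<dots> = 0"
      proof (cases "c < min a d")
        case True
        then show ?thesis using h[of c "min a d"] cd by simp
      next
        case False
        then have "{c..min a d} \<subseteq> {c}" by auto
        then have "{c..min a d} \<in> null_sets lebesgue"
          by (metis null_sets_completionI null_sets_subset finite_imp_null_set_lborel finite.emptyI finite.insertI finite_subset)
        then show ?thesis by (rule integral_eq_zero_null_sets)
      qed
      finally show "(LINT x:{..a}|lebesgue. ?f x) = 0" .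
    qed
    then show ?thesis by eventually_elim auto
  qed
  \<comment> \<open>The shift by 3 makes every interval nondegenerate; with n + 2 the one for n = 0
    would be the point 1/2.\<close>
  have "AE x in lebesgue. \<forall>n::nat. x \<in> {1 / (real n + 3)..1 - 1 / (real n + 3)} \<longrightarrow> h x = 0"
    unfolding AE_all_countable by (intro allI key) (auto simp: field_simps)
  then have "AE x in lebesgue. x \<in> {0<..<1} \<longrightarrow> h x = 0"
  proof eventually_elim
    case (elim x)
    show ?case
    proof
      assume x: "x \<in> {0<..<1}"
      define e where "e = min x (1 - x)"
      have "e > 0" using x by (simp add: e_def)
      then obtain n where n: "1 / real (Suc n) < e" using nat_approx_posE by blast
      have "1 / (real n + 3) \<le> 1 / real (Suc n)" by (simp add: divide_simps)
      with n have "1 / (real n + 3) < e" by linarith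
      then have "x \<in> {1 / (real n + 3)..1 - 1 / (real n + 3)}" by (auto simp: e_def)
      with elim show "h x = 0" by blast
    qed
  qed
  then show ?thesis by (simp add: AE_restrict_space_iff)
qed

lemma unit_integral_eq_LI:
  assumes "0 < c" "d < 1" "\<And>x. x \<notin> {c..d} \<Longrightarrow> f x = 0"
  shows "(\<integral>x. f x \<partial>unit_ival) = LI c d f"
proof -
  have "(\<integral>x. f x \<partial>unit_ival) = (\<integral>x. (if x \<in> {c..d} then f x else 0) \<partial>unit_ival)"
    using assms by (intro Bochner_Integration.integral_cong) auto
  also have "\<dots> = LI c d f"
    using assms by (intro Lebesgue_Measure.integral_restrict) auto
  finally show ?thesis .
qed

lemma cutoff_LI_tendsto:
  assumes g: "integrable (lebesgue_on {c..d}) g" and "c < d"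
  shows "(\<lambda>n. LI c d (\<lambda>x. g x * cutoff c d n x)) \<longlonglongrightarrow> LI c d g"
proof (rule integral_dominated_convergence[where w = "\<lambda>x. \<bar>g x\<bar>"])
  show "(\<lambda>x. g x * cutoff c d n x) \<in> borel_measurable (lebesgue_on {c..d})" for n
    using assms by (intro borel_measurable_integrable integrable_mult_continuous continuous_on_bump) auto
  show "AE x in lebesgue_on {c..d}. norm (g x * cutoff c d n x) \<le> \<bar>g x\<bar>" for n
    using cutoff_bounds[of c d n] by (intro AE_I2) (auto simp: abs_mult intro: mult_left_le)
  \<comment> \<open>All cutoffs vanish at c and d, so pointwise convergence to g may fail
    there.\<close>
  have "AE x in lebesgue. x \<notin> {c, d}"
    by (intro AE_not_in null_sets_completionI finite_imp_null_set_lborel) auto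
  then show "AE x in lebesgue_on {c..d}. (\<lambda>n. g x * cutoff c d n x) \<longlonglongrightarrow> g x"
    unfolding AE_restrict_space_iff[of "{c..d}" lebesgue, simplified]
  proof eventually_elim
    case (elim x)
    show ?case
      using tendsto_mult[OF tendsto_const[of "g x"] cutoff_tendsto_indicator[of c d x]] elim
      by (auto simp: indicator_def)
  qed
qed (use g in auto)

lemma LI_eq_integral:
  "continuous_on {a..b} f \<Longrightarrow> LI a b f = integral {a..b} f"
  by (simp add: lebesgue_integral_eq_integral continuous_imp_integrable_real)

lemma FTC_LI:
  assumes "a \<le> b" "continuous_on {a..b} f'" "\<And>x. x \<in> {a..b} \<Longrightarrow> (f has_real_derivative f' x) (at x)"
  shows "f b = f a + LI a b f'"
  using fundamental_theorem_of_calculus[OF assms(1), of f f'] assms(2,3)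
  by (simp add: LI_eq_integral integral_unique has_vector_derivative_at_within
      has_real_derivative_iff_has_vector_derivative)

text \<open>
  For polynomials this is integration by parts; the general case follows by uniform approximation,
  since the derivatives of the cutoffs are bounded in the mean.
\<close>

lemma deriv_cutoff_LI_tendsto:
  assumes v: "continuous_on {c..d} v" and cd: "c < d"
  shows "(\<lambda>n. LI c d (\<lambda>x. v x * deriv (cutoff c d n) x)) \<longlonglongrightarrow> v c - v d"
proof (rule LIMSEQ_I)
  fix e :: real assume e: "e > 0"
  \<comment> \<open>The error e / 8 costs e / 4 in the integral, by the variation bound 2, and e / 8
    at each endpoint. With e / 4 from the limit for p the sum stays below e.\<close>
  obtain p where "real_polynomial_function p" and pv: "\<And>x. x \<in> {c..d} \<Longrightarrow> \<bar>v x - p x\<bar> < e / 8"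
    using Stone_Weierstrass_real_polynomial_function[OF _ v, of "e / 8"] e by auto
  then obtain p' where p': "real_polynomial_function p'" "\<And>x. (p has_real_derivative p' x) (at x)"
    using has_real_derivative_polynomial_function by blast
  have cp: "continuous_on A p" "continuous_on A p'" for A
    using \<open>real_polynomial_function p\<close> p'(1)
    by (simp_all add: continuous_on_polymonial_function real_polynomial_function_eq)
  have ccut: "continuous_on A (deriv (cutoff c d n))" "continuous_on A (cutoff c d n)" for A n
    using cd by (auto intro: continuous_on_deriv_cutoff continuous_on_bump simp del: of_nat_Suc)
  have dcut: "(cutoff c d n has_real_derivative deriv (cutoff c d n) x) (at x)" for n x
    using bump_has_derivative[OF cd, of "1 / real (Suc n)" 1 0 x] cd
    by (subst deriv_bump) (simp_all del: of_nat_Suc)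
  have parts: "LI c d (\<lambda>x. p x * deriv (cutoff c d n) x) = - LI c d (\<lambda>x. p' x * cutoff c d n x)" for n
  proof -
    have P: "p x = p c + LI c x p'" if "x \<in> {c..d}" for x
      by (rule FTC_LI) (use that cp p'(2) in \<open>auto\<close>)
    have C: "cutoff c d n x = cutoff c d n c + LI c x (deriv (cutoff c d n))" if "x \<in> {c..d}" for x
      using that by (intro FTC_LI ccut dcut) auto
    have "p d * cutoff c d n d - p c * cutoff c d n c
        = LI c d (\<lambda>x. p' x * cutoff c d n x + deriv (cutoff c d n) x * p x)"
      by (rule product_rule_indefinite_integral(2)[OF less_imp_le[OF cd]
            continuous_imp_integrable_real[OF cp(2)] P continuous_imp_integrable_real[OF ccut(1)] C])
    also have "\<dots> = LI c d (\<lambda>x. p' x * cutoff c d n x) + LI c d (\<lambda>x. deriv (cutoff c d n) x * p x)"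
      by (intro Bochner_Integration.integral_add continuous_imp_integrable_real continuous_intros cp ccut)
    finally show ?thesis by (simp add: bump_def mult.commute)
  qed
  have "(\<lambda>n. - LI c d (\<lambda>x. p' x * cutoff c d n x)) \<longlonglongrightarrow> - LI c d p'"
    by (intro tendsto_minus cutoff_LI_tendsto continuous_imp_integrable_real cp cd)
  moreover have "p d = p c + LI c d p'"
    by (rule FTC_LI) (use cd cp p'(2) in auto)
  ultimately have "(\<lambda>n. LI c d (\<lambda>x. p x * deriv (cutoff c d n) x)) \<longlonglongrightarrow> p c - p d"
    by (simp add: parts del: of_nat_Suc)
  from LIMSEQ_D[OF this, of "e / 4"] e obtain N where
    N: "\<And>n. n \<ge> N \<Longrightarrow> \<bar>LI c d (\<lambda>x. p x * deriv (cutoff c d n) x) - (p c - p d)\<bar> < e / 4" by auto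
  show "\<exists>N. \<forall>n\<ge>N. norm (LI c d (\<lambda>x. v x * deriv (cutoff c d n) x) - (v c - v d)) < e"
  proof (intro exI allI impI)
    fix n assume n: "n \<ge> N"
    have i: "integrable (lebesgue_on {c..d}) (\<lambda>x. v x * deriv (cutoff c d n) x)"
      "integrable (lebesgue_on {c..d}) (\<lambda>x. p x * deriv (cutoff c d n) x)"
      by (intro continuous_imp_integrable_real continuous_intros v cp ccut)+
    have eq: "LI c d (\<lambda>x. v x * deriv (cutoff c d n) x) - LI c d (\<lambda>x. p x * deriv (cutoff c d n) x)
      = LI c d (\<lambda>x. v x * deriv (cutoff c d n) x - p x * deriv (cutoff c d n) x)"
      using i by simp
    have "\<bar>LI c d (\<lambda>x. v x * deriv (cutoff c d n) x) - LI c d (\<lambda>x. p x * deriv (cutoff c d n) x)\<bar>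
      \<le> LI c d (\<lambda>x. e / 8 * \<bar>deriv (cutoff c d n) x\<bar>)"
      unfolding eq
    proof (rule integral_abs_bound_integral)
      show "integrable (lebesgue_on {c..d}) (\<lambda>x. v x * deriv (cutoff c d n) x - p x * deriv (cutoff c d n) x)"
        using i by simp
      show "integrable (lebesgue_on {c..d}) (\<lambda>x. e / 8 * \<bar>deriv (cutoff c d n) x\<bar>)"
        by (intro continuous_imp_integrable_real continuous_intros ccut)
      fix x assume "x \<in> space (lebesgue_on {c..d})"
      then have "\<bar>v x - p x\<bar> \<le> e / 8" using pv[of x] by simp
      then have "\<bar>v x - p x\<bar> * \<bar>deriv (cutoff c d n) x\<bar> \<le> e / 8 * \<bar>deriv (cutoff c d n) x\<bar>"
        by (rule mult_right_mono) simp
      then show "\<bar>v x * deriv (cutoff c d n) x - p x * deriv (cutoff c d n) x\<bar> \<le> e / 8 * \<bar>deriv (cutoff c d n) x\<bar>"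
        by (simp only: abs_mult flip: left_diff_distrib)
    qed
    also have "\<dots> = e / 8 * integral {c..d} (\<lambda>x. \<bar>deriv (cutoff c d n) x\<bar>)"
      by (simp add: LI_eq_integral continuous_on_rabs ccut del: of_nat_Suc)
    also have "\<dots> \<le> e / 8 * 2"
      using e by (intro mult_left_mono integral_abs_deriv_cutoff_le cd) auto
    finally have "\<bar>LI c d (\<lambda>x. v x * deriv (cutoff c d n) x) - LI c d (\<lambda>x. p x * deriv (cutoff c d n) x)\<bar> \<le> e / 8 * 2" .
    moreover have "\<bar>v c - p c\<bar> < e / 8" "\<bar>v d - p d\<bar> < e / 8" using pv cd by auto
    ultimately show "norm (LI c d (\<lambda>x. v x * deriv (cutoff c d n) x) - (v c - v d)) < e"
      using N[OF n] unfolding real_norm_def by linarith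
  qed
qed


text \<open>Local absolute continuity of v on the open interval with derivative g, in integral form.
  The endpoint 1 is left out because test functions vanish near it.\<close>

definition AC_repr :: "(real \<Rightarrow> real) \<Rightarrow> (real \<Rightarrow> real) \<Rightarrow> bool"
  where "AC_repr v g \<longleftrightarrow> loc_integrable g \<and> (\<forall>c d. 0 < c \<longrightarrow> c \<le> d \<longrightarrow> d < 1 \<longrightarrow> v d = v c + LI c d g)"

lemma AC_reprD: "AC_repr v g \<Longrightarrow> 0 < c \<Longrightarrow> c \<le> d \<Longrightarrow> d < 1 \<Longrightarrow> v d = v c + LI c d g"
  unfolding AC_repr_def by blast

lemma has_weak_derivD:
  "has_weak_deriv v g \<Longrightarrow> \<phi> \<in> test_fun \<Longrightarrow>
    (\<integral>x. v x * deriv \<phi> x \<partial>unit_ival) = - (\<integral>x. g x * \<phi> x \<partial>unit_ival)"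
  by (simp add: has_weak_deriv_def)

text \<open>Tested against cutoffs, both derivatives give the same values, so in the limit they have
  the same integral over every [c,d].\<close>

lemma weak_deriv_unique:
  assumes "has_weak_deriv v g1" "has_weak_deriv v g2"
  shows "AE x in unit_ival. g1 x = g2 x"
proof -
  have "AE x in unit_ival. g1 x - g2 x = 0"
  proof (rule AE_zero_if_interval_integrals_zero)
    fix c d :: real assume cd: "0 < c" "c < d" "d < 1"
    have i: "integrable (lebesgue_on {c..d}) g1" "integrable (lebesgue_on {c..d}) g2"
      using assms cd by (auto simp: has_weak_deriv_def loc_integrable_def)
    have eq: "LI c d (\<lambda>x. g1 x * cutoff c d n x) = LI c d (\<lambda>x. g2 x * cutoff c d n x)" for n
    proof -
      have "cutoff c d n \<in> test_fun"
        by (rule bump_in_test_fun) (use cd in auto)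
      then have "(\<integral>x. g1 x * cutoff c d n x \<partial>unit_ival) = (\<integral>x. g2 x * cutoff c d n x \<partial>unit_ival)"
        using has_weak_derivD[OF assms(1), of "cutoff c d n"] has_weak_derivD[OF assms(2), of "cutoff c d n"]
        by linarith
      moreover have "(\<integral>x. g x * cutoff c d n x \<partial>unit_ival) = LI c d (\<lambda>x. g x * cutoff c d n x)" for g
        by (rule unit_integral_eq_LI) (use cd in \<open>auto simp: bump_def\<close>)
      ultimately show ?thesis by simp
    qed
    have "LI c d g1 = LI c d g2"
      using cutoff_LI_tendsto[OF i(1) cd(2)] cutoff_LI_tendsto[OF i(2) cd(2)] unfolding eq
      by (rule LIMSEQ_unique)
    then show "integrable (lebesgue_on {c..d}) (\<lambda>x. g1 x - g2 x) \<and> LI c d (\<lambda>x. g1 x - g2 x) = 0"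
      using i by simp
  qed
  then show ?thesis by simp
qed

text \<open>The cutoffs of (c,d) are inserted in the weak formulation: their derivatives act in the
  limit as the difference of the point evaluations at c and d, the cutoffs themselves as the
  indicator.\<close>

lemma weak_deriv_imp_AC_repr:
  assumes w: "has_weak_deriv v g" and v: "continuous_on {0<..<1} v"
  shows "AC_repr v g"
  unfolding AC_repr_def
proof (intro conjI allI impI)
  show "loc_integrable g" using w by (simp add: has_weak_deriv_def)
  fix c d :: real assume "0 < c" "c \<le> d" "d < 1"
  show "v d = v c + LI c d g"
  proof (cases "c = d")
    case True
    have "{d} \<in> null_sets lebesgue"
      by (intro null_sets_completionI finite_imp_null_set_lborel) auto
    with True show ?thesis by (simp add: integral_eq_zero_null_sets)
  next
    case False
    with \<open>0 < c\<close> \<open>c \<le> d\<close> \<open>d < 1\<close> have cd: "0 < c" "c < d" "d < 1" by auto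
    have i: "integrable (lebesgue_on {c..d}) g"
      using w cd by (auto simp: has_weak_deriv_def loc_integrable_def)
    have "LI c d (\<lambda>x. v x * deriv (cutoff c d n) x) = - LI c d (\<lambda>x. g x * cutoff c d n x)" for n
    proof -
      have "cutoff c d n \<in> test_fun"
        by (rule bump_in_test_fun) (use cd in auto)
      then have "(\<integral>x. v x * deriv (cutoff c d n) x \<partial>unit_ival) = - (\<integral>x. g x * cutoff c d n x \<partial>unit_ival)"
        by (rule has_weak_derivD[OF w])
      moreover have "(\<integral>x. g x * cutoff c d n x \<partial>unit_ival) = LI c d (\<lambda>x. g x * cutoff c d n x)"
        by (rule unit_integral_eq_LI) (use cd in \<open>auto simp: bump_def\<close>)
      moreover have "(\<integral>x. v x * deriv (cutoff c d n) x \<partial>unit_ival) = LI c d (\<lambda>x. v x * deriv (cutoff c d n) x)"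
        by (rule unit_integral_eq_LI) (use cd in \<open>auto simp: deriv_bump bump_def simp del: of_nat_Suc\<close>)
      ultimately show ?thesis by simp
    qed
    moreover have "continuous_on {c..d} v"
      by (rule continuous_on_subset[OF v]) (use cd in auto)
    ultimately have "(\<lambda>n. - LI c d (\<lambda>x. g x * cutoff c d n x)) \<longlonglongrightarrow> v c - v d"
      using deriv_cutoff_LI_tendsto[of c d v] cd by (simp del: of_nat_Suc)
    moreover have "(\<lambda>n. - LI c d (\<lambda>x. g x * cutoff c d n x)) \<longlonglongrightarrow> - LI c d g"
      by (intro tendsto_minus cutoff_LI_tendsto i cd)
    ultimately have "v c - v d = - LI c d g" by (rule LIMSEQ_unique)
    then show ?thesis by simp
  qed
qed

text \<open>The product rule on an interval [c,d] around the support of the test function, whose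
  boundary values vanish.\<close>

lemma AC_repr_imp_weak_deriv:
  assumes "AC_repr v g"
  shows "has_weak_deriv v g"
proof -
  have g: "loc_integrable g" and vg: "\<And>c d. 0 < c \<Longrightarrow> c \<le> d \<Longrightarrow> d < 1 \<Longrightarrow> v d = v c + LI c d g"
    using assms unfolding AC_repr_def by blast+
  have ig: "integrable (lebesgue_on {c..d}) g" if "0 < c" "d < 1" for c d
    using g that by (simp add: loc_integrable_def)
  have cv: "continuous_on {c..d} v" if "0 < c" "d < 1" for c d
    by (rule continuous_on_if_indefinite_integral[OF ig[OF that]]) (rule vg; use that in simp)
  show ?thesis
    unfolding has_weak_deriv_def
  proof (intro conjI ballI g)
    show "loc_integrable v"
      unfolding loc_integrable_def using cv by (blast intro: continuous_imp_integrable_real)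
    fix \<phi> :: "real \<Rightarrow> real" assume \<phi>: "\<phi> \<in> test_fun"
    then obtain c0 d0 where cd0: "0 < c0" "d0 < 1" and z: "\<And>x. x \<notin> {c0..d0} \<Longrightarrow> \<phi> x = 0"
      unfolding test_fun_def by blast
    \<comment> \<open>The points c and d lie strictly outside the support. Comparing with 1/2
      ensures c < d even if \<open>{c0..d0}\<close> is empty.\<close>
    define c where "c = min c0 (1/2) / 2"
    define d where "d = (1 + max d0 (1/2)) / 2"
    have cd: "0 < c" "c < d" "d < 1" "c < c0" "d0 < d"
      using cd0 by (auto simp: c_def d_def)
    have diff: "(deriv ^^ n) \<phi> differentiable_on UNIV" for n
      using \<phi> by (simp add: test_fun_def)
    have d\<phi>: "(\<phi> has_real_derivative deriv \<phi> x) (at x)" for x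
      using diff[of 0] by (simp add: differentiable_on_def DERIV_deriv_iff_real_differentiable)
    have c\<phi>: "continuous_on A (deriv \<phi>)" for A
      using differentiable_imp_continuous_on[OF diff[of 1]] continuous_on_subset by auto
    have z': "deriv \<phi> x = 0" if "x \<notin> {c..d}" for x
    proof -
      have "((\<lambda>x. 0) has_real_derivative 0) (at x)" by simp
      then have "(\<phi> has_real_derivative 0) (at x)"
        by (rule has_field_derivative_transform_within_open[of _ _ _ "- {c0..d0}"])
          (use that cd z in auto)
      then show ?thesis by (rule DERIV_imp_deriv)
    qed
    have \<phi>I: "\<phi> x = \<phi> c + LI c x (deriv \<phi>)" if "x \<in> {c..d}" for x
      by (rule FTC_LI[OF _ c\<phi> d\<phi>]) (use that in simp)
    have i\<phi>: "integrable (lebesgue_on {c..d}) (deriv \<phi>)"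
      by (rule continuous_imp_integrable_real[OF c\<phi>])
    have vI: "v x = v c + LI c x g" if "x \<in> {c..d}" for x
      by (rule vg) (use cd that in simp_all)
    have "v d * \<phi> d - v c * \<phi> c = LI c d (\<lambda>x. g x * \<phi> x + deriv \<phi> x * v x)"
      by (rule product_rule_indefinite_integral(2)[OF _ ig vI i\<phi> \<phi>I]) (use cd in auto)
    moreover have "\<phi> c = 0" "\<phi> d = 0" using z cd by auto
    ultimately have "0 = LI c d (\<lambda>x. g x * \<phi> x + deriv \<phi> x * v x)" by simp
    also have "\<dots> = LI c d (\<lambda>x. g x * \<phi> x) + LI c d (\<lambda>x. deriv \<phi> x * v x)"
    proof (rule Bochner_Integration.integral_add)
      have "continuous_on {c..d} \<phi>"
        using d\<phi> by (meson DERIV_continuous_on has_field_derivative_at_within)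
      then show "integrable (lebesgue_on {c..d}) (\<lambda>x. g x * \<phi> x)"
        using cd by (intro integrable_mult_continuous ig)
      show "integrable (lebesgue_on {c..d}) (\<lambda>x. deriv \<phi> x * v x)"
        using cd by (intro integrable_mult_continuous i\<phi> cv)
    qed
    finally have "LI c d (\<lambda>x. v x * deriv \<phi> x) = - LI c d (\<lambda>x. g x * \<phi> x)"
      by (simp add: mult.commute[of "v _"])
    moreover have "(\<integral>x. v x * deriv \<phi> x \<partial>unit_ival) = LI c d (\<lambda>x. v x * deriv \<phi> x)"
      by (rule unit_integral_eq_LI) (use cd z' in auto)
    moreover have "(\<integral>x. g x * \<phi> x \<partial>unit_ival) = LI c d (\<lambda>x. g x * \<phi> x)"
      by (rule unit_integral_eq_LI) (use cd z in auto)
    ultimately show "(\<integral>x. v x * deriv \<phi> x \<partial>unit_ival) = - (\<integral>x. g x * \<phi> x \<partial>unit_ival)"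
      by simp
  qed
qed

subsection \<open>The weighted energy space and the Hardy inequality\<close>

lemma measurable_powr_unit [measurable]: "(\<lambda>r. r powr p) \<in> borel_measurable unit_ival"
  by (intro measurable_restrict_space1 measurable_completion) simp

lemma AE_unit_I: "(\<And>r. 0 < r \<Longrightarrow> r < 1 \<Longrightarrow> P r) \<Longrightarrow> AE r in unit_ival. P r"
  by (rule AE_I2) simp

text \<open>Extension by 0 reduces this to \<open>lebesgue\<close>, which is complete.\<close>

lemma borel_measurable_unit_AE:
  fixes f g :: "real \<Rightarrow> real"
  assumes f: "f \<in> borel_measurable unit_ival" and eq: "AE r in unit_ival. f r = g r"
  shows "g \<in> borel_measurable unit_ival"
proof -
  have "(\<lambda>x. if x \<in> {0<..<1} then f x else 0) \<in> borel_measurable lebesgue"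
    using f by (subst borel_measurable_if) auto
  moreover have "AE x in lebesgue. (if x \<in> {0<..<1} then f x else 0) = (if x \<in> {0<..<1} then g x else 0)"
    using eq by (simp add: AE_restrict_space_iff)
  ultimately have "(\<lambda>x. if x \<in> {0<..<1} then g x else 0) \<in> borel_measurable lebesgue"
    by (rule borel_measurable_AE)
  then show ?thesis by (subst (asm) borel_measurable_if) auto
qed

lemma weighted_mult_integrable:
  assumes "f \<in> borel_measurable unit_ival" "g \<in> borel_measurable unit_ival"
    and "integrable unit_ival (\<lambda>r. r powr p * (f r)\<^sup>2)" "integrable unit_ival (\<lambda>r. r powr p * (g r)\<^sup>2)"
  shows "integrable unit_ival (\<lambda>r. r powr p * (f r * g r))"
proof (rule Bochner_Integration.integrable_bound)
  show "integrable unit_ival (\<lambda>r. r powr p * (f r)\<^sup>2 + r powr p * (g r)\<^sup>2)"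
    using assms by simp
  show "(\<lambda>r. r powr p * (f r * g r)) \<in> borel_measurable unit_ival"
    using assms(1,2) by measurable
  show "AE r in unit_ival. norm (r powr p * (f r * g r)) \<le> norm (r powr p * (f r)\<^sup>2 + r powr p * (g r)\<^sup>2)"
  proof (rule AE_unit_I)
    fix r
    have "\<bar>f r\<bar> * \<bar>g r\<bar> \<le> (f r)\<^sup>2 + (g r)\<^sup>2"
    proof -
      have "0 \<le> \<bar>f r\<bar> * \<bar>g r\<bar>" by simp
      then show ?thesis
        using sum_squares_bound[of "\<bar>f r\<bar>" "\<bar>g r\<bar>"] unfolding mult.assoc power2_abs by linarith
    qed
    then have "r powr p * (\<bar>f r\<bar> * \<bar>g r\<bar>) \<le> r powr p * ((f r)\<^sup>2 + (g r)\<^sup>2)"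
      by (intro mult_left_mono) auto
    then show "norm (r powr p * (f r * g r)) \<le> norm (r powr p * (f r)\<^sup>2 + r powr p * (g r)\<^sup>2)"
      by (simp add: abs_mult distrib_left)
  qed
qed

lemma weighted_comb_integrable:
  assumes "f \<in> borel_measurable unit_ival" "g \<in> borel_measurable unit_ival"
    and "integrable unit_ival (\<lambda>r. r powr p * (f r)\<^sup>2)" "integrable unit_ival (\<lambda>r. r powr p * (g r)\<^sup>2)"
  shows "integrable unit_ival (\<lambda>r. r powr p * (f r + c * g r)\<^sup>2)"
proof -
  have "integrable unit_ival (\<lambda>r. r powr p * (f r)\<^sup>2 + 2 * c * (r powr p * (f r * g r)) + c\<^sup>2 * (r powr p * (g r)\<^sup>2))"
    using assms weighted_mult_integrable[OF assms] by simp
  moreover have "(\<lambda>r. r powr p * (f r)\<^sup>2 + 2 * c * (r powr p * (f r * g r)) + c\<^sup>2 * (r powr p * (g r)\<^sup>2))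
    = (\<lambda>r. r powr p * (f r + c * g r)\<^sup>2)"
    by (rule ext) (simp add: power2_eq_square algebra_simps)
  ultimately show ?thesis by simp
qed

lemma L2_sp_comb: "f \<in> L2_sp M \<Longrightarrow> g \<in> L2_sp M \<Longrightarrow> (\<lambda>r. f r + c * g r) \<in> L2_sp M"
  by (auto simp: L2_sp_def intro: weighted_comb_integrable)

lemma cal_L_comb: "f \<in> cal_L M \<Longrightarrow> g \<in> cal_L M \<Longrightarrow> (\<lambda>r. f r + c * g r) \<in> cal_L M"
  by (auto simp: cal_L_def intro: weighted_comb_integrable)

lemma L2_sp_AE_cong:
  assumes "f \<in> L2_sp M" "AE r in unit_ival. f r = g r"
  shows "g \<in> L2_sp M"
proof -
  have g: "g \<in> borel_measurable unit_ival"
    using assms by (auto simp: L2_sp_def intro: borel_measurable_unit_AE)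
  have f: "f \<in> borel_measurable unit_ival" and i: "integrable unit_ival (\<lambda>r. r powr (M - 1) * (f r)\<^sup>2)"
    using assms by (auto simp: L2_sp_def)
  have "integrable unit_ival (\<lambda>r. r powr (M - 1) * (g r)\<^sup>2)"
    using i
  proof (rule integrable_cong_AE_imp)
    show "(\<lambda>r. r powr (M - 1) * (g r)\<^sup>2) \<in> borel_measurable unit_ival" using g by measurable
    show "AE r in unit_ival. r powr (M - 1) * (f r)\<^sup>2 = r powr (M - 1) * (g r)\<^sup>2"
      using assms(2) by eventually_elim simp
  qed
  with g show ?thesis by (simp add: L2_sp_def)
qed

lemma powr_weights:
  fixes r M :: real
  assumes "0 < r"
  shows "r powr (M - 2) = r powr (M - 3) * r" "r powr (M - 1) = r powr (M - 3) * r\<^sup>2"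
  using powr_add[of r "M - 3" 1] powr_add[of r "M - 3" 2] assms by simp_all

lemma cal_L_subset_L2_sp: "cal_L M \<subseteq> L2_sp M"
proof
  fix v assume "v \<in> cal_L M"
  then have v: "v \<in> borel_measurable unit_ival" and i: "integrable unit_ival (\<lambda>r. r powr (M - 3) * (v r)\<^sup>2)"
    by (auto simp: cal_L_def)
  have "integrable unit_ival (\<lambda>r. r powr (M - 1) * (v r)\<^sup>2)"
    using i
  proof (rule Bochner_Integration.integrable_bound)
    show "(\<lambda>r. r powr (M - 1) * (v r)\<^sup>2) \<in> borel_measurable unit_ival" using v by measurable
    show "AE r in unit_ival. norm (r powr (M - 1) * (v r)\<^sup>2) \<le> norm (r powr (M - 3) * (v r)\<^sup>2)"
      by (rule AE_unit_I) (auto simp: powr_mono' mult_right_mono)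
  qed
  with v show "v \<in> L2_sp M" by (simp add: L2_sp_def)
qed

text \<open>Indefinite integrals live on [c,1], the norms on (0,1). After truncation below c the two
  domains differ by the null set {1}.\<close>

lemma unit_restrict:
  fixes h :: "real \<Rightarrow> real"
  assumes c: "0 < c" and h: "h \<in> borel_measurable unit_ival"
  shows "integrable (lebesgue_on {c..1}) h \<longleftrightarrow> integrable unit_ival (\<lambda>x. indicator {c..} x * h x)"
    and "LI c 1 h = (\<integral>x. indicator {c..} x * h x \<partial>unit_ival)"
proof -
  let ?f = "\<lambda>x. if x \<in> {c..1} then h x else 0"
  let ?g = "\<lambda>x. if x \<in> {0<..<1} then indicator {c..} x * h x else 0"
  have "AE x in lebesgue. x \<notin> {1}"
    by (intro AE_not_in null_sets_completionI finite_imp_null_set_lborel) auto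
  then have eq: "AE x in lebesgue. ?g x = ?f x"
    by eventually_elim (use c in \<open>auto simp: indicator_def\<close>)
  have [measurable]: "indicat_real {c..} \<in> borel_measurable unit_ival"
    by (intro measurable_restrict_space1 measurable_completion) simp
  have "(\<lambda>x. indicator {c..} x * h x) \<in> borel_measurable unit_ival" using h by measurable
  then have g: "?g \<in> borel_measurable lebesgue" by (subst borel_measurable_if) auto
  then have f: "?f \<in> borel_measurable lebesgue" by (rule borel_measurable_AE[OF _ eq])
  have eq': "AE x in lebesgue. ?f x = ?g x" using eq by eventually_elim simp
  have S: "{c..1} \<in> sets lebesgue" "{0<..<1::real} \<in> sets lebesgue" by auto
  show "integrable (lebesgue_on {c..1}) h \<longleftrightarrow> integrable unit_ival (\<lambda>x. indicator {c..} x * h x)"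
    using integrable_cong_AE[OF f g eq']
    unfolding Lebesgue_Measure.integrable_restrict_UNIV[OF S(1)] Lebesgue_Measure.integrable_restrict_UNIV[OF S(2)] .
  show "LI c 1 h = (\<integral>x. indicator {c..} x * h x \<partial>unit_ival)"
    using integral_cong_AE[OF f g eq']
    unfolding Lebesgue_Measure.integral_restrict_UNIV[OF S(1)] Lebesgue_Measure.integral_restrict_UNIV[OF S(2)] .
qed

lemma indicator_mult_integrable:
  fixes h :: "real \<Rightarrow> real"
  assumes "integrable unit_ival h"
  shows "integrable unit_ival (\<lambda>x. indicator {c..} x * h x)"
proof -
  have "{c..} \<inter> {0<..<1} \<in> sets unit_ival"
    by (simp add: sets_restrict_space_iff)
  from integrable_real_mult_indicator[OF this assms]
  have "integrable unit_ival (\<lambda>x. indicator ({c..} \<inter> {0<..<1}) x * h x)"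
    by (simp add: mult.commute)
  then show ?thesis
    by (rule Bochner_Integration.integrable_cong[THEN iffD1, rotated -1]) (auto simp: indicator_def)
qed

lemma finite_measure_unit: "finite_measure unit_ival"
  by (intro finite_measure_lebesgue_on) simp

text \<open>On [c,1] the weight is at least c^(M-1), and \<bar>g\<bar> \<le> 1 + g^2. Integrability
  up to 1 is what gives a meaning to the boundary value.\<close>

lemma L2_sp_integrable:
  assumes g: "g \<in> L2_sp M" and c: "0 < c" and M: "1 \<le> M"
  shows "integrable (lebesgue_on {c..1}) g"
proof -
  interpret finite_measure unit_ival by (rule finite_measure_unit)
  have gm [measurable]: "g \<in> borel_measurable unit_ival" and i: "integrable unit_ival (\<lambda>r. r powr (M - 1) * (g r)\<^sup>2)"
    using g by (auto simp: L2_sp_def)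
  have [measurable]: "indicat_real {c..} \<in> borel_measurable unit_ival"
    by (intro measurable_restrict_space1 measurable_completion) simp
  have "integrable unit_ival (\<lambda>r. 1 + inverse (c powr (M - 1)) * (r powr (M - 1) * (g r)\<^sup>2))"
    using i by simp
  then have "integrable unit_ival (\<lambda>x. indicator {c..} x * g x)"
  proof (rule Bochner_Integration.integrable_bound)
    show "AE r in unit_ival. norm (indicator {c..} r * g r) \<le> norm (1 + inverse (c powr (M - 1)) * (r powr (M - 1) * (g r)\<^sup>2))"
    proof (rule AE_unit_I)
      fix r :: real assume r: "0 < r" "r < 1"
      show "norm (indicator {c..} r * g r) \<le> norm (1 + inverse (c powr (M - 1)) * (r powr (M - 1) * (g r)\<^sup>2))"
      proof (cases "c \<le> r")
        case True
        have "\<bar>g r\<bar> \<le> 1 + (g r)\<^sup>2"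
          using sum_squares_bound[of 1 "\<bar>g r\<bar>"] by simp
        moreover have "1 * (g r)\<^sup>2 \<le> (inverse (c powr (M - 1)) * r powr (M - 1)) * (g r)\<^sup>2"
          using powr_mono2[of "M - 1" c r] True c M by (intro mult_right_mono) (auto simp: field_simps)
        ultimately show ?thesis using True by (simp add: mult.assoc)
      qed simp
    qed
  qed measurable
  then show ?thesis using unit_restrict(1)[OF c gm] by simp
qed

lemma L2_sp_loc_integrable: "g \<in> L2_sp M \<Longrightarrow> 1 \<le> M \<Longrightarrow> loc_integrable g"
  unfolding loc_integrable_def
  by (auto intro: integrable_subinterval[OF L2_sp_integrable])

text \<open>The square integrable derivative provided by \<open>H1_sp\<close> need not be the one
  chosen by \<open>weak_deriv\<close>, but both agree almost everywhere.\<close>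

lemma cal_H0_weak_deriv:
  assumes "w \<in> cal_H0 M"
  shows "has_weak_deriv w (weak_deriv w)" "weak_deriv w \<in> L2_sp M"
proof -
  obtain g where g: "g \<in> L2_sp M" "has_weak_deriv w g"
    using assms by (auto simp: cal_H0_def H10_sp_def H1_sp_def)
  show *: "has_weak_deriv w (weak_deriv w)"
    unfolding weak_deriv_def by (rule someI[of "has_weak_deriv w", OF g(2)])
  show "weak_deriv w \<in> L2_sp M"
    by (rule L2_sp_AE_cong[OF g(1) weak_deriv_unique[OF g(2) *]])
qed

lemma cal_H0_D:
  assumes "w \<in> cal_H0 M"
  shows "continuous_on {0<..1} w" "w 1 = 0" "w \<in> borel_measurable unit_ival" "w \<in> cal_L M"
    "integrable unit_ival (\<lambda>r. r powr (M - 1) * (w r)\<^sup>2)" "integrable unit_ival (\<lambda>r. r powr (M - 3) * (w r)\<^sup>2)"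
    "weak_deriv w \<in> borel_measurable unit_ival" "integrable unit_ival (\<lambda>r. r powr (M - 1) * (weak_deriv w r)\<^sup>2)"
proof -
  have H: "w \<in> L2_sp M" "continuous_on {0<..1} w" "w 1 = 0" "w \<in> cal_L M"
    using assms by (simp_all add: cal_H0_def H10_sp_def H1_sp_def)
  then show "continuous_on {0<..1} w" "w 1 = 0" "w \<in> borel_measurable unit_ival" "w \<in> cal_L M"
    "integrable unit_ival (\<lambda>r. r powr (M - 1) * (w r)\<^sup>2)" "integrable unit_ival (\<lambda>r. r powr (M - 3) * (w r)\<^sup>2)"
    by (simp_all add: L2_sp_def cal_L_def)
  show "weak_deriv w \<in> borel_measurable unit_ival" "integrable unit_ival (\<lambda>r. r powr (M - 1) * (weak_deriv w r)\<^sup>2)"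
    using cal_H0_weak_deriv(2)[OF assms] by (simp_all add: L2_sp_def)
qed

lemma cal_H0_FTC:
  assumes w: "w \<in> cal_H0 M" and M: "1 \<le> M" and cd: "0 < c" "c \<le> d" "d \<le> 1"
  shows "integrable (lebesgue_on {c..d}) (weak_deriv w)" "w d = w c + LI c d (weak_deriv w)"
proof -
  let ?g = "weak_deriv w"
  have i: "integrable (lebesgue_on {c..1}) ?g"
    by (rule L2_sp_integrable[OF cal_H0_weak_deriv(2)[OF w] cd(1) M])
  then show id: "integrable (lebesgue_on {c..d}) ?g"
    by (rule integrable_subinterval) (use cd in auto)
  have "continuous_on {0<..<1} w"
    by (rule continuous_on_subset[OF cal_H0_D(1)[OF w]]) auto
  then have ac: "AC_repr w ?g"
    by (rule weak_deriv_imp_AC_repr[OF cal_H0_weak_deriv(1)[OF w]])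
  show "w d = w c + LI c d ?g"
  proof (cases "d = 1")
    case False
    then show ?thesis using cd by (intro AC_reprD[OF ac]) auto
  next
    case d1: True
    show ?thesis
    proof (cases "c = 1")
      case True
      have "{1::real} \<in> null_sets lebesgue"
        by (intro null_sets_completionI finite_imp_null_set_lborel) auto
      with True d1 show ?thesis by (simp add: integral_eq_zero_null_sets)
    next
      case False
      have "continuous_on {c..1} w"
        by (rule continuous_on_subset[OF cal_H0_D(1)[OF w]]) (use cd in auto)
      \<comment> \<open>Both sides of the identity are continuous up to 1, so it extends from d < 1
        to d = 1.\<close>
      then have "continuous_on (closure {c..<1}) (\<lambda>x. w x - (w c + LI c x ?g))"
        using False cd by (auto intro!: continuous_intros indefinite_integral_continuous_real i)
      then have "w 1 - (w c + LI c 1 ?g) = 0"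
      proof (rule continuous_constant_on_closure)
        fix x assume "x \<in> {c..<1}"
        then show "w x - (w c + LI c x ?g) = 0"
          using cd AC_reprD[OF ac, of c x] by simp
      qed (use False cd in auto)
      then show ?thesis using d1 by simp
    qed
  qed
qed

text \<open>The converse of \<open>cal_H0_FTC\<close>, and the way membership is proved for linear
  combinations, limits and polynomials: integrating from the endpoint 1 yields continuity, the
  boundary value and the weak derivative together.\<close>

lemma cal_H0_I:
  assumes g: "g \<in> L2_sp M" and M: "1 \<le> M" and w: "\<And>c. 0 < c \<Longrightarrow> c \<le> 1 \<Longrightarrow> w c = - LI c 1 g"
    and L: "w \<in> cal_L M"
  shows "w \<in> cal_H0 M" "AE r in unit_ival. weak_deriv w r = g r"
proof -
  have i: "integrable (lebesgue_on {c..1}) g" if "0 < c" for c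
    by (rule L2_sp_integrable[OF g that M])
  have diff: "w d = w c + LI c d g" if "0 < c" "c \<le> d" "d \<le> 1" for c d
    using Equivalence_Measurable_On_Borel.integral_combine[OF i[of c], of d] w[of c] w[of d] that by simp
  have ac: "AC_repr w g"
    unfolding AC_repr_def by (intro conjI allI impI L2_sp_loc_integrable[OF g M] diff) auto
  have wd: "has_weak_deriv w g" by (rule AC_repr_imp_weak_deriv[OF ac])
  have "continuous_on {0<..1} w"
    unfolding continuous_on_eq_continuous_within
  proof
    fix x :: real assume x: "x \<in> {0<..1}"
    have "continuous_on {x / 2..1} w"
    proof (rule continuous_on_if_indefinite_integral[OF i])
      show "0 < x / 2" using x by simp
      show "w y = w (x / 2) + LI (x / 2) y g" if "y \<in> {x / 2..1}" for y
        by (rule diff) (use x that in auto)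
    qed
    then have "continuous (at x within {x / 2..1}) w"
      using x by (simp add: continuous_on_eq_continuous_within)
    moreover have "at x within {x / 2..1} = at x within {0<..1}"
      by (rule at_within_nhd[of _ "{x / 2<..}"]) (use x in auto)
    ultimately show "continuous (at x within {0<..1}) w" by simp
  qed
  moreover have "w 1 = 0"
  proof -
    have "{1::real} \<in> null_sets lebesgue"
      by (intro null_sets_completionI finite_imp_null_set_lborel) auto
    then show ?thesis using w[of 1] by (simp add: integral_eq_zero_null_sets)
  qed
  ultimately show H: "w \<in> cal_H0 M"
    using L cal_L_subset_L2_sp g wd by (auto simp: cal_H0_def H10_sp_def H1_sp_def)
  show "AE r in unit_ival. weak_deriv w r = g r"
    by (rule weak_deriv_unique[OF cal_H0_weak_deriv(1)[OF H] wd])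
qed

text \<open>Since \<open>weak_deriv\<close> is a choice, it is linear only almost everywhere, and
  this is enough for the integrals.\<close>

lemma cal_H0_comb:
  assumes u: "u \<in> cal_H0 M" and v: "v \<in> cal_H0 M" and M: "1 \<le> M"
  shows "(\<lambda>r. u r + c * v r) \<in> cal_H0 M"
    "AE r in unit_ival. weak_deriv (\<lambda>r. u r + c * v r) r = weak_deriv u r + c * weak_deriv v r"
proof -
  have eq: "u x + c * v x = - LI x 1 (\<lambda>r. weak_deriv u r + c * weak_deriv v r)" if "0 < x" "x \<le> 1" for x
  proof -
    have "u x = - LI x 1 (weak_deriv u)" "v x = - LI x 1 (weak_deriv v)"
      using cal_H0_FTC(2)[OF u M that] cal_H0_FTC(2)[OF v M that] cal_H0_D(2)[OF u] cal_H0_D(2)[OF v]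
      by simp_all
    then show ?thesis
      using cal_H0_FTC(1)[OF u M that] cal_H0_FTC(1)[OF v M that] by simp
  qed
  note * = L2_sp_comb[OF cal_H0_weak_deriv(2)[OF u] cal_H0_weak_deriv(2)[OF v]] M eq
    cal_L_comb[OF cal_H0_D(4)[OF u] cal_H0_D(4)[OF v]]
  show "(\<lambda>r. u r + c * v r) \<in> cal_H0 M" by (rule cal_H0_I(1)[OF *])
  show "AE r in unit_ival. weak_deriv (\<lambda>r. u r + c * v r) r = weak_deriv u r + c * weak_deriv v r"
    by (rule cal_H0_I(2)[OF *])
qed


section \<open>The energy forms and the Hardy inequality\<close>

definition D_form :: "real \<Rightarrow> (real \<Rightarrow> real) \<Rightarrow> (real \<Rightarrow> real) \<Rightarrow> real"
  where "D_form M u v = (\<integral>r. r powr (M - 1) * (weak_deriv u r * weak_deriv v r) \<partial>unit_ival)"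

text \<open>On \<open>cal_H0 M\<close>, the diagonal of \<open>D_form\<close> minus
  \<open>K_form\<close> is \<open>Q_form\<close>. The forms are kept apart because
  \<open>D_form\<close> satisfies the Hardy inequality while \<open>K_form\<close> is
  compact.\<close>

definition K_form :: "(real \<Rightarrow> real) \<Rightarrow> real \<Rightarrow> (real \<Rightarrow> real) \<Rightarrow> (real \<Rightarrow> real) \<Rightarrow> real"
  where "K_form a M u v = (\<integral>r. r powr (M - 1) * (a r * u r * v r) \<partial>unit_ival)"

lemma inner_L_self: "inner_L M w w = (\<integral>r. r powr (M - 3) * (w r)\<^sup>2 \<partial>unit_ival)"
  by (simp add: inner_L_def power2_eq_square)

lemma D_form_self: "D_form M w w = (\<integral>r. r powr (M - 1) * (weak_deriv w r)\<^sup>2 \<partial>unit_ival)"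
  by (simp add: D_form_def power2_eq_square)

text \<open>
  The derivative of \<open>r\<^bsup>M - 2\<^esup> w\<^sup>2\<close>.
\<close>

definition flux :: "real \<Rightarrow> (real \<Rightarrow> real) \<Rightarrow> real \<Rightarrow> real"
  where "flux M w r = (M - 2) * (r powr (M - 3) * (w r)\<^sup>2) + 2 * (r powr (M - 2) * (w r * weak_deriv w r))"

text \<open>The square r^(M-3) (w + r w')^2 is nonnegative, and so is the first summand of
  \<open>flux\<close>.\<close>

lemma flux_bound:
  assumes "0 < r" "2 \<le> M"
  shows "- flux M w r \<le> r powr (M - 3) * (w r)\<^sup>2 + r powr (M - 1) * (weak_deriv w r)\<^sup>2"
proof -
  have "0 \<le> r powr (M - 3) * (w r + r * weak_deriv w r)\<^sup>2" by simp
  moreover have "0 \<le> (M - 2) * (r powr (M - 3) * (w r)\<^sup>2)" using assms by simp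
  ultimately show ?thesis
    by (simp add: flux_def powr_weights[OF assms(1)] power2_eq_square algebra_simps)
qed

lemma flux_integrable:
  assumes w: "w \<in> cal_H0 M"
  shows "integrable unit_ival (flux M w)"
proof -
  note d = cal_H0_D[OF w]
  have "integrable unit_ival (\<lambda>r. r powr (M - 2) * (w r * weak_deriv w r))"
  proof (rule Bochner_Integration.integrable_bound)
    show "integrable unit_ival (\<lambda>r. r powr (M - 3) * (w r)\<^sup>2 + r powr (M - 1) * (weak_deriv w r)\<^sup>2)"
      using d by simp
    show "(\<lambda>r. r powr (M - 2) * (w r * weak_deriv w r)) \<in> borel_measurable unit_ival"
      using d(3,7) by measurable
    show "AE r in unit_ival. norm (r powr (M - 2) * (w r * weak_deriv w r))
        \<le> norm (r powr (M - 3) * (w r)\<^sup>2 + r powr (M - 1) * (weak_deriv w r)\<^sup>2)"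
    proof (rule AE_unit_I)
      fix r :: real assume r: "0 < r"
      have "0 \<le> r powr (M - 3) * (\<bar>w r\<bar> - r * \<bar>weak_deriv w r\<bar>)\<^sup>2" "0 \<le> r powr (M - 3) * (r * (\<bar>w r\<bar> * \<bar>weak_deriv w r\<bar>))"
        using r by simp_all
      then have "r powr (M - 3) * r * (\<bar>w r\<bar> * \<bar>weak_deriv w r\<bar>) \<le> r powr (M - 3) * (w r)\<^sup>2 + r powr (M - 3) * r\<^sup>2 * (weak_deriv w r)\<^sup>2"
        by (simp add: power2_eq_square algebra_simps)
      then show "norm (r powr (M - 2) * (w r * weak_deriv w r))
        \<le> norm (r powr (M - 3) * (w r)\<^sup>2 + r powr (M - 1) * (weak_deriv w r)\<^sup>2)"
        using r by (simp add: powr_weights abs_mult)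
    qed
  qed
  with d(6) show ?thesis unfolding flux_def by (intro Bochner_Integration.integrable_add) simp_all
qed

text \<open>The product rule is used twice, for w^2 and then for its product with r^(M-2). The
  boundary term at 1 vanishes because \<open>w 1 = 0\<close>.\<close>

lemma square_eq_neg_flux_integral:
  assumes w: "w \<in> cal_H0 M" and M: "2 \<le> M" and r: "0 < r" "r \<le> 1"
  shows "r powr (M - 2) * (w r)\<^sup>2 = - (\<integral>s. indicator {r..} s * flux M w s \<partial>unit_ival)"
proof -
  let ?g = "weak_deriv w"
  have M1: "1 \<le> M" using M by simp
  have W: "w x = w r + LI r x ?g" if "x \<in> {r..1}" for x
    by (rule cal_H0_FTC(2)[OF w M1]) (use that r in auto)
  have W1: "w y = w r + LI r y ?g" if "y \<in> {r..x}" "x \<le> 1" for x y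
    by (rule W) (use that in auto)
  have i: "integrable (lebesgue_on {r..x}) ?g" if "r \<le> x" "x \<le> 1" for x
    by (rule cal_H0_FTC(1)[OF w M1]) (use r that in auto)
  have sq: "w x * w x = w r * w r + LI r x (\<lambda>s. ?g s * w s + ?g s * w s)" if "x \<in> {r..1}" for x
  proof -
    have x: "r \<le> x" "x \<le> 1" using that by auto
    have "w x * w x - w r * w r = LI r x (\<lambda>s. ?g s * w s + ?g s * w s)"
      by (rule product_rule_indefinite_integral(2)[OF x(1) i[OF x] W1[OF _ x(2)] i[OF x] W1[OF _ x(2)]])
    then show ?thesis by simp
  qed
  have isq: "integrable (lebesgue_on {r..1}) (\<lambda>s. ?g s * w s + ?g s * w s)"
    by (rule product_rule_indefinite_integral(1)[OF r(2) i[OF r(2)] W i[OF r(2)] W]) auto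
  have cp: "continuous_on {r..x} (\<lambda>s. (M - 2) * s powr (M - 3))" for x
    using r by (intro continuous_intros) auto
  have P: "x powr (M - 2) = r powr (M - 2) + LI r x (\<lambda>s. (M - 2) * s powr (M - 3))" if "x \<in> {r..1}" for x
  proof (rule FTC_LI[OF _ cp])
    fix s assume "s \<in> {r..x}"
    then show "((\<lambda>s. s powr (M - 2)) has_real_derivative (M - 2) * s powr (M - 3)) (at s)"
      using r by (auto intro!: derivative_eq_intros)
  qed (use that in auto)
  have "1 powr (M - 2) * (w 1 * w 1) - r powr (M - 2) * (w r * w r)
    = LI r 1 (\<lambda>s. (M - 2) * s powr (M - 3) * (w s * w s) + (?g s * w s + ?g s * w s) * s powr (M - 2))"
    by (rule product_rule_indefinite_integral(2)[OF r(2) continuous_imp_integrable_real[OF cp] P isq sq])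
  also have "(\<lambda>s. (M - 2) * s powr (M - 3) * (w s * w s) + (?g s * w s + ?g s * w s) * s powr (M - 2)) = flux M w"
    by (rule ext) (simp add: flux_def power2_eq_square algebra_simps)
  also have "LI r 1 (flux M w) = (\<integral>s. indicator {r..} s * flux M w s \<partial>unit_ival)"
    by (rule unit_restrict(2)[OF r(1) borel_measurable_integrable[OF flux_integrable[OF w]]])
  finally show ?thesis
    using cal_H0_D(2)[OF w] by (simp add: power2_eq_square)
qed

text \<open>Bounds the growth at 0 by r^(-(M-2)/2) in terms of the energy alone; this is the
  majorant behind compactness.\<close>

lemma pointwise_bound:
  assumes w: "w \<in> cal_H0 M" and M: "2 \<le> M" and r: "0 < r" "r \<le> 1"
  shows "r powr (M - 2) * (w r)\<^sup>2 \<le> inner_L M w w + D_form M w w"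
proof -
  note d = cal_H0_D[OF w]
  have "- (\<integral>s. indicator {r..} s * flux M w s \<partial>unit_ival) = (\<integral>s. - (indicator {r..} s * flux M w s) \<partial>unit_ival)"
    by simp
  also have "\<dots> \<le> (\<integral>s. s powr (M - 3) * (w s)\<^sup>2 + s powr (M - 1) * (weak_deriv w s)\<^sup>2 \<partial>unit_ival)"
  proof (rule integral_mono_AE)
    show "integrable unit_ival (\<lambda>s. - (indicator {r..} s * flux M w s))"
      using indicator_mult_integrable[OF flux_integrable[OF w]] by simp
    show "AE s in unit_ival. - (indicator {r..} s * flux M w s) \<le> s powr (M - 3) * (w s)\<^sup>2 + s powr (M - 1) * (weak_deriv w s)\<^sup>2"
      by (rule AE_unit_I) (use flux_bound M in \<open>auto simp: indicator_def\<close>)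
  qed (use d in simp)
  also have "\<dots> = inner_L M w w + D_form M w w"
    using d by (simp add: inner_L_self D_form_self)
  finally show ?thesis
    using square_eq_neg_flux_integral[OF assms] by simp
qed

text \<open>The integral is the limit of - r^(M-2) w(r)^2 along r = 1/(n+1). Its sign suffices for
  the Hardy inequality, so the boundary term at 0 is not evaluated.\<close>

lemma flux_integral_nonpos:
  assumes w: "w \<in> cal_H0 M" and M: "2 \<le> M"
  shows "(\<integral>s. flux M w s \<partial>unit_ival) \<le> 0"
proof -
  have "(\<lambda>n. \<integral>s. indicator {1 / real (Suc n)..} s * flux M w s \<partial>unit_ival) \<longlonglongrightarrow> (\<integral>s. flux M w s \<partial>unit_ival)"
  proof (rule integral_dominated_convergence[where w = "\<lambda>s. \<bar>flux M w s\<bar>"])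
    show "AE s in unit_ival. (\<lambda>n. indicator {1 / real (Suc n)..} s * flux M w s) \<longlonglongrightarrow> flux M w s"
    proof (rule AE_unit_I)
      fix s :: real assume "0 < s"
      then obtain N where N: "1 / real (Suc N) < s" using nat_approx_posE by blast
      have "\<forall>\<^sub>F n in sequentially. indicator {1 / real (Suc n)..} s * flux M w s = flux M w s"
        using eventually_ge_at_top[of N]
      proof eventually_elim
        case (elim n)
        then have "1 / real (Suc n) \<le> 1 / real (Suc N)" by (intro divide_left_mono) auto
        with N show ?case by simp
      qed
      then show "(\<lambda>n. indicator {1 / real (Suc n)..} s * flux M w s) \<longlonglongrightarrow> flux M w s"
        by (rule tendsto_eventually)
    qed
    show "AE s in unit_ival. norm (indicator {1 / real (Suc n)..} s * flux M w s) \<le> \<bar>flux M w s\<bar>" for n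
      by (rule AE_unit_I) (simp add: indicator_def)
  qed (use flux_integrable[OF w] indicator_mult_integrable[OF flux_integrable[OF w]] in auto)
  moreover have "(\<integral>s. indicator {1 / real (Suc n)..} s * flux M w s \<partial>unit_ival) \<le> 0" for n
  proof -
    have "0 \<le> (1 / real (Suc n)) powr (M - 2) * (w (1 / real (Suc n)))\<^sup>2" by simp
    also have "\<dots> = - (\<integral>s. indicator {1 / real (Suc n)..} s * flux M w s \<partial>unit_ival)"
      by (rule square_eq_neg_flux_integral[OF w M]) auto
    finally show ?thesis by simp
  qed
  ultimately show ?thesis by (intro LIMSEQ_le_const2) auto
qed

text \<open>With b = (M-2)/2 the square r^(M-3) (r w' + b w)^2 equals r^(M-1) w'^2 + b
  \<open>flux\<close> - b^2 r^(M-3) w^2. Integration and the sign of the flux integral give the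
  constant b^2.\<close>

lemma Hardy_inequality:
  assumes w: "w \<in> cal_H0 M" and M: "2 \<le> M"
  shows "((M - 2) / 2)\<^sup>2 * inner_L M w w \<le> D_form M w w"
proof -
  note d = cal_H0_D[OF w]
  define b where "b = (M - 2) / 2"
  have "b\<^sup>2 * inner_L M w w = (\<integral>r. b\<^sup>2 * (r powr (M - 3) * (w r)\<^sup>2) \<partial>unit_ival)"
    by (simp add: inner_L_self)
  also have "\<dots> \<le> (\<integral>r. r powr (M - 1) * (weak_deriv w r)\<^sup>2 + b * flux M w r \<partial>unit_ival)"
  proof (rule integral_mono_AE)
    show "AE r in unit_ival. b\<^sup>2 * (r powr (M - 3) * (w r)\<^sup>2) \<le> r powr (M - 1) * (weak_deriv w r)\<^sup>2 + b * flux M w r"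
    proof (rule AE_unit_I)
      fix r :: real assume r: "0 < r"
      have "0 \<le> r powr (M - 3) * (r * weak_deriv w r + b * w r)\<^sup>2" by simp
      moreover have "flux M w r = 2 * b * (r powr (M - 3) * (w r)\<^sup>2) + 2 * (r powr (M - 3) * r * (w r * weak_deriv w r))"
        by (simp add: flux_def powr_weights[OF r] b_def)
      ultimately show "b\<^sup>2 * (r powr (M - 3) * (w r)\<^sup>2) \<le> r powr (M - 1) * (weak_deriv w r)\<^sup>2 + b * flux M w r"
        unfolding powr_weights[OF r] by (simp add: power2_eq_square algebra_simps)
    qed
  qed (use d flux_integrable[OF w] in simp_all)
  also have "\<dots> = D_form M w w + b * (\<integral>r. flux M w r \<partial>unit_ival)"
    using d flux_integrable[OF w] by (simp add: D_form_self)
  also have "\<dots> \<le> D_form M w w"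
    using flux_integral_nonpos[OF assms] M by (simp add: b_def mult_nonneg_nonpos)
  finally show ?thesis by (simp add: b_def)
qed

text \<open>Cauchy-Schwarz in Young's form: the free parameter t balances the length of the interval
  against the energy and avoids square roots. The weight is bounded below at the left limit
  c.\<close>

lemma LI_bound:
  assumes h: "h \<in> L2_sp M" and M: "1 \<le> M" and c: "0 < c" "c \<le> x" "x \<le> y" "y \<le> 1" and t: "0 < t"
  shows "\<bar>LI x y h\<bar> \<le> ((y - x) / t + t * c powr (1 - M) * (\<integral>r. r powr (M - 1) * (h r)\<^sup>2 \<partial>unit_ival)) / 2"
proof -
  have hm: "h \<in> borel_measurable unit_ival" and i: "integrable unit_ival (\<lambda>r. r powr (M - 1) * (h r)\<^sup>2)"
    using h by (auto simp: L2_sp_def)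
  let ?q = "\<lambda>r. r powr (M - 1) * (h r)\<^sup>2"
  have qm: "?q \<in> borel_measurable unit_ival" using hm by measurable
  have ih: "integrable (lebesgue_on {x..y}) h"
    using integrable_subinterval[OF L2_sp_integrable[OF h _ M, of x]] c by auto
  have iq1: "integrable (lebesgue_on {x..1}) ?q"
    using unit_restrict(1)[OF _ qm, of x] indicator_mult_integrable[OF i, of x] c by auto
  have iq: "integrable (lebesgue_on {x..y}) ?q"
    by (rule integrable_subinterval[OF iq1]) (use c in auto)
  have q_le: "LI x y ?q \<le> (\<integral>r. ?q r \<partial>unit_ival)"
  proof -
    have "LI x y ?q \<le> LI x 1 ?q"
      by (rule integral_mono_lebesgue_on_AE[OF iq1]) (use c in auto)
    also have "\<dots> = (\<integral>r. indicator {x..} r * ?q r \<partial>unit_ival)"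
      by (rule unit_restrict(2)[OF _ qm]) (use c in auto)
    also have "\<dots> \<le> (\<integral>r. ?q r \<partial>unit_ival)"
      by (rule integral_mono_AE[OF indicator_mult_integrable[OF i] i]) (auto intro!: AE_unit_I simp: indicator_def)
    finally show ?thesis .
  qed
  have "\<bar>LI x y h\<bar> \<le> LI x y (\<lambda>r. (1 / t + t * c powr (1 - M) * ?q r) / 2)"
  proof (rule integral_abs_bound_integral[OF ih])
    show "integrable (lebesgue_on {x..y}) (\<lambda>r. (1 / t + t * c powr (1 - M) * ?q r) / 2)"
      using iq by simp
    fix r assume "r \<in> space (lebesgue_on {x..y})"
    then have r: "c \<le> r" using c by simp
    have "0 \<le> (1 - t * \<bar>h r\<bar>)\<^sup>2 / t" using t by simp
    also have "\<dots> = 1 / t - 2 * \<bar>h r\<bar> + t * (h r)\<^sup>2"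
      using t by (simp add: power2_diff power_mult_distrib) (simp add: field_simps power2_eq_square)
    finally have "2 * \<bar>h r\<bar> \<le> 1 / t + t * (h r)\<^sup>2" by simp
    also have "\<dots> \<le> 1 / t + t * (c powr (1 - M) * r powr (M - 1) * (h r)\<^sup>2)"
    proof -
      have "1 = c powr (1 - M) * c powr (M - 1)" using c by (simp flip: powr_add)
      also have "\<dots> \<le> c powr (1 - M) * r powr (M - 1)"
        using r c M by (intro mult_left_mono powr_mono2) auto
      finally have "1 * (h r)\<^sup>2 \<le> c powr (1 - M) * r powr (M - 1) * (h r)\<^sup>2"
        by (rule mult_right_mono) simp
      then show ?thesis using t by (simp add: mult_left_mono)
    qed
    finally show "\<bar>h r\<bar> \<le> (1 / t + t * c powr (1 - M) * ?q r) / 2"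
      by (simp add: mult.assoc)
  qed
  also have "\<dots> = ((y - x) / t + t * c powr (1 - M) * LI x y ?q) / 2"
    using iq c by (simp add: measure_restrict_space)
  also have "\<dots> \<le> ((y - x) / t + t * c powr (1 - M) * (\<integral>r. ?q r \<partial>unit_ival)) / 2"
    using q_le t by (intro divide_right_mono add_left_mono mult_left_mono) auto
  finally show ?thesis .
qed

subsection \<open>Compactness and completeness\<close>

lemma integrable_square_diff:
  fixes u v :: "'a \<Rightarrow> real"
  assumes [measurable]: "u \<in> borel_measurable N" "v \<in> borel_measurable N"
    and u2: "integrable N (\<lambda>x. (u x)\<^sup>2)" and v2: "integrable N (\<lambda>x. (v x)\<^sup>2)"
  shows "integrable N (\<lambda>x. (u x - v x)\<^sup>2)"
proof (rule Bochner_Integration.integrable_bound)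
  show "integrable N (\<lambda>x. 2 * (u x)\<^sup>2 + 2 * (v x)\<^sup>2)" using u2 v2 by simp
  show "AE x in N. norm ((u x - v x)\<^sup>2) \<le> norm (2 * (u x)\<^sup>2 + 2 * (v x)\<^sup>2)"
  proof (rule AE_I2)
    fix x
    have "0 \<le> (u x + v x)\<^sup>2" by simp
    then have "(u x - v x)\<^sup>2 \<le> 2 * (u x)\<^sup>2 + 2 * (v x)\<^sup>2" by (simp add: power2_eq_square algebra_simps)
    then show "norm ((u x - v x)\<^sup>2) \<le> norm (2 * (u x)\<^sup>2 + 2 * (v x)\<^sup>2)" by simp
  qed
qed measurable

text \<open>Fatou's lemma along the subsequence s bounds the distance of f n to g by the Cauchy
  modulus. Because the limit g is prescribed, the lemma also identifies a limit already known
  pointwise.\<close>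

lemma L2_limit_of_AE_limit:
  fixes f :: "nat \<Rightarrow> 'a \<Rightarrow> real"
  assumes f [measurable]: "\<And>n. f n \<in> borel_measurable N" and f2: "\<And>n. integrable N (\<lambda>x. (f n x)\<^sup>2)"
    and Cauchy: "\<And>e. e > 0 \<Longrightarrow> \<exists>K. \<forall>m\<ge>K. \<forall>n\<ge>K. (\<integral>x. (f m x - f n x)\<^sup>2 \<partial>N) < e"
    and s: "strict_mono s" and lim: "AE x in N. (\<lambda>n. f (s n) x) \<longlonglongrightarrow> g x"
    and g [measurable]: "g \<in> borel_measurable N"
  shows "integrable N (\<lambda>x. (g x)\<^sup>2)" "(\<lambda>n. \<integral>x. (f n x - g x)\<^sup>2 \<partial>N) \<longlonglongrightarrow> 0"
    "\<And>n. integrable N (\<lambda>x. (f n x - g x)\<^sup>2)"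
proof -
  have ff: "integrable N (\<lambda>x. (f m x - f n x)\<^sup>2)" for m n
    by (rule integrable_square_diff) (use f2 in auto)
  have main: "\<exists>K. \<forall>n\<ge>K. (\<integral>\<^sup>+x. ennreal ((f n x - g x)\<^sup>2) \<partial>N) \<le> ennreal e" if e: "e > 0" for e
  proof -
    obtain K where K: "\<And>m n. m \<ge> K \<Longrightarrow> n \<ge> K \<Longrightarrow> (\<integral>x. (f m x - f n x)\<^sup>2 \<partial>N) < e"
      using Cauchy[OF e] by blast
    have "(\<integral>\<^sup>+x. ennreal ((f n x - g x)\<^sup>2) \<partial>N) \<le> ennreal e" if n: "n \<ge> K" for n
    proof -
      have "(\<integral>\<^sup>+x. ennreal ((f n x - g x)\<^sup>2) \<partial>N) = (\<integral>\<^sup>+x. liminf (\<lambda>k. ennreal ((f n x - f (s k) x)\<^sup>2)) \<partial>N)"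
      proof (rule nn_integral_cong_AE)
        show "AE x in N. ennreal ((f n x - g x)\<^sup>2) = liminf (\<lambda>k. ennreal ((f n x - f (s k) x)\<^sup>2))"
          using lim
        proof eventually_elim
          case (elim x)
          have "(\<lambda>k. ennreal ((f n x - f (s k) x)\<^sup>2)) \<longlonglongrightarrow> ennreal ((f n x - g x)\<^sup>2)"
            by (intro tendsto_intros elim)
          then show ?case using lim_imp_Liminf[OF sequentially_bot] by metis
        qed
      qed
      also have "\<dots> \<le> liminf (\<lambda>k. \<integral>\<^sup>+x. ennreal ((f n x - f (s k) x)\<^sup>2) \<partial>N)"
        by (intro nn_integral_liminf) measurable
      also have "\<dots> \<le> liminf (\<lambda>k. ennreal e)"
      proof (rule Liminf_mono)
        show "\<forall>\<^sub>F k in sequentially. (\<integral>\<^sup>+x. ennreal ((f n x - f (s k) x)\<^sup>2) \<partial>N) \<le> ennreal e"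
          using eventually_ge_at_top[of K]
        proof eventually_elim
          case (elim k)
          then have "s k \<ge> K" using seq_suble[OF s, of k] by simp
          with K[OF n this] show ?case
            by (subst nn_integral_eq_integral[OF ff]) (auto intro: ennreal_leI)
        qed
      qed
      also have "\<dots> = ennreal e" by (simp add: Liminf_const)
      finally show ?thesis .
    qed
    then show ?thesis by blast
  qed
  have fg: "\<exists>K. \<forall>n\<ge>K. integrable N (\<lambda>x. (f n x - g x)\<^sup>2) \<and> (\<integral>x. (f n x - g x)\<^sup>2 \<partial>N) \<le> e" if e: "e > 0" for e
  proof -
    obtain K where K: "\<And>n. n \<ge> K \<Longrightarrow> (\<integral>\<^sup>+x. ennreal ((f n x - g x)\<^sup>2) \<partial>N) \<le> ennreal e"
      using main[OF e] by blast
    have "integrable N (\<lambda>x. (f n x - g x)\<^sup>2) \<and> (\<integral>x. (f n x - g x)\<^sup>2 \<partial>N) \<le> e" if n: "n \<ge> K" for n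
    proof
      show i: "integrable N (\<lambda>x. (f n x - g x)\<^sup>2)"
      proof (rule integrableI_bounded)
        have "(\<integral>\<^sup>+x. ennreal (norm ((f n x - g x)\<^sup>2)) \<partial>N) \<le> ennreal e" using K[OF n] by simp
        then show "(\<integral>\<^sup>+x. ennreal (norm ((f n x - g x)\<^sup>2)) \<partial>N) < \<infinity>"
          by (rule le_less_trans) simp
      qed measurable
      show "(\<integral>x. (f n x - g x)\<^sup>2 \<partial>N) \<le> e"
        using K[OF n] e by (subst (asm) nn_integral_eq_integral[OF i]) auto
    qed
    then show ?thesis by blast
  qed
  obtain K where K: "integrable N (\<lambda>x. (f K x - g x)\<^sup>2)" using fg[of 1] by auto
  have "integrable N (\<lambda>x. (f K x - (f K x - g x))\<^sup>2)"
    by (rule integrable_square_diff) (use f2 K in auto)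
  then show g2: "integrable N (\<lambda>x. (g x)\<^sup>2)" by simp
  show "integrable N (\<lambda>x. (f n x - g x)\<^sup>2)" for n
    by (rule integrable_square_diff) (use f2 g2 in auto)
  show "(\<lambda>n. \<integral>x. (f n x - g x)\<^sup>2 \<partial>N) \<longlonglongrightarrow> 0"
  proof (rule LIMSEQ_I)
    fix e :: real assume "e > 0"
    then obtain K where "\<And>n. n \<ge> K \<Longrightarrow> (\<integral>x. (f n x - g x)\<^sup>2 \<partial>N) \<le> e / 2"
      using fg[of "e / 2"] by auto
    with \<open>e > 0\<close> show "\<exists>K. \<forall>n\<ge>K. norm ((\<integral>x. (f n x - g x)\<^sup>2 \<partial>N) - 0) < e"
      by (intro exI[of _ K]) (fastforce simp: abs_of_nonneg)
  qed
qed

text \<open>Finite measure makes the sequence Cauchy in the mean, hence almost everywhere Cauchy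
  along a subsequence, and the previous lemma upgrades its pointwise limit.\<close>

lemma (in finite_measure) L2_complete:
  fixes f :: "nat \<Rightarrow> 'a \<Rightarrow> real"
  assumes f [measurable]: "\<And>n. f n \<in> borel_measurable M" and f2: "\<And>n. integrable M (\<lambda>x. (f n x)\<^sup>2)"
    and Cauchy: "\<And>e. e > 0 \<Longrightarrow> \<exists>K. \<forall>m\<ge>K. \<forall>n\<ge>K. (\<integral>x. (f m x - f n x)\<^sup>2 \<partial>M) < e"
  obtains g where "g \<in> borel_measurable M" "integrable M (\<lambda>x. (g x)\<^sup>2)"
    "(\<lambda>n. \<integral>x. (f n x - g x)\<^sup>2 \<partial>M) \<longlonglongrightarrow> 0"
proof -
  have ff: "integrable M (\<lambda>x. (f m x - f n x)\<^sup>2)" for m n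
    by (rule integrable_square_diff) (use f2 in auto)
  have abs_le: "\<bar>y\<bar> \<le> (t + y\<^sup>2 / t) / 2" if "t > 0" for t y :: real
  proof -
    have "0 \<le> (t - \<bar>y\<bar>)\<^sup>2 / t" using that by simp
    also have "\<dots> = t - 2 * \<bar>y\<bar> + y\<^sup>2 / t"
      using that by (simp add: power2_diff) (simp add: field_simps power2_eq_square)
    finally show ?thesis by simp
  qed
  have i: "integrable M (f n)" for n
  proof (rule Bochner_Integration.integrable_bound)
    show "integrable M (\<lambda>x. 1 + (f n x)\<^sup>2)" using f2 by simp
    show "AE x in M. norm (f n x) \<le> norm (1 + (f n x)\<^sup>2)"
      using abs_le[of 1] by (intro AE_I2) (simp add: order_trans[OF abs_le[of 1]])
  qed measurable
  have "\<exists>K. \<forall>m\<ge>K. \<forall>n\<ge>K. (\<integral>x. norm (f m x - f n x) \<partial>M) < e" if e: "e > 0" for e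
  proof -
    define V where "V = measure M (space M)"
    \<comment> \<open>With this t, and squares integrating to less than e * t, both terms of the
      bound \<open>(t * V + ... / t) / 2\<close> are below e.\<close>
    define t where "t = e / (V + 1)"
    have V: "V \<ge> 0" by (simp add: V_def)
    then have t: "t > 0" "t * V < e"
      using e by (simp_all add: t_def pos_divide_less_eq algebra_simps)
    obtain K where K: "\<And>m n. m \<ge> K \<Longrightarrow> n \<ge> K \<Longrightarrow> (\<integral>x. (f m x - f n x)\<^sup>2 \<partial>M) < e * t"
      using Cauchy[of "e * t"] e t by auto
    have "(\<integral>x. norm (f m x - f n x) \<partial>M) < e" if "m \<ge> K" "n \<ge> K" for m n
    proof -
      have "(\<integral>x. norm (f m x - f n x) \<partial>M) \<le> (\<integral>x. (t + (f m x - f n x)\<^sup>2 / t) / 2 \<partial>M)"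
        by (rule integral_mono) (use i ff abs_le[OF t(1)] in auto)
      also have "\<dots> = (t * V + (\<integral>x. (f m x - f n x)\<^sup>2 \<partial>M) / t) / 2"
        using ff[of m n] by (simp add: V_def mult.commute)
      also have "\<dots> < e"
      proof -
        have "(\<integral>x. (f m x - f n x)\<^sup>2 \<partial>M) / t < e"
          using K[OF that] t by (simp add: pos_divide_less_eq)
        with t show ?thesis by simp
      qed
      finally show ?thesis .
    qed
    then show ?thesis by blast
  qed
  from cauchy_L1_AE_cauchy_subseq[OF i this] obtain r where r: "strict_mono r"
    and AE: "AE x in M. Cauchy (\<lambda>n. f (r n) x)" by blast
  define g where "g x = lim (\<lambda>n. f (r n) x)" for x
  have g: "g \<in> borel_measurable M" unfolding g_def by measurable
  have lim: "AE x in M. (\<lambda>n. f (r n) x) \<longlonglongrightarrow> g x"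
    using AE by eventually_elim (simp add: g_def Cauchy_convergent_iff convergent_LIMSEQ_iff)
  show ?thesis
    by (rule that[OF g]) (rule L2_limit_of_AE_limit[OF f f2 Cauchy r lim g]; assumption)+
qed

section \<open>Compactness and completeness of the energy space\<close>

lemma D_form_nonneg: "0 \<le> D_form M w w"
  by (simp add: D_form_self)

lemma inner_L_nonneg: "0 \<le> inner_L M w w"
  by (simp add: inner_L_self)

lemma powr_half_square: "0 < (x::real) \<Longrightarrow> (x powr (p / 2))\<^sup>2 = x powr p"
  by (simp add: power2_eq_square flip: powr_add)

text \<open>Points to the left of x suffice, which includes x = 1. In \<open>LI_bound\<close>, t
  makes the energy part at most e, and d then makes the length part at most e; d \<le> x/2 keeps z
  away from 0.\<close>

lemma cal_H0_equicontinuous: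
  assumes M: "2 \<le> M" and w: "\<And>n::nat. w n \<in> cal_H0 M" and C: "\<And>n. inner_L M (w n) (w n) + D_form M (w n) (w n) \<le> C"
    and x: "0 < x" "x \<le> 1" and e: "0 < e"
  obtains d where "d > 0" "d < x" "\<And>n z. x - d \<le> z \<Longrightarrow> z \<le> x \<Longrightarrow> \<bar>w n x - w n z\<bar> \<le> e"
proof -
  have C0: "0 \<le> C" using C[of 0] D_form_nonneg[of M "w 0"] inner_L_nonneg[of M "w 0"] by linarith
  define c where "c = x / 2"
  define t where "t = e / (c powr (1 - M) * (C + 1))"
  have c: "c > 0" using x by (simp add: c_def)
  have t: "t > 0" using e c C0 by (simp add: t_def)
  have tC: "t * c powr (1 - M) * C \<le> e"
  proof -
    have "t * c powr (1 - M) * C = e * (C / (C + 1))" using c by (simp add: t_def)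
    also have "\<dots> \<le> e" using e C0 by (intro mult_left_le) auto
    finally show ?thesis .
  qed
  define d where "d = min (x / 2) (t * e)"
  show ?thesis
  proof
    show "d > 0" "d < x" using x t e by (auto simp: d_def)
    fix n z assume z: "x - d \<le> z" "z \<le> x"
    then have cz: "c \<le> z" by (simp add: c_def d_def)
    have "w n x = w n z + LI z x (weak_deriv (w n))"
      by (rule cal_H0_FTC(2)[OF w]) (use c cz z x M in auto)
    then have "\<bar>w n x - w n z\<bar> = \<bar>LI z x (weak_deriv (w n))\<bar>" by simp
    also have "\<dots> \<le> ((x - z) / t + t * c powr (1 - M) * D_form M (w n) (w n)) / 2"
      unfolding D_form_self by (rule LI_bound[OF cal_H0_weak_deriv(2)[OF w]]) (use c cz z x M t in auto)
    also have "\<dots> \<le> (e + e) / 2"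
    proof (intro divide_right_mono add_mono)
      show "(x - z) / t \<le> e" using z t by (simp add: pos_divide_le_eq d_def mult.commute)
      have "D_form M (w n) (w n) \<le> C" using C[of n] inner_L_nonneg[of M "w n"] by linarith
      then have "t * c powr (1 - M) * D_form M (w n) (w n) \<le> t * c powr (1 - M) * C"
        using t by (intro mult_left_mono) auto
      with tC show "t * c powr (1 - M) * D_form M (w n) (w n) \<le> e" by linarith
    qed simp
    finally show "\<bar>w n x - w n z\<bar> \<le> e" by simp
  qed
qed

text \<open>Convergence is extracted on the rationals of (0,1], spread to all points by
  equicontinuity, and integrated by dominated convergence with the constant 4 C from
  \<open>pointwise_bound\<close>.\<close>

lemma cal_H0_compact:
  assumes M: "2 \<le> M" and w: "\<And>n. w n \<in> cal_H0 M" and C: "\<And>n. inner_L M (w n) (w n) + D_form M (w n) (w n) \<le> C"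
  obtains s :: "nat \<Rightarrow> nat" and f where "strict_mono s" "f \<in> borel_measurable unit_ival"
    "\<And>n. integrable unit_ival (\<lambda>r. r powr (M - 1) * (w (s n) r - f r)\<^sup>2)"
    "(\<lambda>n. \<integral>r. r powr (M - 1) * (w (s n) r - f r)\<^sup>2 \<partial>unit_ival) \<longlonglongrightarrow> 0"
proof -
  have C0: "0 \<le> C" using C[of 0] D_form_nonneg[of M "w 0"] inner_L_nonneg[of M "w 0"] by linarith
  have pb: "r powr (M - 2) * (w n r)\<^sup>2 \<le> C" if "0 < r" "r \<le> 1" for n r
    using pointwise_bound[OF w M that] C by (rule order_trans)
  \<comment> \<open>The functions may blow up at 0. Multiplied by x^p they are bounded by
    \<open>sqrt C\<close> uniformly in n and x, as the extraction principle demands.\<close>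
  define p where "p = (M - 2) / 2"
  have "norm (x powr p * w n x) \<le> sqrt C" if "x \<in> \<rat> \<inter> {0<..1}" for n x
  proof (rule real_le_rsqrt)
    show "(norm (x powr p * w n x))\<^sup>2 \<le> C"
      using pb[of x n] that by (simp add: p_def power_mult_distrib powr_half_square)
  qed
  then obtain s :: "nat \<Rightarrow> nat" where s: "strict_mono s"
    and conv: "\<And>x. x \<in> \<rat> \<inter> {0<..1} \<Longrightarrow> \<exists>l. (\<lambda>n. x powr p * w (s n) x) \<longlonglongrightarrow> l"
    using function_convergent_subsequence[of "\<rat> \<inter> {0<..1}" "\<lambda>n x. x powr p * w n x" "sqrt C"]
      countable_rat by (metis countable_Int1)
  have conv': "Cauchy (\<lambda>n. w (s n) x)" if x: "0 < x" "x \<le> 1" for x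
  proof (rule metric_CauchyI)
    fix e :: real assume e: "e > 0"
    obtain d where d: "d > 0" "d < x" and eq: "\<And>n z. x - d \<le> z \<Longrightarrow> z \<le> x \<Longrightarrow> \<bar>w n x - w n z\<bar> \<le> e / 4"
      using cal_H0_equicontinuous[where w = w, OF M w C x, of "e / 4"] e by (metis divide_pos_pos zero_less_numeral)
    obtain z where z: "z \<in> \<rat>" "x - d < z" "z < x"
      using Rats_dense_in_real[of "x - d" x] d by auto
    then have z01: "z \<in> \<rat> \<inter> {0<..1}" using d x by auto
    obtain l where "(\<lambda>n. z powr p * w (s n) z) \<longlonglongrightarrow> l" using conv[OF z01] by blast
    then have "(\<lambda>n. z powr (- p) * (z powr p * w (s n) z)) \<longlonglongrightarrow> z powr (- p) * l"
      by (rule tendsto_mult_left)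
    moreover have "z powr (- p) * (z powr p * y) = y" for y
      using z01 by (simp add: powr_minus)
    ultimately have "Cauchy (\<lambda>n. w (s n) z)"
      by (simp add: LIMSEQ_imp_Cauchy)
    from metric_CauchyD[OF this, of "e / 4"] e obtain K where
      K: "\<And>m n. m \<ge> K \<Longrightarrow> n \<ge> K \<Longrightarrow> dist (w (s m) z) (w (s n) z) < e / 4" by auto
    show "\<exists>K. \<forall>m\<ge>K. \<forall>n\<ge>K. dist (w (s m) x) (w (s n) x) < e"
    proof (intro exI allI impI)
      fix m n assume "m \<ge> K" "n \<ge> K"
      from K[OF this] eq[of z "s m"] eq[of z "s n"] z e
      show "dist (w (s m) x) (w (s n) x) < e"
        unfolding dist_real_def by linarith
    qed
  qed
  define f where "f x = lim (\<lambda>n. w (s n) x)" for x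
  have lim: "(\<lambda>n. w (s n) x) \<longlonglongrightarrow> f x" if "0 < x" "x \<le> 1" for x
    using conv'[OF that] by (simp add: f_def Cauchy_convergent_iff convergent_LIMSEQ_iff)
  have wm [measurable]: "w n \<in> borel_measurable unit_ival" for n
    by (rule cal_H0_D(3)[OF w])
  have f [measurable]: "f \<in> borel_measurable unit_ival"
    unfolding f_def by measurable
  have fb: "r powr (M - 2) * (f r)\<^sup>2 \<le> C" if r: "0 < r" "r \<le> 1" for r
  proof (rule LIMSEQ_le_const2)
    show "(\<lambda>n. r powr (M - 2) * (w (s n) r)\<^sup>2) \<longlonglongrightarrow> r powr (M - 2) * (f r)\<^sup>2"
      by (intro tendsto_intros lim r)
    show "\<exists>N. \<forall>n\<ge>N. r powr (M - 2) * (w (s n) r)\<^sup>2 \<le> C" using pb[OF r] by blast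
  qed
  have bound: "r powr (M - 1) * (w n r - f r)\<^sup>2 \<le> 4 * C" if r: "0 < r" "r < 1" for n r
  proof -
    have "0 \<le> (w n r + f r)\<^sup>2" by simp
    then have 1: "(w n r - f r)\<^sup>2 \<le> 2 * (w n r)\<^sup>2 + 2 * (f r)\<^sup>2" by (simp add: power2_eq_square algebra_simps)
    have "r powr (M - 1) * (w n r - f r)\<^sup>2 \<le> r powr (M - 2) * (2 * (w n r)\<^sup>2 + 2 * (f r)\<^sup>2)"
      using r 1 by (intro mult_mono powr_mono') auto
    also have "\<dots> \<le> 4 * C"
      using pb[of r n] fb[of r] r by (simp add: distrib_left)
    finally show ?thesis .
  qed
  interpret finite_measure unit_ival by (rule finite_measure_unit)
  have int: "integrable unit_ival (\<lambda>r. r powr (M - 1) * (w (s n) r - f r)\<^sup>2)" for n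
  proof (rule integrable_const_bound)
    show "AE r in unit_ival. norm (r powr (M - 1) * (w (s n) r - f r)\<^sup>2) \<le> 4 * C"
      by (rule AE_unit_I) (use bound in simp)
  qed measurable
  have "(\<lambda>n. \<integral>r. r powr (M - 1) * (w (s n) r - f r)\<^sup>2 \<partial>unit_ival) \<longlonglongrightarrow> (\<integral>r. 0 \<partial>unit_ival)"
  proof (rule integral_dominated_convergence[where w = "\<lambda>_. 4 * C"])
    show "AE r in unit_ival. norm (r powr (M - 1) * (w (s n) r - f r)\<^sup>2) \<le> 4 * C" for n
      by (rule AE_unit_I) (use bound in simp)
    show "AE r in unit_ival. (\<lambda>n. r powr (M - 1) * (w (s n) r - f r)\<^sup>2) \<longlonglongrightarrow> 0"
    proof (rule AE_unit_I)
      fix r :: real assume r: "0 < r" "r < 1"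
      have "(\<lambda>n. r powr (M - 1) * (w (s n) r - f r)\<^sup>2) \<longlonglongrightarrow> r powr (M - 1) * (f r - f r)\<^sup>2"
        using r by (intro tendsto_intros lim) auto
      then show "(\<lambda>n. r powr (M - 1) * (w (s n) r - f r)\<^sup>2) \<longlonglongrightarrow> 0" by simp
    qed
  qed (use int in auto)
  then have "(\<lambda>n. \<integral>r. r powr (M - 1) * (w (s n) r - f r)\<^sup>2 \<partial>unit_ival) \<longlonglongrightarrow> 0" by simp
  from that[OF s f int this] show ?thesis .
qed


text \<open>Multiplication by r^(p/2) is an isometry onto the unweighted space, where the
  completeness results are stated.\<close>

lemma half_weight:
  "integrable unit_ival (\<lambda>r. (r powr (p / 2) * h r)\<^sup>2) \<longleftrightarrow> integrable unit_ival (\<lambda>r. r powr p * (h r)\<^sup>2)"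
  "(\<integral>r. (r powr (p / 2) * h r)\<^sup>2 \<partial>unit_ival) = (\<integral>r. r powr p * (h r)\<^sup>2 \<partial>unit_ival)"
  by (auto intro!: Bochner_Integration.integrable_cong Bochner_Integration.integral_cong
      simp: power_mult_distrib powr_half_square)

lemma half_weight_diff:
  "(\<integral>r. (r powr (p / 2) * h r - r powr (p / 2) * h' r)\<^sup>2 \<partial>unit_ival) = (\<integral>r. r powr p * (h r - h' r)\<^sup>2 \<partial>unit_ival)"
  using half_weight(2)[of p "\<lambda>r. h r - h' r"] by (simp add: right_diff_distrib)

lemma D_form_diff:
  assumes u: "u \<in> cal_H0 M" and v: "v \<in> cal_H0 M" and M: "1 \<le> M"
  shows "D_form M (\<lambda>r. u r + - 1 * v r) (\<lambda>r. u r + - 1 * v r)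
    = (\<integral>r. r powr (M - 1) * (weak_deriv u r - weak_deriv v r)\<^sup>2 \<partial>unit_ival)"
  unfolding D_form_self
proof (rule integral_cong_AE)
  note c = cal_H0_comb[OF u v M, of "- 1"]
  show "(\<lambda>r. r powr (M - 1) * (weak_deriv (\<lambda>r. u r + - 1 * v r) r)\<^sup>2) \<in> borel_measurable unit_ival"
    using cal_H0_D(7)[OF c(1)] by measurable
  show "(\<lambda>r. r powr (M - 1) * (weak_deriv u r - weak_deriv v r)\<^sup>2) \<in> borel_measurable unit_ival"
    using cal_H0_D(7)[OF u] cal_H0_D(7)[OF v] by measurable
  show "AE r in unit_ival. r powr (M - 1) * (weak_deriv (\<lambda>r. u r + - 1 * v r) r)\<^sup>2
      = r powr (M - 1) * (weak_deriv u r - weak_deriv v r)\<^sup>2"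
    using c(2) by eventually_elim simp
qed

lemma inner_L_diff:
  "inner_L M (\<lambda>r. u r + - 1 * v r) (\<lambda>r. u r + - 1 * v r) = (\<integral>r. r powr (M - 3) * (u r - v r)\<^sup>2 \<partial>unit_ival)"
  by (simp add: inner_L_self)

text \<open>Only the derivatives need an abstract limit g. The limit function is its integral from
  1, it is attained pointwise, and the Cauchy property in the r^(M-3) norm then forces convergence
  in that norm to the same function.\<close>

lemma cal_H0_complete:
  assumes M: "2 \<le> M" and w: "\<And>n. w n \<in> cal_H0 M"
    and Cauchy: "\<And>e. e > 0 \<Longrightarrow> \<exists>N::nat. \<forall>m\<ge>N. \<forall>n\<ge>N.
        inner_L M (\<lambda>r. w m r + - 1 * w n r) (\<lambda>r. w m r + - 1 * w n r)
        + D_form M (\<lambda>r. w m r + - 1 * w n r) (\<lambda>r. w m r + - 1 * w n r) < e"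
  shows "\<exists>u\<in>cal_H0 M. (\<lambda>n. inner_L M (\<lambda>r. w n r + - 1 * u r) (\<lambda>r. w n r + - 1 * u r)
        + D_form M (\<lambda>r. w n r + - 1 * u r) (\<lambda>r. w n r + - 1 * u r)) \<longlonglongrightarrow> 0"
proof -
  interpret finite_measure unit_ival by (rule finite_measure_unit)
  have M1: "1 \<le> M" using M by simp
  note d = cal_H0_D[OF w]
  have [measurable]: "w n \<in> borel_measurable unit_ival" "weak_deriv (w n) \<in> borel_measurable unit_ival" for n
    by (rule d)+
  define P where "P n r = r powr ((M - 1) / 2) * weak_deriv (w n) r" for n r
  define U where "U n r = r powr ((M - 3) / 2) * w n r" for n r
  have [measurable]: "P n \<in> borel_measurable unit_ival" "U n \<in> borel_measurable unit_ival" for n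
    unfolding P_def U_def by measurable
  have P2: "integrable unit_ival (\<lambda>r. (P n r)\<^sup>2)" and U2: "integrable unit_ival (\<lambda>r. (U n r)\<^sup>2)" for n
    using d(6,8)[of n] by (simp_all add: P_def U_def half_weight)
  have PD: "(\<integral>r. (P m r - P n r)\<^sup>2 \<partial>unit_ival) = D_form M (\<lambda>r. w m r + - 1 * w n r) (\<lambda>r. w m r + - 1 * w n r)" for m n
    unfolding D_form_diff[OF w w M1] P_def by (rule half_weight_diff)
  have UI: "(\<integral>r. (U m r - U n r)\<^sup>2 \<partial>unit_ival) = inner_L M (\<lambda>r. w m r + - 1 * w n r) (\<lambda>r. w m r + - 1 * w n r)" for m n
    unfolding inner_L_diff U_def by (rule half_weight_diff)
  have CP: "\<exists>K. \<forall>m\<ge>K. \<forall>n\<ge>K. (\<integral>r. (P m r - P n r)\<^sup>2 \<partial>unit_ival) < e" if e: "e > 0" for e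
    unfolding PD using Cauchy[OF e] by (meson inner_L_nonneg add_increasing le_less_trans order_refl)
  have CU: "\<exists>K. \<forall>m\<ge>K. \<forall>n\<ge>K. (\<integral>r. (U m r - U n r)\<^sup>2 \<partial>unit_ival) < e" if e: "e > 0" for e
    unfolding UI using Cauchy[OF e] by (meson D_form_nonneg add_increasing2 le_less_trans order_refl)
  obtain p where p [measurable]: "p \<in> borel_measurable unit_ival" and p2: "integrable unit_ival (\<lambda>r. (p r)\<^sup>2)"
    and Plim: "(\<lambda>n. \<integral>r. (P n r - p r)\<^sup>2 \<partial>unit_ival) \<longlonglongrightarrow> 0"
    using L2_complete[of P, OF _ P2 CP] by auto
  define g where "g r = r powr (- ((M - 1) / 2)) * p r" for r
  have gp: "r powr ((M - 1) / 2) * g r = p r" if "0 < r" for r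
    using that by (simp add: g_def powr_minus)
  have gm [measurable]: "g \<in> borel_measurable unit_ival" unfolding g_def by measurable
  have "integrable unit_ival (\<lambda>r. (r powr ((M - 1) / 2) * g r)\<^sup>2)"
    using p2 by (rule Bochner_Integration.integrable_cong[THEN iffD1, rotated -1]) (auto simp: gp)
  then have g: "g \<in> L2_sp M"
    using gm by (simp add: L2_sp_def half_weight)
  have Pg: "(\<integral>r. (P n r - p r)\<^sup>2 \<partial>unit_ival) = (\<integral>r. r powr (M - 1) * (weak_deriv (w n) r - g r)\<^sup>2 \<partial>unit_ival)" for n
    unfolding half_weight_diff[symmetric] by (rule Bochner_Integration.integral_cong) (auto simp: P_def gp)
  define W where "W x = (if 0 < x \<and> x \<le> 1 then - LI x 1 g else 0)" for x
  have lim: "(\<lambda>n. w n x) \<longlonglongrightarrow> W x" if x: "0 < x" "x < 1" for x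
  proof (rule LIMSEQ_I)
    fix e :: real assume e: "e > 0"
    \<comment> \<open>The threshold \<open>e * e\<close> matches the parameter 1 / e in
      \<open>LI_bound\<close>: the length part is at most e, the energy part below e, and their sum
      is halved.\<close>
    have "(\<lambda>n. x powr (1 - M) * (\<integral>r. (P n r - p r)\<^sup>2 \<partial>unit_ival)) \<longlonglongrightarrow> x powr (1 - M) * 0"
      by (intro tendsto_mult_left Plim)
    then have "\<forall>\<^sub>F n in sequentially. x powr (1 - M) * (\<integral>r. (P n r - p r)\<^sup>2 \<partial>unit_ival) < e * e"
      using e by (intro order_tendstoD(2)) auto
    then obtain N where N: "\<And>n. n \<ge> N \<Longrightarrow> x powr (1 - M) * (\<integral>r. (P n r - p r)\<^sup>2 \<partial>unit_ival) < e * e"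
      unfolding eventually_sequentially by blast
    show "\<exists>N. \<forall>n\<ge>N. norm (w n x - W x) < e"
    proof (intro exI allI impI)
      fix n assume n: "n \<ge> N"
      have "w n 1 = w n x + LI x 1 (weak_deriv (w n))" "integrable (lebesgue_on {x..1}) (weak_deriv (w n))"
        using cal_H0_FTC[OF w M1, of x 1 n] x by auto
      moreover have "integrable (lebesgue_on {x..1}) g"
        by (rule L2_sp_integrable[OF g x(1) M1])
      ultimately have "W x - w n x = LI x 1 (\<lambda>r. weak_deriv (w n) r - g r)"
        using d(2)[of n] x by (simp add: W_def)
      then have "\<bar>w n x - W x\<bar> = \<bar>LI x 1 (\<lambda>r. weak_deriv (w n) r - g r)\<bar>"
        by linarith
      also have "\<dots> \<le> ((1 - x) / (1 / e) + 1 / e * x powr (1 - M) * (\<integral>r. r powr (M - 1) * (weak_deriv (w n) r - g r)\<^sup>2 \<partial>unit_ival)) / 2"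
        by (rule LI_bound[OF _ M1, where c = x])
          (use L2_sp_comb[OF cal_H0_weak_deriv(2)[OF w] g, where c = "- 1"] x e in auto)
      also have "\<dots> < e"
      proof -
        have "1 / e * (x powr (1 - M) * (\<integral>r. (P n r - p r)\<^sup>2 \<partial>unit_ival)) < 1 / e * (e * e)"
          by (rule mult_strict_left_mono[OF N[OF n]]) (use e in simp)
        moreover have "1 / e * (e * e) = e" using e by simp
        moreover have "(1 - x) / (1 / e) \<le> e" using x e by (simp add: mult_left_le_one_le)
        moreover have "(y + z) / 2 < e" if "z < b" "b = e" "y \<le> e" for y z b :: real using that by simp
        ultimately show ?thesis unfolding Pg mult.assoc by blast
      qed
      finally show "norm (w n x - W x) < e" by simp
    qed
  qed
  have Wm [measurable]: "W \<in> borel_measurable unit_ival"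
    by (rule borel_measurable_LIMSEQ_real[where u = w]) (use lim in auto)
  have Um: "(\<lambda>r. r powr ((M - 3) / 2) * W r) \<in> borel_measurable unit_ival" by measurable
  \<comment> \<open>The whole sequence converges pointwise, so the identity serves as the
    subsequence.\<close>
  have Ulim: "AE r in unit_ival. (\<lambda>n. U (id n) r) \<longlonglongrightarrow> r powr ((M - 3) / 2) * W r"
    by (rule AE_unit_I) (use lim in \<open>auto simp: U_def intro!: tendsto_mult_left\<close>)
  have id: "strict_mono (id :: nat \<Rightarrow> nat)" by (simp add: strict_mono_def)
  note UW = L2_limit_of_AE_limit[of U, OF _ U2 CU id Ulim Um]
  have "W \<in> cal_L M"
    using UW(1) Wm by (simp add: cal_L_def half_weight)
  moreover have "W c = - LI c 1 g" if "0 < c" "c \<le> 1" for c using that by (simp add: W_def)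
  ultimately have W: "W \<in> cal_H0 M" and Wg: "AE r in unit_ival. weak_deriv W r = g r"
    using cal_H0_I[OF g M1, of W] by auto
  have [measurable]: "weak_deriv W \<in> borel_measurable unit_ival" by (rule cal_H0_D(7)[OF W])
  have DW: "D_form M (\<lambda>r. w n r + - 1 * W r) (\<lambda>r. w n r + - 1 * W r) = (\<integral>r. (P n r - p r)\<^sup>2 \<partial>unit_ival)" for n
    unfolding D_form_diff[OF w W M1] Pg
  proof (rule integral_cong_AE)
    show "AE r in unit_ival. r powr (M - 1) * (weak_deriv (w n) r - weak_deriv W r)\<^sup>2 = r powr (M - 1) * (weak_deriv (w n) r - g r)\<^sup>2"
      using Wg by eventually_elim simp
  qed measurable
  have IW: "inner_L M (\<lambda>r. w n r + - 1 * W r) (\<lambda>r. w n r + - 1 * W r)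
      = (\<integral>r. (U n r - r powr ((M - 3) / 2) * W r)\<^sup>2 \<partial>unit_ival)" for n
    unfolding inner_L_diff U_def by (rule half_weight_diff[symmetric])
  have "(\<lambda>n. (\<integral>r. (U n r - r powr ((M - 3) / 2) * W r)\<^sup>2 \<partial>unit_ival)
      + (\<integral>r. (P n r - p r)\<^sup>2 \<partial>unit_ival)) \<longlonglongrightarrow> 0 + 0"
    by (intro tendsto_add Plim UW(2)) measurable
  then have "(\<lambda>n. inner_L M (\<lambda>r. w n r + - 1 * W r) (\<lambda>r. w n r + - 1 * W r)
      + D_form M (\<lambda>r. w n r + - 1 * W r) (\<lambda>r. w n r + - 1 * W r)) \<longlonglongrightarrow> 0"
    unfolding DW IW add_0 .
  with W show ?thesis by blast
qed


text \<open>The factor r contributes r^2 to the square and so lifts the weight r^(M-3), which for M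
  = 2 is not integrable at 0, to r^(M-1).\<close>

lemma poly_in_cal_H0:
  assumes M: "2 \<le> M" and Q: "Q = [:0, 1:] * R" "poly Q 1 = 0"
  shows "poly Q \<in> cal_H0 M"
proof (rule cal_H0_I(1)[where g = "poly (pderiv Q)"])
  interpret finite_measure unit_ival by (rule finite_measure_unit)
  have pm [measurable]: "poly q \<in> borel_measurable unit_ival" for q :: "real poly"
  proof -
    have "poly q \<in> borel_measurable borel"
      by (intro borel_measurable_continuous_onI continuous_intros)
    then show ?thesis by (intro measurable_restrict_space1 measurable_completion) simp
  qed
  have int: "integrable unit_ival (\<lambda>r. r powr (M - 1) * (poly q r)\<^sup>2)" for q
  proof -
    have "bounded (poly q ` {0..1})"
      by (intro compact_imp_bounded compact_continuous_image continuous_intros) auto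
    then obtain B where B: "\<And>r. r \<in> {0..1} \<Longrightarrow> \<bar>poly q r\<bar> \<le> B"
      unfolding bounded_iff by (metis imageI real_norm_def)
    show ?thesis
    proof (rule integrable_const_bound)
      show "AE r in unit_ival. norm (r powr (M - 1) * (poly q r)\<^sup>2) \<le> 1 * B\<^sup>2"
      proof (rule AE_unit_I)
        fix r :: real assume r: "0 < r" "r < 1"
        have "r powr (M - 1) \<le> 1" using r M by (simp add: powr_le1)
        moreover have "(poly q r)\<^sup>2 \<le> B\<^sup>2"
          using B[of r] r by (metis abs_le_square_iff abs_of_nonneg abs_ge_zero atLeastAtMost_iff less_imp_le order_trans)
        ultimately have "r powr (M - 1) * (poly q r)\<^sup>2 \<le> 1 * B\<^sup>2" by (intro mult_mono) auto
        then show "norm (r powr (M - 1) * (poly q r)\<^sup>2) \<le> 1 * B\<^sup>2" by simp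
      qed
    qed measurable
  qed
  show "poly (pderiv Q) \<in> L2_sp M" using int pm by (simp add: L2_sp_def)
  have "integrable unit_ival (\<lambda>r. r powr (M - 3) * (poly Q r)\<^sup>2)"
    using int[of R]
    by (rule Bochner_Integration.integrable_cong[THEN iffD1, rotated -1])
      (auto simp: Q(1) powr_weights power_mult_distrib)
  then show "poly Q \<in> cal_L M" using pm by (simp add: cal_L_def)
  show "1 \<le> M" using M by simp
  fix c :: real assume "0 < c" "c \<le> 1"
  have "poly Q 1 = poly Q c + LI c 1 (poly (pderiv Q))"
    by (rule FTC_LI[OF \<open>c \<le> 1\<close> _ poly_DERIV]) (intro continuous_intros)
  then show "poly Q c = - LI c 1 (poly (pderiv Q))" using Q(2) by simp
qed

lemma inner_L_self_eq_0_iff: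
  assumes w: "w \<in> cal_L M"
  shows "inner_L M w w = 0 \<longleftrightarrow> \<not> nonzero_fun w"
proof -
  have "inner_L M w w = 0 \<longleftrightarrow> (AE r in unit_ival. r powr (M - 3) * (w r)\<^sup>2 = 0)"
    unfolding inner_L_self using w by (intro integral_nonneg_eq_0_iff_AE) (auto simp: cal_L_def)
  also have "\<dots> \<longleftrightarrow> (AE r in unit_ival. w r = 0)"
    by (rule AE_cong) auto
  finally show ?thesis by (simp add: nonzero_fun_def)
qed

lemma nonzero_fun_poly:
  assumes "Q \<noteq> 0"
  shows "nonzero_fun (poly Q)"
  unfolding nonzero_fun_def
proof
  have "AE x in lebesgue. x \<notin> {x. poly Q x = 0}"
    using assms by (intro AE_not_in null_sets_completionI finite_imp_null_set_lborel poly_roots_finite)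
  moreover assume "AE r in unit_ival. poly Q r = 0"
  then have "AE x in lebesgue. x \<in> {0<..<1} \<longrightarrow> poly Q x = 0" by (simp add: AE_restrict_space_iff)
  ultimately have "AE x in lebesgue. x \<notin> {0<..<1::real}"
    by eventually_elim auto
  then have "emeasure lebesgue {0<..<1::real} = 0"
    by (subst (asm) AE_iff_measurable[of "{0<..<1}"]) auto
  then show False by simp
qed

subsection \<open>Iterated minimization of an abstract Rayleigh quotient\<close>

text \<open>
  Instead of a vector space structure there is a single operation \<open>comb u c v\<close>, meaning \<open>u + c v\<close>. The
  map \<open>E\<close> from polynomials is only there to make \<open>H\<close> infinite-dimensional, so that the competitors
  of every step are nonempty.
\<close>

locale rayleigh_forms =
  fixes H :: "'f set" and comb :: "'f \<Rightarrow> real \<Rightarrow> 'f \<Rightarrow> 'f"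
    and ip D K :: "'f \<Rightarrow> 'f \<Rightarrow> real" and A k :: real
    and E :: "real poly \<Rightarrow> 'f"
  assumes comb_in: "u \<in> H \<Longrightarrow> v \<in> H \<Longrightarrow> comb u c v \<in> H"
    and ip_comb: "u \<in> H \<Longrightarrow> v \<in> H \<Longrightarrow> w \<in> H \<Longrightarrow> ip (comb u c v) w = ip u w + c * ip v w"
    and D_comb: "u \<in> H \<Longrightarrow> v \<in> H \<Longrightarrow> w \<in> H \<Longrightarrow> D (comb u c v) w = D u w + c * D v w"
    and K_comb: "u \<in> H \<Longrightarrow> v \<in> H \<Longrightarrow> w \<in> H \<Longrightarrow> K (comb u c v) w = K u w + c * K v w"
    and ip_sym: "ip u v = ip v u" and D_sym: "D u v = D v u" and K_sym: "K u v = K v u"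
    and ip_nonneg: "0 \<le> ip u u"
    and K_bound: "u \<in> H \<Longrightarrow> \<bar>K u u\<bar> \<le> A * ip u u"
    and D_ge: "u \<in> H \<Longrightarrow> k * ip u u \<le> D u u"
    and compact: "(\<And>n. f n \<in> H) \<Longrightarrow> (\<And>n. ip (f n) (f n) + D (f n) (f n) \<le> C) \<Longrightarrow>
      \<exists>s::nat \<Rightarrow> nat. strict_mono s \<and> (\<forall>e>0. \<exists>N. \<forall>m\<ge>N. \<forall>n\<ge>N.
        K (comb (f (s m)) (-1) (f (s n))) (comb (f (s m)) (-1) (f (s n))) < e)"
    and complete: "(\<And>n. f n \<in> H) \<Longrightarrow> (\<And>e. e > 0 \<Longrightarrow> \<exists>N::nat. \<forall>m\<ge>N. \<forall>n\<ge>N.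
        ip (comb (f m) (-1) (f n)) (comb (f m) (-1) (f n))
        + D (comb (f m) (-1) (f n)) (comb (f m) (-1) (f n)) < e) \<Longrightarrow>
      \<exists>u\<in>H. (\<lambda>n. ip (comb (f n) (-1) u) (comb (f n) (-1) u)
        + D (comb (f n) (-1) u) (comb (f n) (-1) u)) \<longlonglongrightarrow> 0"
    and E_in: "E p \<in> H" and E_comb: "E (p + smult c p') = comb (E p) c (E p')"
    and E_nonzero: "p \<noteq> 0 \<Longrightarrow> ip (E p) (E p) \<noteq> 0"
    and k_nonneg: "0 \<le> k"
begin

definition q :: "'f \<Rightarrow> 'f \<Rightarrow> real" where "q u v = D u v - K u v"

text \<open>Being nonzero reads \<open>ip w w \<noteq> 0\<close>: the type \<open>'f\<close> has no
  zero, and functions vanishing almost everywhere have to be excluded as well.\<close>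

definition comps :: "(nat \<Rightarrow> 'f) \<Rightarrow> nat \<Rightarrow> 'f set"
  where "comps \<psi> i = {w \<in> H. ip w w \<noteq> 0 \<and> (\<forall>j\<in>{1..<i}. ip w (\<psi> j) = 0)}"

definition nu :: "(nat \<Rightarrow> 'f) \<Rightarrow> nat \<Rightarrow> real"
  where "nu \<psi> i = (INF w\<in>comps \<psi> i. q w w / ip w w)"

definition att :: "(nat \<Rightarrow> 'f) \<Rightarrow> nat \<Rightarrow> 'f \<Rightarrow> bool"
  where "att \<psi> i w \<longleftrightarrow> w \<in> comps \<psi> i \<and> q w w / ip w w = nu \<psi> i"

definition reached :: "(nat \<Rightarrow> 'f) \<Rightarrow> nat \<Rightarrow> bool"
  where "reached \<psi> i \<longleftrightarrow> 1 \<le> i \<and> (\<forall>j\<in>{1..<i}. nu \<psi> j < k \<and> att \<psi> j (\<psi> j))"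

definition weak_eigen :: "real \<Rightarrow> 'f \<Rightarrow> bool"
  where "weak_eigen \<nu> u \<longleftrightarrow> u \<in> H \<and> (\<forall>v\<in>H. q u v = \<nu> * ip u v)"

section \<open>Bilinear algebra and lower bounds for the forms\<close>

lemma ip_comb_right: "u \<in> H \<Longrightarrow> v \<in> H \<Longrightarrow> w \<in> H \<Longrightarrow> ip w (comb u c v) = ip w u + c * ip w v"
  by (metis ip_comb ip_sym)

lemma q_sym: "q u v = q v u"
  by (simp add: q_def D_sym[of u v] K_sym[of u v])

lemma q_comb: "u \<in> H \<Longrightarrow> v \<in> H \<Longrightarrow> w \<in> H \<Longrightarrow> q (comb u c v) w = q u w + c * q v w"
  by (simp add: q_def D_comb K_comb algebra_simps)

lemma q_comb_right: "u \<in> H \<Longrightarrow> v \<in> H \<Longrightarrow> w \<in> H \<Longrightarrow> q w (comb u c v) = q w u + c * q w v"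
  by (metis q_comb q_sym)

lemma ip_comb_square:
  assumes "u \<in> H" "v \<in> H"
  shows "ip (comb u c v) (comb u c v) = ip u u + 2 * c * ip u v + c\<^sup>2 * ip v v"
  using assms
  by (simp add: ip_comb ip_comb_right comb_in ip_sym[of v u] power2_eq_square algebra_simps)

lemma q_comb_square:
  assumes "u \<in> H" "v \<in> H"
  shows "q (comb u c v) (comb u c v) = q u u + 2 * c * q u v + c\<^sup>2 * q v v"
  using assms
  by (simp add: q_comb q_comb_right comb_in q_sym[of v u] power2_eq_square algebra_simps)

lemma D_le: "u \<in> H \<Longrightarrow> D u u \<le> q u u + A * ip u u"
  using K_bound[of u] by (simp add: q_def)

lemma q_ge: "u \<in> H \<Longrightarrow> (k - A) * ip u u \<le> q u u"
  using K_bound[of u] D_ge[of u] by (simp add: q_def algebra_simps)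

lemma q_nonneg_if_ip_eq_0:
  assumes "u \<in> H" "ip u u = 0"
  shows "0 \<le> q u u"
  using q_ge[OF assms(1)] assms(2) by simp

lemma ip_Cauchy_Schwarz:
  assumes "u \<in> H" "v \<in> H"
  shows "(ip u v)\<^sup>2 \<le> ip u u * ip v v"
proof (cases "ip v v = 0")
  case True
  have "0 \<le> ip u u + 2 * c * ip u v" for c
    using ip_nonneg[of "comb u c v"] ip_comb_square[OF assms, of c] True by simp
  \<comment> \<open>The form is only semidefinite. If \<open>ip u v\<close> were nonzero, this c
    would give the affine expression the value -1.\<close>
  from this[of "- (ip u u + 1) / (2 * ip u v)"] have "ip u v = 0"
    by (rule_tac ccontr) (simp add: field_simps)
  then show ?thesis using True by simp
next
  case False
  then have pos: "ip v v > 0" using ip_nonneg[of v] by simp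
  have "0 \<le> ip u u + 2 * (- ip u v / ip v v) * ip u v + (- ip u v / ip v v)\<^sup>2 * ip v v"
    using ip_nonneg[of "comb u (- ip u v / ip v v) v"] ip_comb_square[OF assms] by metis
  also have "\<dots> = ip u u - (ip u v)\<^sup>2 / ip v v"
    using pos by (simp add: power2_eq_square field_simps)
  finally show ?thesis using pos by (simp add: field_simps)
qed

lemma bdd_below_rayleigh: "bdd_below ((\<lambda>w. q w w / ip w w) ` comps \<psi> i)"
proof (rule bdd_belowI2)
  fix w assume "w \<in> comps \<psi> i"
  then have "w \<in> H" "ip w w > 0"
    using ip_nonneg[of w] by (auto simp: comps_def)
  with q_ge[of w] show "k - A \<le> q w w / ip w w"
    by (simp add: field_simps)
qed

lemma nu_le: "w \<in> comps \<psi> i \<Longrightarrow> nu \<psi> i \<le> q w w / ip w w"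
  unfolding nu_def by (rule cINF_lower[OF bdd_below_rayleigh])

text \<open>
  Each orthogonality condition is imposed by eliminating with one member of the sequence; that
  the degrees stay strictly increasing keeps the remaining members nonzero.
\<close>

lemma orthogonal_sequence:
  fixes \<psi> :: "nat \<Rightarrow> 'f"
  assumes "\<And>j. j \<in> {1..<i} \<Longrightarrow> \<psi> j \<in> H"
  shows "\<exists>P :: nat \<Rightarrow> real poly. strict_mono (\<lambda>n. degree (P n)) \<and>
           (\<forall>n. \<forall>j\<in>{1..<i}. ip (E (P n)) (\<psi> j) = 0)"
  using assms
proof (induction i)
  case 0
  show ?case
    by (intro exI[of _ "\<lambda>n. monom 1 n"]) (auto simp: degree_monom_eq strict_mono_def)
next
  case (Suc i)
  obtain P :: "nat \<Rightarrow> real poly" where P: "strict_mono (\<lambda>n. degree (P n))"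
    and o: "\<And>n j. j \<in> {1..<i} \<Longrightarrow> ip (E (P n)) (\<psi> j) = 0"
    using Suc.IH Suc.prems by fastforce
  show ?case
  proof (cases "i = 0 \<or> (\<forall>n. ip (E (P n)) (\<psi> i) = 0)")
    case True
    with o P show ?thesis
      by (intro exI[of _ P]) (force simp: less_Suc_eq)
  next
    case False
    then obtain p where i: "i \<noteq> 0" and p: "ip (E (P p)) (\<psi> i) \<noteq> 0" by blast
    define c where "c n = - ip (E (P (Suc p + n))) (\<psi> i) / ip (E (P p)) (\<psi> i)" for n
    define R where "R n = P (Suc p + n) + smult (c n) (P p)" for n
    have R: "ip (E (R n)) v = ip (E (P (Suc p + n))) v + c n * ip (E (P p)) v" if "v \<in> H" for n v
      using that by (simp add: R_def E_comb E_in ip_comb)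
    have deg: "degree (R n) = degree (P (Suc p + n))" for n
    proof -
      have "degree (P p) < degree (P (Suc p + n))"
        using strict_monoD[OF P, of p "Suc p + n"] by simp
      then show ?thesis
        unfolding R_def by (intro degree_add_eq_left le_less_trans[OF degree_smult_le])
    qed
    have in_H: "\<psi> j \<in> H" if "j \<in> {1..<Suc i}" for j using Suc.prems that by blast
    have "ip (E (R n)) (\<psi> j) = 0" if j: "j \<in> {1..<Suc i}" for n j
    proof (cases "j = i")
      case True
      then show ?thesis
        using p in_H[OF j] by (simp add: R c_def)
    next
      case False
      then have "j \<in> {1..<i}" using j by auto
      then show ?thesis
        using o in_H[OF j] by (simp add: R)
    qed
    moreover have "strict_mono (\<lambda>n. degree (R n))"
      using strict_monoD[OF P] by (auto simp: strict_mono_def deg)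
    ultimately show ?thesis by blast
  qed
qed

lemma comps_nonempty:
  fixes \<psi> :: "nat \<Rightarrow> 'f"
  assumes "\<And>j. j \<in> {1..<i} \<Longrightarrow> \<psi> j \<in> H"
  shows "comps \<psi> i \<noteq> {}"
proof -
  obtain P :: "nat \<Rightarrow> real poly" where P: "strict_mono (\<lambda>n. degree (P n))"
    and o: "\<forall>n. \<forall>j\<in>{1..<i}. ip (E (P n)) (\<psi> j) = 0"
    using orthogonal_sequence[of i \<psi>, OF assms] by blast
  \<comment> \<open>Index 1 rather than 0: its degree exceeds that of \<open>P 0\<close> and is
    therefore positive, whereas \<open>P 0\<close> may have degree 0.\<close>
  have "P 1 \<noteq> 0"
    using strict_monoD[OF P, of 0 1] by auto
  then have "E (P 1) \<in> comps \<psi> i"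
    using o E_in E_nonzero by (auto simp: comps_def)
  then show ?thesis by blast
qed

lemma reached_in_H:
  assumes "reached \<psi> i" "j \<in> {1..<i}"
  shows "\<psi> j \<in> H" "ip (\<psi> j) (\<psi> j) \<noteq> 0" "\<And>l. l \<in> {1..<j} \<Longrightarrow> ip (\<psi> j) (\<psi> l) = 0"
  using assms by (auto simp: reached_def att_def comps_def)

lemma reached_orthogonal:
  assumes "reached \<psi> i" "j \<in> {1..<i}" "l \<in> {1..<i}" "j \<noteq> l"
  shows "ip (\<psi> j) (\<psi> l) = 0"
  using assms reached_in_H(3)[OF assms(1)] by (metis atLeastLessThan_iff ip_sym linorder_neqE_nat)

text \<open>Also covers vectors with \<open>ip w w = 0\<close>, which are not competitors but do
  arise as differences; for them the bound k - A on the quotient becomes q \<ge> 0.\<close>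

lemma form_nonneg:
  assumes "w \<in> H" "\<forall>j\<in>{1..<i}. ip w (\<psi> j) = 0"
  shows "nu \<psi> i * ip w w \<le> q w w"
proof (cases "ip w w = 0")
  case True
  then show ?thesis using q_nonneg_if_ip_eq_0[OF assms(1)] by simp
next
  case False
  then have w: "w \<in> comps \<psi> i" using assms by (simp add: comps_def)
  have "ip w w > 0" using False ip_nonneg[of w] by simp
  with nu_le[OF w] show ?thesis
    by (simp add: pos_le_divide_eq)
qed

lemma relatively_compact:
  assumes w: "\<And>n. w n \<in> H" "\<And>n. ip (w n) (w n) = 1" "\<And>n. q (w n) (w n) \<le> C"
  obtains s :: "nat \<Rightarrow> nat" where "strict_mono s"
    "\<And>e. e > 0 \<Longrightarrow> \<exists>N. \<forall>m\<ge>N. \<forall>n\<ge>N.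
        K (comb (w (s m)) (-1) (w (s n))) (comb (w (s m)) (-1) (w (s n))) < e"
proof -
  have "ip (w n) (w n) + D (w n) (w n) \<le> 1 + C + A" for n
    using D_le[OF w(1), of n] w(2,3)[of n] by simp
  from compact[of w, OF w(1) this] obtain s :: "nat \<Rightarrow> nat" where s: "strict_mono s"
    and K: "\<forall>e>0. \<exists>N. \<forall>m\<ge>N. \<forall>n\<ge>N.
        K (comb (w (s m)) (-1) (w (s n))) (comb (w (s m)) (-1) (w (s n))) < e"
    by (elim exE conjE)
  show ?thesis
    by (rule that[OF s]) (use K in simp)
qed

lemma coercive:
  assumes "u \<in> H"
  shows "(k - l) * ip u u \<le> (q u u - l * ip u u) + K u u"
  using D_ge[OF assms] by (simp add: q_def algebra_simps)

text \<open>The last factor is D - l ip, so it dominates (k - l) ip by the lower bound on D, and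
  then D as well. The absolute value appears because l may be negative.\<close>

lemma coercive_full:
  assumes "u \<in> H" "l < k"
  shows "ip u u + D u u \<le> ((1 + \<bar>l\<bar>) / (k - l) + 1) * (q u u - l * ip u u + K u u)"
proof -
  let ?B = "q u u - l * ip u u + K u u"
  have 1: "ip u u \<le> ?B / (k - l)"
    using coercive[OF assms(1), of l] assms(2) by (simp add: field_simps)
  have "ip u u + D u u = (1 + l) * ip u u + ?B"
    by (simp add: q_def algebra_simps)
  also have "\<dots> \<le> (1 + \<bar>l\<bar>) * ip u u + ?B"
    using ip_nonneg[of u] by (simp add: mult_right_mono)
  also have "\<dots> \<le> (1 + \<bar>l\<bar>) * (?B / (k - l)) + ?B"
    using 1 by (intro add_right_mono mult_left_mono) auto
  also have "\<dots> = ((1 + \<bar>l\<bar>) / (k - l) + 1) * ?B"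
    by (simp add: distrib_right)
  finally show ?thesis .
qed

lemma normalize:
  assumes "v \<in> comps \<psi> i" and H\<psi>: "\<And>j. j \<in> {1..<i} \<Longrightarrow> \<psi> j \<in> H"
  obtains w where "w \<in> comps \<psi> i" "ip w w = 1" "q w w = q v v / ip v v"
proof -
  define t where "t = 1 / sqrt (ip v v)"
  have v: "v \<in> H" "ip v v > 0" "\<And>j. j \<in> {1..<i} \<Longrightarrow> ip v (\<psi> j) = 0"
    using assms(1) ip_nonneg[of v] by (auto simp: comps_def)
  have t2: "t\<^sup>2 = 1 / ip v v"
    using v(2) by (simp add: t_def power_divide)
  \<comment> \<open>Scaling by t, written as v + (t - 1) v with the only operation at hand.\<close>
  define w where "w = comb v (t - 1) v"
  have H: "w \<in> H" by (simp add: w_def comb_in v)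
  have "ip w w = t\<^sup>2 * ip v v" "q w w = t\<^sup>2 * q v v"
    using v by (simp_all add: w_def ip_comb_square q_comb_square power2_eq_square algebra_simps)
  then have ip1: "ip w w = 1" and qq: "q w w = q v v / ip v v"
    using v(2) by (simp_all add: t2)
  have "w \<in> comps \<psi> i"
  proof -
    have "ip w (\<psi> j) = 0" if "j \<in> {1..<i}" for j
      using v(3)[OF that] v(1) H\<psi>[OF that] by (simp add: w_def ip_comb)
    then show ?thesis using H ip1 by (simp add: comps_def)
  qed
  with ip1 qq that show ?thesis by blast
qed


text \<open>The parallelogram law for q - \<nu> ip, with the nonnegative term for the opposite sign
  dropped.\<close>

lemma form_comb_diff_le:
  assumes u: "u \<in> H" "\<forall>j\<in>{1..<i}. ip u (\<psi> j) = 0" and v: "v \<in> H" "\<forall>j\<in>{1..<i}. ip v (\<psi> j) = 0"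
    and H\<psi>: "\<And>j. j \<in> {1..<i} \<Longrightarrow> \<psi> j \<in> H" and c: "c\<^sup>2 = 1"
  shows "q (comb u c v) (comb u c v) - nu \<psi> i * ip (comb u c v) (comb u c v)
           \<le> 2 * (q u u - nu \<psi> i * ip u u) + 2 * (q v v - nu \<psi> i * ip v v)"
proof -
  have "nu \<psi> i * ip (comb u (-c) v) (comb u (-c) v) \<le> q (comb u (-c) v) (comb u (-c) v)"
    by (rule form_nonneg) (use u v H\<psi> in \<open>auto simp: comb_in ip_comb\<close>)
  then show ?thesis
    unfolding q_comb_square[OF u(1) v(1)] ip_comb_square[OF u(1) v(1)]
    by (simp add: c algebra_simps)
qed

proposition attained:
  assumes r: "reached \<psi> i" and lt: "nu \<psi> i < k"
  shows "\<exists>w. att \<psi> i w"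
proof -
  define l where "l = nu \<psi> i"
  define B where "B u = q u u - l * ip u u" for u
  have H\<psi>: "\<psi> j \<in> H" if "j \<in> {1..<i}" for j using reached_in_H(1)[OF r that] .
  have "\<exists>w. w \<in> comps \<psi> i \<and> ip w w = 1 \<and> B w < 1 / Suc n" for n
  proof -
    have "(INF w\<in>comps \<psi> i. q w w / ip w w) < l + 1 / Suc n"
      by (simp add: l_def nu_def)
    then obtain v where "v \<in> comps \<psi> i" "q v v / ip v v < l + 1 / Suc n"
      using cINF_less_iff[OF comps_nonempty[of i \<psi>, OF H\<psi>] bdd_below_rayleigh] by blast
    then show ?thesis
      using normalize[of v \<psi> i, OF \<open>v \<in> comps \<psi> i\<close> H\<psi>] by (metis B_def add_diff_cancel_left' diff_strict_right_mono mult.right_neutral)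
  qed
  then obtain w where w: "\<And>n. w n \<in> comps \<psi> i" "\<And>n. ip (w n) (w n) = 1"
    and B_lt: "\<And>n. B (w n) < 1 / Suc n" by metis
  have H: "w n \<in> H" and o: "\<forall>j\<in>{1..<i}. ip (w n) (\<psi> j) = 0" for n
    using w(1)[of n] by (auto simp: comps_def)
  have "q (w n) (w n) \<le> l + 1" for n
  proof -
    have "B (w n) \<le> 1" by (rule less_imp_le[OF less_le_trans[OF B_lt]]) simp
    then show ?thesis by (simp add: B_def w)
  qed
  with relatively_compact[of w "l + 1", OF H w(2)] obtain s :: "nat \<Rightarrow> nat" where s: "strict_mono s"
    and Ks: "\<And>e. e > 0 \<Longrightarrow> \<exists>N. \<forall>m\<ge>N. \<forall>n\<ge>N.
        K (comb (w (s m)) (-1) (w (s n))) (comb (w (s m)) (-1) (w (s n))) < e" by metis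
  define f where "f n = w (s n)" for n
  let ?d = "\<lambda>m n. comb (f m) (-1) (f n)"
  have fH: "f n \<in> H" and fo: "\<forall>j\<in>{1..<i}. ip (f n) (\<psi> j) = 0" for n
    using H o by (auto simp: f_def)
  have Bf: "B (f n) < 1 / Suc n" for n
  proof -
    have "1 / real (Suc (s n)) \<le> 1 / real (Suc n)"
      using seq_suble[OF s, of n] by (intro divide_left_mono) auto
    with B_lt[of "s n"] show ?thesis by (simp add: f_def)
  qed
  define c where "c = (1 + \<bar>l\<bar>) / (k - l) + 1"
  have c: "c > 0" using lt by (simp add: c_def l_def add_nonneg_pos)
  have "\<exists>N. \<forall>m\<ge>N. \<forall>n\<ge>N. ip (?d m n) (?d m n) + D (?d m n) (?d m n) < e" if e: "e > 0" for e
  proof -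
    \<comment> \<open>Budget: values of B below e / (8 c) give differences below 4 e / (8 c) = e /
      (2 c). The compact part adds at most as much, and coercivity multiplies the sum by c.\<close>
    from Ks[of "e / (2 * c)"] obtain N1 where
      N1: "\<And>m n. m \<ge> N1 \<Longrightarrow> n \<ge> N1 \<Longrightarrow> K (?d m n) (?d m n) < e / (2 * c)"
      using c e unfolding f_def by (metis divide_pos_pos mult_pos_pos zero_less_numeral)
    obtain N2 where N2: "1 / real (Suc N2) < e / (8 * c)"
      using c e nat_approx_posE[of "e / (8 * c)"] by auto
    have "ip (?d m n) (?d m n) + D (?d m n) (?d m n) < e" if "m \<ge> max N1 N2" "n \<ge> max N1 N2" for m n
    proof -
      have "B (f p) < e / (8 * c)" if "p \<ge> N2" for p
      proof -
        have "1 / real (Suc p) \<le> 1 / real (Suc N2)"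
          using that by (intro divide_left_mono) auto
        with N2 Bf[of p] show ?thesis by linarith
      qed
      from this[of m] this[of n] that
      have "B (?d m n) < e / (2 * c)"
        using form_comb_diff_le[OF fH[of m] fo[of m] fH[of n] fo[of n] H\<psi>, of "-1"] by (simp add: B_def l_def)
      with N1[of m n] that have "B (?d m n) + K (?d m n) (?d m n) < e / c" by simp
      then have "c * (B (?d m n) + K (?d m n) (?d m n)) < e"
        using c by (simp add: pos_less_divide_eq mult.commute)
      with coercive_full[of "?d m n" l] lt show ?thesis
        by (simp add: comb_in fH B_def c_def l_def)
    qed
    then show ?thesis by blast
  qed
  from complete[of f, OF fH this] obtain u where u: "u \<in> H"
    and lim: "(\<lambda>n. ip (comb (f n) (-1) u) (comb (f n) (-1) u) + D (comb (f n) (-1) u) (comb (f n) (-1) u)) \<longlonglongrightarrow> 0"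
    by blast
  let ?g = "\<lambda>n. comb (f n) (-1) u"
  have gH: "?g n \<in> H" for n by (simp add: comb_in fH u)
  have D0: "0 \<le> D v v" if "v \<in> H" for v
    using D_ge[OF that] ip_nonneg[of v] k_nonneg by (meson mult_nonneg_nonneg order_trans)
  have ip_lim: "(\<lambda>n. ip (?g n) (?g n)) \<longlonglongrightarrow> 0"
    by (rule tendsto_sandwich[OF _ _ tendsto_const lim]) (auto simp: ip_nonneg D0 gH)
  have D_lim: "(\<lambda>n. D (?g n) (?g n)) \<longlonglongrightarrow> 0"
    by (rule tendsto_sandwich[OF _ _ tendsto_const lim]) (auto simp: ip_nonneg D0 gH)
  \<comment> \<open>Up to sign, \<open>ip u (\<psi> j)\<close> equals the product of the remainder f
    n - u with \<psi> j, which tends to 0 by Cauchy-Schwarz.\<close>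
  have uo: "ip u (\<psi> j) = 0" if j: "j \<in> {1..<i}" for j
  proof -
    have "(ip u (\<psi> j))\<^sup>2 \<le> ip (?g n) (?g n) * ip (\<psi> j) (\<psi> j)" for n
      using ip_Cauchy_Schwarz[OF gH[of n] H\<psi>[OF j]] fo j by (simp add: ip_comb fH u H\<psi>)
    moreover have "(\<lambda>n. ip (?g n) (?g n) * ip (\<psi> j) (\<psi> j)) \<longlonglongrightarrow> 0"
      using tendsto_mult_right[OF ip_lim, of "ip (\<psi> j) (\<psi> j)"] by simp
    ultimately have "(ip u (\<psi> j))\<^sup>2 \<le> 0"
      by (intro LIMSEQ_le_const) auto
    then show ?thesis by simp
  qed
  have fg: "ip (comb u 1 (?g n)) v = ip (f n) v" "q (comb u 1 (?g n)) v = q (f n) v" if "v \<in> H" for v n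
    using that by (simp_all add: ip_comb q_comb fH u comb_in)
  \<comment> \<open>If u were null, f n - u would keep the norm 1 of f n and could not tend to
    0.\<close>
  have "ip u u \<noteq> 0"
  proof
    assume 0: "ip u u = 0"
    have "1 = ip (?g n) (?g n)" for n
    proof -
      have "ip (f n) u = 0"
        using ip_Cauchy_Schwarz[OF fH[of n] u] 0 by simp
      then show ?thesis
        using 0 w(2)[of "s n"] by (simp add: ip_comb_square[OF fH u] flip: f_def)
    qed
    with ip_lim show False
      using LIMSEQ_unique[OF ip_lim, of 1] by simp
  qed
  then have uc: "u \<in> comps \<psi> i" using u uo by (simp add: comps_def)
  have "B u \<le> 0"
  proof -
    \<comment> \<open>The forms do not distinguish u from f n - (f n - u). The parallelogram bound
      thus replaces a continuity argument for q: B tends to 0 along f n, and along the remainder it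
      is bounded by a multiple of the energy.\<close>
    have "B u \<le> 2 * (D (?g n) (?g n) + (A + \<bar>l\<bar>) * ip (?g n) (?g n)) + 2 * (1 / Suc n)" for n
    proof -
      have "B (comb (f n) (-1) (?g n)) \<le> 2 * B (f n) + 2 * B (?g n)"
        unfolding B_def l_def
        by (rule form_comb_diff_le) (use fH fo u uo gH H\<psi> in \<open>auto simp: ip_comb\<close>)
      moreover have "B (comb (f n) (-1) (?g n)) = B u"
        unfolding B_def
        by (simp add: q_comb_square ip_comb_square fH gH q_comb q_comb_right ip_comb ip_comb_right u
            ip_sym[of u "f n"] q_sym[of u "f n"] algebra_simps)
      moreover have "B (?g n) \<le> D (?g n) (?g n) + (A + \<bar>l\<bar>) * ip (?g n) (?g n)"
      proof -
        have "- l * ip (?g n) (?g n) \<le> \<bar>l\<bar> * ip (?g n) (?g n)"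
          by (intro mult_right_mono ip_nonneg) simp
        with K_bound[OF gH[of n]] show ?thesis by (simp add: B_def q_def algebra_simps)
      qed
      moreover have "x \<le> 2 * b' + 2 * c" if "y \<le> 2 * a + 2 * b" "y = x" "b \<le> b'" "a < c" for x y a b b' c :: real
        using that by linarith
      ultimately show ?thesis using Bf[of n] by blast
    qed
    moreover have "(\<lambda>n. 2 * (D (?g n) (?g n) + (A + \<bar>l\<bar>) * ip (?g n) (?g n)) + 2 * (1 / Suc n)) \<longlonglongrightarrow>
      2 * (0 + (A + \<bar>l\<bar>) * 0) + 2 * 0"
      by (intro tendsto_intros D_lim ip_lim) (use LIMSEQ_inverse_real_of_nat in \<open>simp add: inverse_eq_divide\<close>)
    ultimately show ?thesis
      by (intro LIMSEQ_le_const[of _ 0 "B u"]) auto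
  qed
  then have "q u u / ip u u \<le> l"
    using \<open>ip u u \<noteq> 0\<close> ip_nonneg[of u] by (simp add: B_def pos_divide_le_eq less_le)
  with nu_le[OF uc] uc have "att \<psi> i u" by (simp add: att_def l_def)
  then show ?thesis by blast
qed

text \<open>Gram-Schmidt in dual form: subtracting the projection onto the last \<psi> shows that L
  already vanishes on the complement of the others, and the induction removes them one by
  one.\<close>

lemma annihilates_if_orthogonal:
  fixes \<psi> :: "nat \<Rightarrow> 'f"
  assumes lin: "\<And>u v c. u \<in> H \<Longrightarrow> v \<in> H \<Longrightarrow> L (comb u c v) = L u + c * L v"
    and H\<psi>: "\<And>j. j \<in> {1..<i} \<Longrightarrow> \<psi> j \<in> H \<and> ip (\<psi> j) (\<psi> j) \<noteq> 0 \<and> L (\<psi> j) = (0::real)"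
    and o: "\<And>j l. j \<in> {1..<i} \<Longrightarrow> l \<in> {1..<i} \<Longrightarrow> j \<noteq> l \<Longrightarrow> ip (\<psi> j) (\<psi> l) = 0"
    and L: "\<And>u. u \<in> H \<Longrightarrow> \<forall>j\<in>{1..<i}. ip u (\<psi> j) = 0 \<Longrightarrow> L u = 0"
    and u: "u \<in> H"
  shows "L u = 0"
  using H\<psi> o L u
proof (induction i arbitrary: u)
  case 0
  then show ?case by simp
next
  case (Suc i)
  show ?case
  proof (rule Suc.IH)
    show "L u = 0" if u: "u \<in> H" and uo: "\<forall>j\<in>{1..<i}. ip u (\<psi> j) = 0" for u
    proof (cases "i = 0")
      case True
      then show ?thesis using Suc.prems(3)[OF u] by simp
    next
      case False
      then have i: "i \<in> {1..<Suc i}" by simp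
      let ?c = "- ip u (\<psi> i) / ip (\<psi> i) (\<psi> i)"
      have "L (comb u ?c (\<psi> i)) = 0"
      proof (rule Suc.prems(3))
        show "comb u ?c (\<psi> i) \<in> H"
          using Suc.prems(1)[OF i] u by (simp add: comb_in)
        show "\<forall>j\<in>{1..<Suc i}. ip (comb u ?c (\<psi> i)) (\<psi> j) = 0"
        proof
          fix j assume j: "j \<in> {1..<Suc i}"
          show "ip (comb u ?c (\<psi> i)) (\<psi> j) = 0"
            using Suc.prems(1)[OF i] Suc.prems(1)[OF j] Suc.prems(2)[OF i j] u uo j
            by (cases "j = i") (auto simp: ip_comb)
        qed
      qed
      then show ?thesis
        using Suc.prems(1)[OF i] u by (simp add: lin)
    qed
  qed (use Suc.prems in auto)
qed

lemma quadratic_nonneg_imp_zero: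
  assumes "\<And>t. 0 \<le> t * b + t\<^sup>2 * (c::real)"
  shows "b = 0"
proof (rule ccontr)
  assume b: "b \<noteq> 0"
  \<comment> \<open>Any positive d > c works: at t = - b / d the expression equals (b / d)^2 (c - d)
    < 0.\<close>
  define d where "d = \<bar>c\<bar> + 1"
  have d: "d > 0" "c < d" by (simp_all add: d_def)
  let ?t = "- b / d"
  have "?t * b + ?t\<^sup>2 * c = b\<^sup>2 / d\<^sup>2 * (c - d)"
    using d by (simp add: power2_eq_square field_simps)
  also have "\<dots> < 0"
    using b d by (intro mult_pos_neg) auto
  finally show False using assms[of ?t] by linarith
qed

proposition weak_eigen_if_att:
  assumes "reached \<psi> i" "att \<psi> i w"
  shows "weak_eigen (nu \<psi> i) w"
  using assms
proof (induction i arbitrary: w rule: less_induct)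
  case (less i)
  note r = less.prems(1)
  define l where "l = nu \<psi> i"
  have w: "w \<in> H" "ip w w \<noteq> 0" "\<And>j. j \<in> {1..<i} \<Longrightarrow> ip w (\<psi> j) = 0" "q w w = l * ip w w"
    using less.prems(2) by (auto simp: att_def comps_def l_def field_simps)
  have weak: "weak_eigen (nu \<psi> j) (\<psi> j)" if "j \<in> {1..<i}" for j
  proof (rule less.IH)
    show "j < i" using that by simp
    show "reached \<psi> j" "att \<psi> j (\<psi> j)"
      using r that by (auto simp: reached_def)
  qed
  define L where "L v = q w v - l * ip w v" for v
  have "L v = 0" if "v \<in> H" for v
  proof (rule annihilates_if_orthogonal[where L = L and \<psi> = \<psi> and i = i])
    show "L (comb u c v) = L u + c * L v" if "u \<in> H" "v \<in> H" for u v c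
      using that w(1) by (simp add: L_def q_comb_right ip_comb_right algebra_simps)
    show "ip (\<psi> j) (\<psi> l) = 0" if "j \<in> {1..<i}" "l \<in> {1..<i}" "j \<noteq> l" for j l
      by (rule reached_orthogonal[OF r that])
    show "\<psi> j \<in> H \<and> ip (\<psi> j) (\<psi> j) \<noteq> 0 \<and> L (\<psi> j) = 0" if j: "j \<in> {1..<i}" for j
    proof -
      \<comment> \<open>The earlier minimizer is already known to be an eigenvector, and w is
        orthogonal to it; symmetry of q moves the equation to the test vector \<psi> j.\<close>
      have "q (\<psi> j) w = nu \<psi> j * ip (\<psi> j) w"
        using weak[OF j] w(1) by (simp add: weak_eigen_def)
      then have "q w (\<psi> j) = 0"
        using w(3)[OF j] ip_sym[of "\<psi> j" w] q_sym[of "\<psi> j" w] by simp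
      then show ?thesis
        using w(3)[OF j] reached_in_H[OF r j] by (simp add: L_def)
    qed
    show "v \<in> H" by fact
    show "L u = 0" if u: "u \<in> H" "\<forall>j\<in>{1..<i}. ip u (\<psi> j) = 0" for u
    proof -
      \<comment> \<open>The variation w + t u stays admissible and q - l ip vanishes at w, so only
        the linear and the quadratic term remain.\<close>
      have "0 \<le> t * (2 * L u) + t\<^sup>2 * (q u u - l * ip u u)" for t
      proof -
        have "l * ip (comb w t u) (comb w t u) \<le> q (comb w t u) (comb w t u)"
          unfolding l_def
          by (rule form_nonneg) (use w u reached_in_H(1)[OF r] in \<open>auto simp: comb_in ip_comb\<close>)
        then show ?thesis
          using w(1,4) u(1) by (simp add: L_def q_comb_square ip_comb_square algebra_simps)
      qed
      from quadratic_nonneg_imp_zero[OF this] show ?thesis by simp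
    qed
  qed
  then show ?case using w(1) by (simp add: weak_eigen_def L_def l_def)
qed

text \<open>
  An orthonormal sequence with bounded Rayleigh quotients would be precompact for \<open>K\<close>, so
  coercivity would make its members arbitrarily close to each other.
\<close>

lemma no_infinite_orthogonal:
  fixes w :: "nat \<Rightarrow> 'f"
  assumes "l < k" and w: "\<And>n. w n \<in> H" "\<And>n. ip (w n) (w n) = 1" "\<And>m n. m \<noteq> n \<Longrightarrow> ip (w m) (w n) = 0"
    "\<And>m n. m \<noteq> n \<Longrightarrow> q (w m) (w n) = 0" "\<And>n. q (w n) (w n) \<le> l"
  shows False
proof -
  obtain s :: "nat \<Rightarrow> nat" where s: "strict_mono s"
    and K: "\<And>e. e > 0 \<Longrightarrow> \<exists>N. \<forall>m\<ge>N. \<forall>n\<ge>N.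
        K (comb (w (s m)) (-1) (w (s n))) (comb (w (s m)) (-1) (w (s n))) < e"
    using relatively_compact[of w l, OF w(1,2,5)] by metis
  \<comment> \<open>The difference of two orthonormal members has squared norm 2 and q at most 2 l,
    so coercivity demands K \<ge> 2 (k - l).\<close>
  from K[of "2 * (k - l)"] assms(1) obtain N where
    N: "\<forall>m\<ge>N. \<forall>n\<ge>N. K (comb (w (s m)) (-1) (w (s n))) (comb (w (s m)) (-1) (w (s n))) < 2 * (k - l)"
    by auto
  let ?u = "comb (w (s N)) (-1) (w (s (Suc N)))"
  have "s N \<noteq> s (Suc N)" using strict_monoD[OF s, of N "Suc N"] by simp
  then have ip2: "ip ?u ?u = 2" and q2: "q ?u ?u \<le> 2 * l"
    using add_mono[OF w(5)[of "s N"] w(5)[of "s (Suc N)"]]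
    by (simp_all add: ip_comb_square q_comb_square w)
  have "(k - l) * ip ?u ?u \<le> q ?u ?u - l * ip ?u ?u + K ?u ?u"
    by (rule coercive) (simp add: comb_in w)
  moreover have "K ?u ?u < 2 * (k - l)" using N by simp
  ultimately show False using ip2 q2 by simp
qed

proposition eigenvalue_is_nu:
  assumes run: "\<And>i. reached \<psi> i \<Longrightarrow> nu \<psi> i < k \<Longrightarrow> att \<psi> i (\<psi> i)"
    and u: "weak_eigen \<nu> u" "ip u u \<noteq> 0" and lt: "\<nu> < k"
  shows "\<exists>i. reached \<psi> i \<and> nu \<psi> i < k \<and> nu \<psi> i = \<nu>"
proof (rule ccontr)
  assume neg: "\<not> ?thesis"
  have uH: "u \<in> H" and u_eq: "q u u = \<nu> * ip u u"
    using u(1) by (auto simp: weak_eigen_def)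
  have orth: "ip u (\<psi> i) = 0" if "reached \<psi> i" "nu \<psi> i < k" for i
  proof -
    have w: "weak_eigen (nu \<psi> i) (\<psi> i)"
      using weak_eigen_if_att[OF that(1) run[OF that]] .
    \<comment> \<open>Symmetry of q equates both eigenvalue equations; as the eigenvalues differ,
      the product must vanish.\<close>
    then have "nu \<psi> i * ip (\<psi> i) u = \<nu> * ip u (\<psi> i)"
      using u(1) q_sym[of u "\<psi> i"] by (auto simp: weak_eigen_def)
    with neg that show ?thesis by (auto simp: ip_sym[of u])
  qed
  have le: "nu \<psi> i \<le> \<nu>" if "reached \<psi> i" for i
  proof -
    have "u \<in> comps \<psi> i"
      unfolding comps_def
    proof (intro CollectI conjI ballI uH u(2))
      fix j assume "j \<in> {1..<i}"
      then have "reached \<psi> j" "nu \<psi> j < k" using that by (auto simp: reached_def)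
      then show "ip u (\<psi> j) = 0" by (rule orth)
    qed
    from nu_le[OF this] u_eq u(2) show ?thesis by simp
  qed
  have reached: "reached \<psi> (Suc n)" for n
  proof (induction n)
    case 0
    show ?case by (simp add: reached_def)
  next
    case (Suc n)
    have "nu \<psi> (Suc n) < k" using le[OF Suc] lt by simp
    then have "att \<psi> (Suc n) (\<psi> (Suc n))" by (rule run[OF Suc])
    with Suc \<open>nu \<psi> (Suc n) < k\<close> show ?case
      by (simp add: reached_def atLeastLessThanSuc)
  qed
  have att: "att \<psi> (Suc n) (\<psi> (Suc n))" and lek: "nu \<psi> (Suc n) < k" for n
    using run[OF reached] le[OF reached, of n] lt by auto
  have \<psi>: "\<psi> (Suc n) \<in> H" "ip (\<psi> (Suc n)) (\<psi> (Suc n)) > 0" for n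
    using att[of n] ip_nonneg[of "\<psi> (Suc n)"] by (auto simp: att_def comps_def)
  have o: "ip (\<psi> (Suc m)) (\<psi> (Suc n)) = 0" if "m \<noteq> n" for m n
    using that by (intro reached_orthogonal[OF reached[of "Suc (max m n)"]]) auto
  have qe: "q (\<psi> (Suc m)) v = nu \<psi> (Suc m) * ip (\<psi> (Suc m)) v" if "v \<in> H" for m v
    using weak_eigen_if_att[OF reached att, of m] that by (simp add: weak_eigen_def)
  define t where "t n = 1 / sqrt (ip (\<psi> (Suc n)) (\<psi> (Suc n)))" for n
  define w where "w n = comb (\<psi> (Suc n)) (t n - 1) (\<psi> (Suc n))" for n
  have wH: "w n \<in> H" for n by (simp add: w_def comb_in \<psi>)
  have ipw: "ip (w n) v = t n * ip (\<psi> (Suc n)) v" if "v \<in> H" for n v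
    using that \<psi> by (simp add: w_def ip_comb algebra_simps)
  have qw: "q (w n) v = t n * q (\<psi> (Suc n)) v" if "v \<in> H" for n v
    using that \<psi> by (simp add: w_def q_comb algebra_simps)
  have ipw2: "ip (w m) (w n) = t m * t n * ip (\<psi> (Suc m)) (\<psi> (Suc n))" for m n
    using ipw[OF wH, of m n] ipw[OF \<psi>(1), of n m] ip_sym[of "\<psi> (Suc m)" "w n"]
      ip_sym[of "\<psi> (Suc m)" "\<psi> (Suc n)"] by simp
  have qw2: "q (w m) (w n) = nu \<psi> (Suc m) * ip (w m) (w n)" for m n
    by (simp add: qw[OF wH] qe[OF wH] ipw[OF wH])
  have one: "ip (w n) (w n) = 1" for n
    using \<psi>(2)[of n] by (simp add: ipw2 t_def)
  show False
    by (rule no_infinite_orthogonal[of \<nu> w])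
      (use lt wH one le[OF reached] o in \<open>simp_all add: qw2 ipw2\<close>)
qed

end

subsection \<open>Application to the singular problem\<close>

text \<open>The factor X tames the weight at 0 and 1 - X provides the boundary value at 1;
  multiplication by both is linear and injective in p.\<close>

definition test_poly :: "real poly \<Rightarrow> real poly"
  where "test_poly p = [:0, 1:] * ([:1, - 1:] * p)"

proposition rayleigh_forms_cal_H0:
  assumes M: "2 \<le> M" and a: "a \<in> borel_measurable unit_ival" and aA: "AE r in unit_ival. \<bar>a r\<bar> \<le> A"
  shows "rayleigh_forms (cal_H0 M) (\<lambda>u c v r. u r + c * v r) (inner_L M) (D_form M) (K_form a M) A
    (((M - 2) / 2)\<^sup>2) (\<lambda>p. poly (test_poly p))"
proof
  have M1: "1 \<le> M" using M by simp
  note d = cal_H0_D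
  have ii: "integrable unit_ival (\<lambda>r. r powr (M - 3) * (u r * v r))" if "u \<in> cal_H0 M" "v \<in> cal_H0 M" for u v
    using d[OF that(1)] d[OF that(2)] by (intro weighted_mult_integrable)
  have iD: "integrable unit_ival (\<lambda>r. r powr (M - 1) * (weak_deriv u r * weak_deriv v r))" if "u \<in> cal_H0 M" "v \<in> cal_H0 M" for u v
    using d[OF that(1)] d[OF that(2)] by (intro weighted_mult_integrable)
  have iK: "integrable unit_ival (\<lambda>r. r powr (M - 1) * (a r * u r * v r))" if "u \<in> cal_H0 M" "v \<in> cal_H0 M" for u v
  proof -
    have "integrable unit_ival (\<lambda>r. r powr (M - 1) * (u r * v r) * a r)"
      using d[OF that(1)] d[OF that(2)]
      by (intro integrable_mult_bounded[OF _ a aA] weighted_mult_integrable)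
    then show ?thesis by (simp add: mult_ac)
  qed
  \<comment> \<open>The weight r^(M-1) is retained here because compactness is available for it; the
    bound by \<open>inner_L\<close> follows from r^(M-1) \<le> r^(M-3).\<close>
  have K_abs: "\<bar>K_form a M u u\<bar> \<le> A * (\<integral>r. r powr (M - 1) * (u r)\<^sup>2 \<partial>unit_ival)" if u: "u \<in> cal_H0 M" for u
  proof -
    have "\<bar>K_form a M u u\<bar> \<le> (\<integral>r. \<bar>r powr (M - 1) * (a r * u r * u r)\<bar> \<partial>unit_ival)"
      unfolding K_form_def by (rule integral_abs_bound)
    also have "\<dots> \<le> (\<integral>r. A * (r powr (M - 1) * (u r)\<^sup>2) \<partial>unit_ival)"
    proof (rule integral_mono_AE)
      show "AE r in unit_ival. \<bar>r powr (M - 1) * (a r * u r * u r)\<bar> \<le> A * (r powr (M - 1) * (u r)\<^sup>2)"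
        using aA
      proof eventually_elim
        case (elim r)
        have "\<bar>r powr (M - 1) * (a r * u r * u r)\<bar> = \<bar>a r\<bar> * (r powr (M - 1) * (u r)\<^sup>2)"
          by (simp add: abs_mult power2_eq_square)
        also have "\<dots> \<le> A * (r powr (M - 1) * (u r)\<^sup>2)" using elim by (intro mult_right_mono) auto
        finally show ?case .
      qed
    qed (use iK[OF u u] d[OF u] in auto)
    finally show ?thesis by simp
  qed
  \<comment> \<open>An almost everywhere bound could be negative only if (0,1) were a null
    set.\<close>
  have A0: "0 \<le> A"
  proof (rule ccontr)
    assume "\<not> 0 \<le> A"
    with aA have "AE r in unit_ival. poly 1 r = (0::real)" by (auto elim!: eventually_mono)
    moreover have "nonzero_fun (poly 1)" by (rule nonzero_fun_poly) simp
    ultimately show False by (simp add: nonzero_fun_def)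
  qed
  show comb: "(\<lambda>r. u r + c * v r) \<in> cal_H0 M" if "u \<in> cal_H0 M" "v \<in> cal_H0 M" for u v c
    by (rule cal_H0_comb(1)[OF that M1])
  show "inner_L M (\<lambda>r. u r + c * v r) w = inner_L M u w + c * inner_L M v w"
    if "u \<in> cal_H0 M" "v \<in> cal_H0 M" "w \<in> cal_H0 M" for u v w c
  proof -
    have "inner_L M (\<lambda>r. u r + c * v r) w = (\<integral>r. r powr (M - 3) * (u r * w r) + c * (r powr (M - 3) * (v r * w r)) \<partial>unit_ival)"
      unfolding inner_L_def by (simp add: algebra_simps)
    also have "\<dots> = inner_L M u w + c * inner_L M v w"
      unfolding inner_L_def using ii that by simp
    finally show ?thesis .
  qed
  show "K_form a M (\<lambda>r. u r + c * v r) w = K_form a M u w + c * K_form a M v w"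
    if "u \<in> cal_H0 M" "v \<in> cal_H0 M" "w \<in> cal_H0 M" for u v w c
  proof -
    have "K_form a M (\<lambda>r. u r + c * v r) w = (\<integral>r. r powr (M - 1) * (a r * u r * w r) + c * (r powr (M - 1) * (a r * v r * w r)) \<partial>unit_ival)"
      unfolding K_form_def by (simp add: algebra_simps)
    also have "\<dots> = K_form a M u w + c * K_form a M v w"
      unfolding K_form_def using iK that by simp
    finally show ?thesis .
  qed
  show "D_form M (\<lambda>r. u r + c * v r) w = D_form M u w + c * D_form M v w"
    if u: "u \<in> cal_H0 M" and v: "v \<in> cal_H0 M" and w: "w \<in> cal_H0 M" for u v w c
  proof -
    have "D_form M (\<lambda>r. u r + c * v r) w = (\<integral>r. r powr (M - 1) * (weak_deriv u r * weak_deriv w r) + c * (r powr (M - 1) * (weak_deriv v r * weak_deriv w r)) \<partial>unit_ival)"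
      unfolding D_form_def
    proof (rule integral_cong_AE)
      show "(\<lambda>r. r powr (M - 1) * (weak_deriv (\<lambda>r. u r + c * v r) r * weak_deriv w r)) \<in> borel_measurable unit_ival"
        by (rule borel_measurable_integrable[OF iD[OF comb[OF u v] w]])
      show "(\<lambda>r. r powr (M - 1) * (weak_deriv u r * weak_deriv w r) + c * (r powr (M - 1) * (weak_deriv v r * weak_deriv w r))) \<in> borel_measurable unit_ival"
        using iD[OF u w] iD[OF v w] by (intro borel_measurable_integrable) simp
      show "AE r in unit_ival. r powr (M - 1) * (weak_deriv (\<lambda>r. u r + c * v r) r * weak_deriv w r)
          = r powr (M - 1) * (weak_deriv u r * weak_deriv w r) + c * (r powr (M - 1) * (weak_deriv v r * weak_deriv w r))"
        using cal_H0_comb(2)[OF u v M1, of c] by eventually_elim (simp add: algebra_simps)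
    qed
    also have "\<dots> = D_form M u w + c * D_form M v w"
      unfolding D_form_def using iD u v w by simp
    finally show ?thesis .
  qed
  show "inner_L M u v = inner_L M v u" "D_form M u v = D_form M v u" "K_form a M u v = K_form a M v u" for u v
    by (simp_all add: inner_L_def D_form_def K_form_def mult_ac)
  show "0 \<le> inner_L M u u" for u by (rule inner_L_nonneg)
  show "((M - 2) / 2)\<^sup>2 * inner_L M u u \<le> D_form M u u" if "u \<in> cal_H0 M" for u
    by (rule Hardy_inequality[OF that M])
  show "\<bar>K_form a M u u\<bar> \<le> A * inner_L M u u" if u: "u \<in> cal_H0 M" for u
  proof -
    have "(\<integral>r. r powr (M - 1) * (u r)\<^sup>2 \<partial>unit_ival) \<le> (\<integral>r. r powr (M - 3) * (u r)\<^sup>2 \<partial>unit_ival)"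
      by (rule integral_mono_AE) (use d[OF u] in \<open>auto intro!: AE_unit_I mult_right_mono powr_mono'\<close>)
    then have "A * (\<integral>r. r powr (M - 1) * (u r)\<^sup>2 \<partial>unit_ival) \<le> A * inner_L M u u"
      unfolding inner_L_self using A0 by (rule mult_left_mono)
    with K_abs[OF u] show ?thesis by linarith
  qed
  show "0 \<le> ((M - 2) / 2)\<^sup>2" by simp
  show "\<exists>u\<in>cal_H0 M. (\<lambda>n. inner_L M (\<lambda>r. f n r + - 1 * u r) (\<lambda>r. f n r + - 1 * u r)
        + D_form M (\<lambda>r. f n r + - 1 * u r) (\<lambda>r. f n r + - 1 * u r)) \<longlonglongrightarrow> 0"
    if "\<And>n. f n \<in> cal_H0 M" "\<And>e. e > 0 \<Longrightarrow> \<exists>N::nat. \<forall>m\<ge>N. \<forall>n\<ge>N.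
        inner_L M (\<lambda>r. f m r + - 1 * f n r) (\<lambda>r. f m r + - 1 * f n r)
        + D_form M (\<lambda>r. f m r + - 1 * f n r) (\<lambda>r. f m r + - 1 * f n r) < e" for f
    by (rule cal_H0_complete[OF M that])
  show "\<exists>s::nat \<Rightarrow> nat. strict_mono s \<and> (\<forall>e>0. \<exists>N. \<forall>m\<ge>N. \<forall>n\<ge>N.
        K_form a M (\<lambda>r. f (s m) r + - 1 * f (s n) r) (\<lambda>r. f (s m) r + - 1 * f (s n) r) < e)"
    if f: "\<And>n. f n \<in> cal_H0 M" and C: "\<And>n. inner_L M (f n) (f n) + D_form M (f n) (f n) \<le> C" for f C
  proof -
    obtain s :: "nat \<Rightarrow> nat" and h where s: "strict_mono s" and hm: "h \<in> borel_measurable unit_ival"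
      and ih: "\<And>n. integrable unit_ival (\<lambda>r. r powr (M - 1) * (f (s n) r - h r)\<^sup>2)"
      and lim: "(\<lambda>n. \<integral>r. r powr (M - 1) * (f (s n) r - h r)\<^sup>2 \<partial>unit_ival) \<longlonglongrightarrow> 0"
      by (rule cal_H0_compact[where w = f, OF M f C]) (rule that)
    let ?T = "\<lambda>n. \<integral>r. r powr (M - 1) * (f (s n) r - h r)\<^sup>2 \<partial>unit_ival"
    have le: "K_form a M (\<lambda>r. f (s m) r + - 1 * f (s n) r) (\<lambda>r. f (s m) r + - 1 * f (s n) r)
        \<le> A * (2 * ?T m + 2 * ?T n)" for m n
    proof -
      let ?u = "\<lambda>r. f (s m) r + - 1 * f (s n) r"
      have "(\<integral>r. r powr (M - 1) * (?u r)\<^sup>2 \<partial>unit_ival)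
          \<le> (\<integral>r. 2 * (r powr (M - 1) * (f (s m) r - h r)\<^sup>2) + 2 * (r powr (M - 1) * (f (s n) r - h r)\<^sup>2) \<partial>unit_ival)"
      proof (rule integral_mono_AE)
        show "integrable unit_ival (\<lambda>r. r powr (M - 1) * (?u r)\<^sup>2)"
          by (rule d(5)[OF comb[OF f f]])
        show "AE r in unit_ival. r powr (M - 1) * (?u r)\<^sup>2
            \<le> 2 * (r powr (M - 1) * (f (s m) r - h r)\<^sup>2) + 2 * (r powr (M - 1) * (f (s n) r - h r)\<^sup>2)"
        proof (rule AE_unit_I)
          fix r
          have "0 \<le> r powr (M - 1) * ((f (s m) r - h r) + (f (s n) r - h r))\<^sup>2" by simp
          then show "r powr (M - 1) * (?u r)\<^sup>2
            \<le> 2 * (r powr (M - 1) * (f (s m) r - h r)\<^sup>2) + 2 * (r powr (M - 1) * (f (s n) r - h r)\<^sup>2)"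
            by (simp add: power2_eq_square algebra_simps)
        qed
      qed (use ih in simp)
      also have "\<dots> = 2 * ?T m + 2 * ?T n" using ih by simp
      finally have "A * (\<integral>r. r powr (M - 1) * (?u r)\<^sup>2 \<partial>unit_ival) \<le> A * (2 * ?T m + 2 * ?T n)"
        using A0 by (rule mult_left_mono)
      with K_abs[OF comb[OF f f, of "s m" "- 1" "s n"]] show ?thesis by linarith
    qed
    have "\<exists>N. \<forall>m\<ge>N. \<forall>n\<ge>N. K_form a M (\<lambda>r. f (s m) r + - 1 * f (s n) r) (\<lambda>r. f (s m) r + - 1 * f (s n) r) < e"
      if e: "e > 0" for e
    proof -
      have "(\<lambda>n. A * (2 * ?T n)) \<longlonglongrightarrow> A * (2 * 0)" by (intro tendsto_mult_left lim)
      then have "\<forall>\<^sub>F n in sequentially. A * (2 * ?T n) < e / 2"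
        using e by (intro order_tendstoD(2)) auto
      then obtain N where N: "\<And>n. n \<ge> N \<Longrightarrow> A * (2 * ?T n) < e / 2"
        unfolding eventually_sequentially by blast
      show ?thesis
      proof (intro exI allI impI)
        fix m n assume mn: "m \<ge> N" "n \<ge> N"
        show "K_form a M (\<lambda>r. f (s m) r + - 1 * f (s n) r) (\<lambda>r. f (s m) r + - 1 * f (s n) r) < e"
          using N[OF mn(1)] N[OF mn(2)] le[of m n] unfolding distrib_left by linarith
      qed
    qed
    with s show ?thesis by blast
  qed
  show E: "poly (test_poly p) \<in> cal_H0 M" for p
    by (rule poly_in_cal_H0[OF M]) (simp_all add: test_poly_def)
  show "poly (test_poly (p + smult c p')) = (\<lambda>r. poly (test_poly p) r + c * poly (test_poly p') r)" for p c p'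
    by (rule ext) (simp add: test_poly_def algebra_simps)
  show "inner_L M (poly (test_poly p)) (poly (test_poly p)) \<noteq> 0" if "p \<noteq> 0" for p
  proof -
    have "test_poly p \<noteq> 0" using that by (simp add: test_poly_def del: mult_pCons_left)
    then show ?thesis
      using inner_L_self_eq_0_iff[OF d(4)[OF E]] nonzero_fun_poly by blast
  qed
qed

theorem proposition3p10:
  fixes M :: real and a :: "real \<Rightarrow> real"
  assumes "M \<ge> 2" and "a \<in> L_infty"
  shows "(\<forall>\<psi> i. step_reached a M \<psi> i \<and> nu_hat a M \<psi> i < ((M - 2) / 2)\<^sup>2 \<longrightarrow>
            (\<exists>w. attains a M \<psi> i w) \<and>
            (\<forall>w. attains a M \<psi> i w \<longrightarrow> weak_solution_S a M (nu_hat a M \<psi> i) w)) \<and>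
         (\<forall>\<psi>. complete_run a M \<psi> \<longrightarrow>
            {\<nu>. eigenvalue_S a M \<nu> \<and> \<nu> < ((M - 2) / 2)\<^sup>2} =
            {nu_hat a M \<psi> i | i. step_reached a M \<psi> i \<and> nu_hat a M \<psi> i < ((M - 2) / 2)\<^sup>2})"
proof -
  obtain A where a: "a \<in> borel_measurable unit_ival" and aA: "AE r in unit_ival. \<bar>a r\<bar> \<le> A"
    using assms(2) by (auto simp: L_infty_def)
  interpret R: rayleigh_forms "cal_H0 M" "\<lambda>u c v r. u r + c * v r" "inner_L M" "D_form M" "K_form a M" A
    "((M - 2) / 2)\<^sup>2" "\<lambda>p. poly (test_poly p)"
    by (rule rayleigh_forms_cal_H0[OF assms(1) a aA])
  \<comment> \<open>One integral splits into two only when both parts are integrable, hence the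
    restriction to \<open>cal_H0 M\<close>.\<close>
  have q: "R.q u v = (\<integral>r. r powr (M - 1) * (weak_deriv u r * weak_deriv v r - a r * u r * v r) \<partial>unit_ival)"
    if "u \<in> cal_H0 M" "v \<in> cal_H0 M" for u v
  proof -
    have "integrable unit_ival (\<lambda>r. r powr (M - 1) * (weak_deriv u r * weak_deriv v r))"
      using cal_H0_D[OF that(1)] cal_H0_D[OF that(2)] by (intro weighted_mult_integrable)
    moreover have "integrable unit_ival (\<lambda>r. r powr (M - 1) * (u r * v r) * a r)"
      using cal_H0_D[OF that(1)] cal_H0_D[OF that(2)]
      by (intro integrable_mult_bounded[OF _ a aA] weighted_mult_integrable)
    then have "integrable unit_ival (\<lambda>r. r powr (M - 1) * (a r * u r * v r))" by (simp add: mult_ac)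
    ultimately show ?thesis
      by (simp add: R.q_def D_form_def K_form_def right_diff_distrib)
  qed
  have nz: "nonzero_fun w \<longleftrightarrow> inner_L M w w \<noteq> 0" if "w \<in> cal_H0 M" for w
    using inner_L_self_eq_0_iff[OF cal_H0_D(4)[OF that]] by blast
  have ray: "rayleigh a M w = R.q w w / inner_L M w w" if "w \<in> cal_H0 M" for w
    unfolding rayleigh_def Q_form_def q[OF that that] inner_L_self
    by (simp add: power2_eq_square mult.assoc)
  have comps: "competitors M \<psi> i = R.comps \<psi> i" for \<psi> i
    unfolding competitors_def R.comps_def orth_L_def using nz by blast
  have nu: "nu_hat a M \<psi> i = R.nu \<psi> i" for \<psi> i
    unfolding nu_hat_def R.nu_def comps
    by (rule arg_cong[where f = Inf], rule image_cong) (auto simp: R.comps_def ray)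
  have att: "attains a M \<psi> i w \<longleftrightarrow> R.att \<psi> i w" for \<psi> i w
    unfolding attains_def R.att_def comps nu using ray by (auto simp: R.comps_def)
  have reached: "step_reached a M \<psi> i \<longleftrightarrow> R.reached \<psi> i" for \<psi> i
    unfolding step_reached_def R.reached_def nu att ..
  have weak: "weak_solution_S a M \<nu> w \<longleftrightarrow> R.weak_eigen \<nu> w" for \<nu> w
    unfolding weak_solution_S_def R.weak_eigen_def using q by (auto simp: inner_L_def)
  have "{\<nu>. eigenvalue_S a M \<nu> \<and> \<nu> < ((M - 2) / 2)\<^sup>2} =
      {R.nu \<psi> i | i. R.reached \<psi> i \<and> R.nu \<psi> i < ((M - 2) / 2)\<^sup>2}" if "complete_run a M \<psi>" for \<psi>
  proof (intro set_eqI iffI)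
    have run: "R.att \<psi> i (\<psi> i)" if "R.reached \<psi> i" "R.nu \<psi> i < ((M - 2) / 2)\<^sup>2" for i
      using \<open>complete_run a M \<psi>\<close> that unfolding complete_run_def nu att reached by blast
    fix \<nu>
    {
      assume "\<nu> \<in> {\<nu>. eigenvalue_S a M \<nu> \<and> \<nu> < ((M - 2) / 2)\<^sup>2}"
      then obtain u where "nonzero_fun u" "R.weak_eigen \<nu> u" and lt: "\<nu> < ((M - 2) / 2)\<^sup>2"
        by (auto simp: eigenvalue_S_def weak)
      then have "inner_L M u u \<noteq> 0" using nz by (auto simp: R.weak_eigen_def)
      from R.eigenvalue_is_nu[OF run \<open>R.weak_eigen \<nu> u\<close> this lt]
      show "\<nu> \<in> {R.nu \<psi> i | i. R.reached \<psi> i \<and> R.nu \<psi> i < ((M - 2) / 2)\<^sup>2}" by blast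
    next
      assume "\<nu> \<in> {R.nu \<psi> i | i. R.reached \<psi> i \<and> R.nu \<psi> i < ((M - 2) / 2)\<^sup>2}"
      then obtain i where i: "R.reached \<psi> i" "R.nu \<psi> i < ((M - 2) / 2)\<^sup>2" "\<nu> = R.nu \<psi> i" by blast
      have "R.weak_eigen \<nu> (\<psi> i)"
        unfolding i(3) by (rule R.weak_eigen_if_att[OF i(1) run[OF i(1,2)]])
      moreover have "nonzero_fun (\<psi> i)"
        using run[OF i(1,2)] nz by (auto simp: R.att_def R.comps_def)
      ultimately show "\<nu> \<in> {\<nu>. eigenvalue_S a M \<nu> \<and> \<nu> < ((M - 2) / 2)\<^sup>2}"
        using i by (auto simp: eigenvalue_S_def weak)
    }
  qed
  then show ?thesis
    unfolding nu att reached weak using R.attained R.weak_eigen_if_att by blast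
qed

end
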